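(* Let $G$ and $H$ be two finitely generated groups such that $G\approx H$, i.e. $\mathrm{Con}(G)=\mathrm{Con}(H)$. If $G$ is torsion-free nilpotent of class $c$ with Hirsch length $h$, then $H$ is also torsion-free nilpotent of class $c$ with Hirsch length $h$.
   Context: Let $G$ be a finitely generated group. Given a finite generating sequence $\mathfrak g=(g_1,\dots,g_n)$ of $G$ and a finite (indexed) partition $\mathcal E=\{E_1,\dots,E_m\}$ of $G$ into nonempty, pairwise disjoint subsets, a configuration corresponding to $(\mathfrak g,\mathcal E)$ is an $(n+1)$-tuple $C=(c_0,c_1,\dots,c_n)$ with $1\le c_i\le m$ for each $i$ such that there is $x\in G$ with $x\in E_{c_0}$ and $g_ix\in E_{c_i}$ for each $1\le i\le n$. The set of all configurations corresponding to $(\mathfrak g,\mathcal E)$ is denoted $\mathrm{Con}(\mathfrak g,\mathcal E)$, and $\mathrm{Con}(G)$ denotes the set of all $\mathrm{Con}(\mathfrak g,\mathcal E)$ as $\mathfrak g$ runs over the finite generating sequences of $G$ and $\mathcal E$ over the finite partitions of $G$. Finitely generated groups $G_1,G_2$ are called configuration equivalent, written $G_1\approx G_2$, if $\mathrm{Con}(G_1)=\mathrm{Con}(G_2)$. The Hirsch length of a polycyclic group (in particular, of a finitely generated nilpotent group) is the number of infinite factors in a series with cyclic factors; it is independent of the series. *)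

theory Defs
  imports "HOL-Algebra.Algebra" "HOL-Library.Disjoint_Sets"
begin

section \<open>Configurations\<close>

definition finitely_generated :: "('a, 'b) monoid_scheme \<Rightarrow> bool" where
  "finitely_generated G \<longleftrightarrow>
     (\<exists>S. finite S \<and> S \<subseteq> carrier G \<and> generate G S = carrier G)"

definition generating_sequence :: "('a, 'b) monoid_scheme \<Rightarrow> 'a list \<Rightarrow> bool" where
  "generating_sequence G gs \<longleftrightarrow> set gs \<subseteq> carrier G \<and> generate G (set gs) = carrier G"

text \<open>Only the values \<open>E 1, \<dots>, E m\<close> of the function \<open>E\<close> are used.\<close>

definition indexed_partition :: "('a, 'b) monoid_scheme \<Rightarrow> nat \<Rightarrow> (nat \<Rightarrow> 'a set) \<Rightarrow> bool" where
  "indexed_partition G m E \<longleftrightarrow>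
     (\<forall>j\<in>{1..m}. E j \<noteq> {}) \<and> disjoint_family_on E {1..m} \<and> (\<Union>j\<in>{1..m}. E j) = carrier G"

text \<open>The tuple \<open>(c\<^sub>0, c\<^sub>1, \<dots>, c\<^sub>n)\<close> is the list \<open>C\<close> with \<open>C ! i = c\<^sub>i\<close>. Lists are indexed
  from \<open>0\<close>, so \<open>gs ! i\<close> is the generator with number \<open>Suc i\<close>.\<close>

definition configuration ::
  "('a, 'b) monoid_scheme \<Rightarrow> 'a list \<Rightarrow> nat \<Rightarrow> (nat \<Rightarrow> 'a set) \<Rightarrow> nat list \<Rightarrow> bool" where
  "configuration G gs m E C \<longleftrightarrow>
     length C = Suc (length gs) \<and> set C \<subseteq> {1..m} \<and>
     (\<exists>x\<in>carrier G. x \<in> E (C ! 0) \<and>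
        (\<forall>i<length gs. gs ! i \<otimes>\<^bsub>G\<^esub> x \<in> E (C ! Suc i)))"

definition Con_pair ::
  "('a, 'b) monoid_scheme \<Rightarrow> 'a list \<Rightarrow> nat \<Rightarrow> (nat \<Rightarrow> 'a set) \<Rightarrow> nat list set" where
  "Con_pair G gs m E = {C. configuration G gs m E C}"

definition Con :: "('a, 'b) monoid_scheme \<Rightarrow> nat list set set" where
  "Con G = {Con_pair G gs m E | gs m E. generating_sequence G gs \<and> indexed_partition G m E}"

definition configuration_equivalent ::
  "('a, 'c) monoid_scheme \<Rightarrow> ('b, 'd) monoid_scheme \<Rightarrow> bool" where
  "configuration_equivalent G H \<longleftrightarrow> Con G = Con H"

section \<open>Torsion-free and nilpotent groups, Hirsch length\<close>

definition torsion_free :: "('a, 'b) monoid_scheme \<Rightarrow> bool" where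
  "torsion_free G \<longleftrightarrow>
     (\<forall>x\<in>carrier G. \<forall>n::nat. 0 < n \<and> x [^]\<^bsub>G\<^esub> n = \<one>\<^bsub>G\<^esub> \<longrightarrow> x = \<one>\<^bsub>G\<^esub>)"

text \<open>The term with index \<open>n\<close> is the subgroup usually written \<open>\<gamma>\<close> with index \<open>n + 1\<close>.\<close>

primrec lower_central :: "('a, 'b) monoid_scheme \<Rightarrow> nat \<Rightarrow> 'a set" where
  "lower_central G 0 = carrier G"
| "lower_central G (Suc n) = generate G
     (\<Union>x\<in>lower_central G n. \<Union>y\<in>carrier G. {x \<otimes>\<^bsub>G\<^esub> y \<otimes>\<^bsub>G\<^esub> inv\<^bsub>G\<^esub> x \<otimes>\<^bsub>G\<^esub> inv\<^bsub>G\<^esub> y})"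

text \<open>The class is the exact one; the trivial group is nilpotent of class \<open>0\<close>.\<close>

definition nilpotent_of_class :: "('a, 'b) monoid_scheme \<Rightarrow> nat \<Rightarrow> bool" where
  "nilpotent_of_class G c \<longleftrightarrow>
     lower_central G c = {\<one>\<^bsub>G\<^esub>} \<and> (\<forall>d<c. lower_central G d \<noteq> {\<one>\<^bsub>G\<^esub>})"

abbreviation series_factor ::
  "('a, 'b) monoid_scheme \<Rightarrow> (nat \<Rightarrow> 'a set) \<Rightarrow> nat \<Rightarrow> 'a set monoid" where
  "series_factor G K i \<equiv> (G\<lparr>carrier := K (Suc i)\<rparr>) Mod K i"

definition cyclic_series ::
  "('a, 'b) monoid_scheme \<Rightarrow> nat \<Rightarrow> (nat \<Rightarrow> 'a set) \<Rightarrow> bool" where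
  "cyclic_series G r K \<longleftrightarrow>
     K 0 = {\<one>\<^bsub>G\<^esub>} \<and> K r = carrier G \<and>
     (\<forall>i<r. subgroup (K (Suc i)) G \<and> K i \<lhd> (G\<lparr>carrier := K (Suc i)\<rparr>) \<and>
            cyclic_group (series_factor G K i))"

text \<open>The Hirsch length does not depend on the series, so it is stated as a relation that holds
  when some series has the given number of infinite factors. The relation holds for no number
  if the group is not polycyclic.\<close>

definition has_hirsch_length :: "('a, 'b) monoid_scheme \<Rightarrow> nat \<Rightarrow> bool" where
  "has_hirsch_length G h \<longleftrightarrow>
     (\<exists>r K. cyclic_series G r K \<and>
            card {i. i < r \<and> infinite (carrier (series_factor G K i))} = h)"

end

theory Submission
  imports Defs
begin

text \<open>
  Let \<open>Con G = Con H\<close>. Partitioning \<open>G\<close> into the cosets of a normal subgroup \<open>N\<close> of finite index, each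
  configuration is determined by its first entry, so \<open>H\<close> acts on the classes through a surjection
  onto \<open>G / N\<close>: the groups have the same finite quotients. Partitioning \<open>G\<close> into a finite set of
  singletons and the rest lets one follow a group word in both groups: they satisfy the same laws,
  so they have the same nilpotency class.

  If \<open>G\<close> has a series with cyclic factors, \<open>h\<close> of them infinite, then a section \<open>S / S0\<close> of exponent
  \<open>p\<close> has at most \<open>p ^ h\<close> elements when \<open>p\<close> is prime to the orders of the finite factors. Conversely
  every \<open>p\<close> admits such a section with \<open>p ^ h\<close> elements and \<open>S0\<close> of finite index: in a step
  \<open>A = B\<langle>a\<rangle>\<close> with infinite factor a power of \<open>a\<close> acts trivially on the finite quotient of
  \<open>B\<close> by its \<open>n\<close>-th powers, so \<open>S / S0\<close> is enlarged by a direct cyclic factor. Hence finite quotients determine \<open>h\<close>.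

  Finally, torsion in the nilpotent group \<open>H\<close> gives a central element \<open>t\<close> of some order \<open>q\<close>, and starting the
  construction with \<open>\<langle>t\<rangle>\<close> yields a section of exponent \<open>q\<close> with \<open>q ^ (h + 1)\<close> elements. A torsion-free
  nilpotent group \<open>G\<close> has a series with all factors infinite cyclic, which bounds such sections by
  \<open>q ^ h\<close> for every \<open>q\<close>.
\<close>

section \<open>Polycyclic groups\<close>

text \<open>Sections \<open>S / S0\<close> are counted, and not quotients of the whole group,
  because the latter can be too small: the largest quotient of exponent 2 of the integral Heisenberg
  group has 4 elements, while its Hirsch length is 3. The price is that \<open>S0\<close> need not
  be normal in the group, whereas only normal subgroups of finite index are compared through
  configurations. Subgroups generated by all \<open>n\<close>-th powers repair this: they are
  invariant under conjugation, have finite index, and lie inside \<open>S0\<close> for suitable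
  \<open>n\<close>.

  Large sections exist for every exponent, but the upper bound needs an exponent prime to the finite
  factors. For the Hirsch length it can be chosen after the series of the other group is known. In
  the torsion argument it is dictated by the order of \<open>t\<close>, so \<open>G\<close> must
  offer a series with no nontrivial finite factor. Such a series is built along the upper central
  series, since lower central factors can have torsion even in a torsion-free nilpotent group.
  Independence of the Hirsch length from the series comes out of the same inequality, applied to
  \<open>G\<close> and itself.\<close>

lemma int_subgroup_generator:
  fixes J :: "int set"
  assumes "0 \<in> J" and diff: "\<And>i j. i \<in> J \<Longrightarrow> j \<in> J \<Longrightarrow> i - j \<in> J"
  obtains d where "d \<in> J" "\<And>j. j \<in> J \<Longrightarrow> d dvd j"
proof (cases "J \<subseteq> {0}")
  case True
  then show ?thesis using assms that[of 0] by auto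
next
  case False
  have neg: "- i \<in> J" if "i \<in> J" for i using diff[OF \<open>0 \<in> J\<close> that] by simp
  have plus: "i + j \<in> J" if "i \<in> J" "j \<in> J" for i j using diff[OF that(1) neg[OF that(2)]] by simp
  obtain j where j: "j \<in> J" "j \<noteq> 0" using False by auto
  have ex: "\<exists>n::nat. 0 < n \<and> int n \<in> J"
    using j neg[OF j(1)] by (cases "j > 0") (auto intro: exI[of _ "nat \<bar>j\<bar>"])
  define n where "n = (LEAST n::nat. 0 < n \<and> int n \<in> J)"
  have n: "0 < n" "int n \<in> J" using LeastI_ex[OF ex] unfolding n_def by auto
  have least: "n \<le> m" if "0 < m" "int m \<in> J" for m
    unfolding n_def using that by (intro Least_le) auto
  have mult_nat: "int k * int n \<in> J" for k
    by (induction k) (use assms n plus in \<open>auto simp: algebra_simps\<close>)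
  have mult: "k * int n \<in> J" for k
    using mult_nat[of "nat \<bar>k\<bar>"] neg[of "\<bar>k\<bar> * int n"] by (cases "k \<ge> 0") auto
  have "int n dvd j" if "j \<in> J" for j
  proof -
    have "j - (j div int n) * int n \<in> J" using diff[OF that mult] .
    then have "j mod int n \<in> J" by (simp add: minus_div_mult_eq_mod)
    moreover have "0 \<le> j mod int n" "j mod int n < int n" using n by auto
    ultimately have "j mod int n = 0"
      using least[of "nat (j mod int n)"] by (cases "j mod int n = 0") auto
    then show ?thesis by auto
  qed
  then show ?thesis using that n(2) by blast
qed

context group
begin

lemma inv_cancel_left [simp]:
  assumes "x \<in> carrier G" "y \<in> carrier G"
  shows "x \<otimes> (inv x \<otimes> y) = y" "inv x \<otimes> (x \<otimes> y) = y"
  using assms by (simp_all add: m_assoc [symmetric])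

lemma subgroup_nat_pow_closed:
  "subgroup H G \<Longrightarrow> x \<in> H \<Longrightarrow> x [^] (n::nat) \<in> H"
  by (induction n) (auto intro: subgroup.one_closed subgroup.m_closed)

lemma conj_pow:
  assumes "x \<in> carrier G" "y \<in> carrier G"
  shows "(x \<otimes> y \<otimes> inv x) [^] (n::nat) = x \<otimes> y [^] n \<otimes> inv x"
  using assms by (induction n) (simp_all add: m_assoc)

subsection \<open>Cyclic extensions and series with cyclic factors\<close>

text \<open>\<open>A / B\<close> is cyclic, generated by the image of \<open>a\<close>. The
  elementwise form spares the formation of quotient groups; a trivial or finite factor is allowed,
  so exponents of \<open>a\<close> are not unique.\<close>

definition cyclic_ext :: "'a set \<Rightarrow> 'a \<Rightarrow> 'a set \<Rightarrow> bool" where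
  "cyclic_ext B a A \<longleftrightarrow> subgroup B G \<and> subgroup A G \<and> B \<subseteq> A \<and>
     (\<forall>x\<in>A. \<forall>b\<in>B. x \<otimes> b \<otimes> inv x \<in> B) \<and> a \<in> A \<and>
     (\<forall>x\<in>A. \<exists>b\<in>B. \<exists>j::int. x = b \<otimes> a [^] j)"

lemma cyclic_extD:
  assumes "cyclic_ext B a A"
  shows "subgroup B G" "subgroup A G" "B \<subseteq> A" "a \<in> A" "a \<in> carrier G"
    and "\<And>x b. x \<in> A \<Longrightarrow> b \<in> B \<Longrightarrow> x \<otimes> b \<otimes> inv x \<in> B"
    and "\<And>x. x \<in> A \<Longrightarrow> \<exists>b\<in>B. \<exists>j::int. x = b \<otimes> a [^] j"
    and "\<And>b. b \<in> B \<Longrightarrow> b \<in> carrier G" and "\<And>b. b \<in> A \<Longrightarrow> b \<in> carrier G"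
proof -
  show 1: "subgroup B G" "subgroup A G" "B \<subseteq> A" "a \<in> A"
    "\<And>x b. x \<in> A \<Longrightarrow> b \<in> B \<Longrightarrow> x \<otimes> b \<otimes> inv x \<in> B"
    "\<And>x. x \<in> A \<Longrightarrow> \<exists>b\<in>B. \<exists>j::int. x = b \<otimes> a [^] j"
    using assms unfolding cyclic_ext_def by simp_all
  show "\<And>b. b \<in> B \<Longrightarrow> b \<in> carrier G" "\<And>b. b \<in> A \<Longrightarrow> b \<in> carrier G"
    using 1(1,2) by (auto dest: subgroup.mem_carrier)
  then show "a \<in> carrier G" using 1(4) by simp
qed

text \<open>The exponent of \<open>x\<close> modulo \<open>B\<close>. It is a relation because a
  finite factor determines \<open>j\<close> only modulo the order of \<open>a\<close> in
  \<open>A / B\<close>; as a multivalued homomorphism to the integers it serves finite and infinite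
  factors alike.\<close>

definition deg :: "'a set \<Rightarrow> 'a \<Rightarrow> 'a \<Rightarrow> int \<Rightarrow> bool" where
  "deg B a x j \<longleftrightarrow> (\<exists>b\<in>B. x = b \<otimes> a [^] j)"

context
  fixes B a A assumes ext: "cyclic_ext B a A"
begin

lemma ext_conj_int_pow: "b \<in> B \<Longrightarrow> a [^] (j::int) \<otimes> b \<otimes> inv (a [^] j) \<in> B"
  by (intro cyclic_extD(6)[OF ext] subgroup_int_pow_closed cyclic_extD(2,4)[OF ext])

lemma deg_mult:
  assumes "deg B a x j" "deg B a y k" shows "deg B a (x \<otimes> y) (j + k)"
proof -
  note E = cyclic_extD(1-5,8,9)[OF ext]
  obtain b c where b: "b \<in> B" "x = b \<otimes> a [^] j" "c \<in> B" "y = c \<otimes> a [^] k"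
    using assms unfolding deg_def by auto
  have "b \<otimes> (a [^] j \<otimes> c \<otimes> inv (a [^] j)) \<in> B"
    using ext_conj_int_pow E(1) b by (simp add: subgroup.m_closed)
  moreover have "x \<otimes> y = b \<otimes> (a [^] j \<otimes> c \<otimes> inv (a [^] j)) \<otimes> a [^] (j + k)"
    using b E by (simp add: m_assoc int_pow_mult)
  ultimately show ?thesis unfolding deg_def by blast
qed

lemma deg_inv:
  assumes "deg B a x j" shows "deg B a (inv x) (- j)"
proof -
  note E = cyclic_extD(1-5,8,9)[OF ext]
  obtain b where b: "b \<in> B" "x = b \<otimes> a [^] j"
    using assms unfolding deg_def by auto
  have "a [^] (-j) \<otimes> inv b \<otimes> inv (a [^] (-j)) \<in> B"
    using ext_conj_int_pow E(1) b by (simp add: subgroup.m_inv_closed)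
  moreover have "inv x = (a [^] (-j) \<otimes> inv b \<otimes> inv (a [^] (-j))) \<otimes> a [^] (-j)"
    using b E by (simp add: m_assoc int_pow_neg inv_mult_group)
  ultimately show ?thesis unfolding deg_def by blast
qed

lemma deg_0: "deg B a x 0 \<longleftrightarrow> x \<in> B"
  using cyclic_extD(5,8)[OF ext] unfolding deg_def by auto

lemma deg_ex: "x \<in> A \<Longrightarrow> \<exists>j. deg B a x j"
  using cyclic_extD(7)[OF ext] unfolding deg_def by blast

lemma deg_imp: "deg B a x j \<Longrightarrow> x \<in> A"
  unfolding deg_def using cyclic_extD(2-4)[OF ext]
  by (auto intro: subgroup.m_closed subgroup_int_pow_closed)

lemma deg_unique:
  assumes "deg B a x i" "deg B a x j" shows "a [^] (i - j) \<in> B"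
proof -
  note E = cyclic_extD(1-5,8,9)[OF ext]
  have "deg B a (x \<otimes> inv x) (j + - i)" by (rule deg_mult[OF assms(2) deg_inv[OF assms(1)]])
  then have "deg B a \<one> (j - i)" using deg_imp[OF assms(1)] E by simp
  then obtain b where "b \<in> B" "\<one> = b \<otimes> a [^] (j - i)" unfolding deg_def by auto
  then have "b = a [^] (i - j)"
    using inv_equality[of b "a [^] (j - i)"] E(5,6) int_pow_neg[of a "j - i"] by simp
  then show ?thesis using \<open>b \<in> B\<close> by simp
qed

lemma deg_pow_in:
  assumes "deg B a x j" "a [^] j \<in> B" shows "x \<in> B"
  using assms cyclic_extD(1)[OF ext] unfolding deg_def by (auto intro: subgroup.m_closed)

lemma inf_int_pow_notin:
  assumes "\<forall>n::nat>0. a [^] n \<notin> B" "j \<noteq> 0" shows "a [^] (j::int) \<notin> B"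
proof
  assume j: "a [^] j \<in> B"
  note E = cyclic_extD(1-5,8,9)[OF ext]
  have "a [^] (nat \<bar>j\<bar>) \<in> B"
  proof (cases "j \<ge> 0")
    case True then show ?thesis using j by simp
  next
    case False
    then have "inv (a [^] j) = a [^] (nat \<bar>j\<bar>)" using E by (simp add: int_pow_def2 del: pow_nat)
    then show ?thesis using subgroup.m_inv_closed[OF E(1) j] by simp
  qed
  then show False using assms(1)[rule_format, of "nat \<bar>j\<bar>"] assms(2) by simp
qed

lemma fin_int_pow_in:
  assumes "a [^] (n::nat) \<in> B" shows "a [^] (d * int n) \<in> B"
proof -
  note E = cyclic_extD(1-5,8,9)[OF ext]
  have "a [^] (d * int n) = (a [^] n) [^] d"
    using int_pow_pow[OF E(5), of "int n" d] by (simp add: mult.commute int_pow_int)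
  then show ?thesis using subgroup_int_pow_closed[OF E(1) assms] by simp
qed

end

text \<open>\<open>r\<close> is a multivalued homomorphism from \<open>D\<close> to the integers.
  Its values form a subgroup generated by some \<open>d\<close>, and any \<open>s\<close> with value
  \<open>d\<close> generates \<open>D\<close> modulo the elements that have 0 among their values.
  The number \<open>d\<close> is returned because it separates trivial from infinite factors in the
  infinite step of \<open>poly_pullback\<close>.\<close>

lemma cyclic_ext_of_rel:
  assumes D: "subgroup D G" and ex: "\<And>x. x \<in> D \<Longrightarrow> \<exists>j::int. r x j"
    and mul: "\<And>x y j k. x \<in> D \<Longrightarrow> y \<in> D \<Longrightarrow> r x j \<Longrightarrow> r y k \<Longrightarrow> r (x \<otimes> y) (j + k)"
    and inv: "\<And>x j. x \<in> D \<Longrightarrow> r x j \<Longrightarrow> r (inv x) (- j)"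
  obtains s d where "cyclic_ext {x \<in> D. r x 0} s D" "\<And>k::nat. r (s [^] k) (d * int k)"
proof -
  note D' = subgroup.mem_carrier[OF D] subgroup.m_closed[OF D] subgroup.m_inv_closed[OF D]
    subgroup.one_closed[OF D]
  have one: "r \<one> 0"
  proof -
    obtain j where j: "r \<one> j" using ex[OF D'(4)] ..
    show ?thesis using mul[OF D'(4) D'(4) j, of "- j"] inv[OF D'(4) j] by simp
  qed
  let ?J = "{j. \<exists>x\<in>D. r x j}"
  have "i - j \<in> ?J" if ij: "i \<in> ?J" "j \<in> ?J" for i j
  proof -
    obtain x y where "x \<in> D" "r x i" "y \<in> D" "r y j" using ij by auto
    then have "r (x \<otimes> inv y) (i + - j)" by (intro mul inv D'(3))
    moreover have "x \<otimes> inv y \<in> D" using \<open>x \<in> D\<close> \<open>y \<in> D\<close> by (intro D'(2,3))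
    ultimately show ?thesis by auto
  qed
  moreover have "0 \<in> ?J" using one D'(4) by auto
  ultimately obtain d where d: "d \<in> ?J" "\<And>j. j \<in> ?J \<Longrightarrow> d dvd j"
    using int_subgroup_generator[of ?J] by blast
  then obtain s where s: "s \<in> D" "r s d" by auto
  have spow: "s [^] k \<in> D" "r (s [^] k) (d * int k)" for k :: nat
  proof -
    show *: "s [^] k \<in> D" for k :: nat by (rule subgroup_nat_pow_closed[OF D s(1)])
    show "r (s [^] k) (d * int k)"
    proof (induction k)
      case (Suc k)
      have "r (s [^] k \<otimes> s) (d * int k + d)" by (rule mul[OF * s(1) Suc s(2)])
      then show ?case by (simp add: algebra_simps)
    qed (use one in simp)
  qed
  have ipow: "s [^] k \<in> D" "r (s [^] k) (d * k)" for k :: int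
  proof -
    show "s [^] k \<in> D" by (rule subgroup_int_pow_closed[OF D s(1)])
    show "r (s [^] k) (d * k)"
    proof (cases "k \<ge> 0")
      case True then show ?thesis using spow(2)[of "nat k"] by simp
    next
      case False
      then have "s [^] k = inv (s [^] nat (-k))" by (simp add: int_pow_def2 del: pow_nat)
      then show ?thesis using inv[OF spow(1) spow(2), of "nat (-k)"] False by simp
    qed
  qed
  have "subgroup {x \<in> D. r x 0} G"
  proof (rule subgroupI)
    show "{x \<in> D. r x 0} \<noteq> {}" using one D'(4) by auto
    show "{x \<in> D. r x 0} \<subseteq> carrier G" using D'(1) by auto
  qed (use D'(2,3) mul[of _ _ 0 0] inv[of _ 0] in simp_all)
  moreover have "x \<otimes> b \<otimes> inv x \<in> {x \<in> D. r x 0}" if xb: "x \<in> D" "b \<in> {x \<in> D. r x 0}" for x b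
  proof -
    obtain j where "r x j" using ex[OF xb(1)] ..
    then have "r (x \<otimes> b \<otimes> inv x) (j + 0 + - j)"
      using xb by (intro mul inv D'(2,3)) auto
    then show ?thesis using xb D'(2,3) by simp
  qed
  moreover have "\<exists>b\<in>{x \<in> D. r x 0}. \<exists>j::int. x = b \<otimes> s [^] j" if xD: "x \<in> D" for x
  proof -
    obtain j where j: "r x j" using ex[OF xD] ..
    then obtain k where k: "j = d * k" using d(2) \<open>x \<in> D\<close> by blast
    have "r (x \<otimes> inv (s [^] k)) (j + - (d * k))"
      using xD j ipow by (intro mul inv D'(3))
    then have "x \<otimes> inv (s [^] k) \<in> {x \<in> D. r x 0}" using k xD ipow(1) D'(2,3) by simp
    moreover have "x = x \<otimes> inv (s [^] k) \<otimes> s [^] k"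
      using D'(1)[OF xD] D'(1)[OF s(1)] by (simp add: m_assoc)
    ultimately show ?thesis by blast
  qed
  ultimately have "cyclic_ext {x \<in> D. r x 0} s D"
    unfolding cyclic_ext_def using D s by blast
  then show ?thesis using that spow(2) by blast
qed

lemma cyclic_ext_Int:
  assumes ext: "cyclic_ext B a A" and S: "subgroup S G" "S \<subseteq> A"
  obtains s where "cyclic_ext (S \<inter> B) s S"
proof -
  obtain s d where "cyclic_ext {x \<in> S. deg B a x 0} s S"
    by (rule cyclic_ext_of_rel[OF S(1), of "deg B a"])
      (use S deg_ex[OF ext] deg_mult[OF ext] deg_inv[OF ext] in auto)
  moreover have "{x \<in> S. deg B a x 0} = S \<inter> B" using deg_0[OF ext] by auto
  ultimately show ?thesis using that by metis
qed

text \<open>A subnormal series from \<open>T\<close> to \<open>A\<close> with cyclic factors, \<open>h\<close> of them infinite and the others of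
  order prime to \<open>p\<close>. Thus \<open>p = 1\<close> imposes no condition, while \<open>p = 0\<close> forces all nontrivial factors to be
  infinite.\<close>

inductive poly :: "nat \<Rightarrow> 'a set \<Rightarrow> nat \<Rightarrow> 'a set \<Rightarrow> bool" for p T where
  poly_base: "subgroup T G \<Longrightarrow> poly p T 0 T"
| poly_fin: "poly p T h B \<Longrightarrow> cyclic_ext B a A \<Longrightarrow> 0 < n \<Longrightarrow> coprime p n \<Longrightarrow>
     a [^] (n::nat) \<in> B \<Longrightarrow> poly p T h A"
| poly_inf: "poly p T h B \<Longrightarrow> cyclic_ext B a A \<Longrightarrow> \<forall>n::nat>0. a [^] n \<notin> B \<Longrightarrow> poly p T (Suc h) A"

lemma poly_subgroup: "poly p T h A \<Longrightarrow> subgroup A G"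
  by (induction rule: poly.induct) (auto dest: cyclic_extD)

lemma poly_subset: "poly p T h A \<Longrightarrow> T \<subseteq> A"
  by (induction rule: poly.induct) (auto dest: cyclic_extD)

lemma poly_base_subgroup: "poly p T h A \<Longrightarrow> subgroup T G"
  by (induction rule: poly.induct) auto

lemma poly_trans: "poly p A k C \<Longrightarrow> poly p T h A \<Longrightarrow> poly p T (h + k) C"
  by (induction rule: poly.induct) (auto intro: poly.intros)

lemma poly_0_imp: "poly 0 T h A \<Longrightarrow> poly p T h A"
  by (induction rule: poly.induct) (auto intro: poly.intros)

lemma poly_1_step: "poly 1 T h B \<Longrightarrow> cyclic_ext B a A \<Longrightarrow> \<exists>h'. poly 1 T h' A"
  by (metis poly_inf poly_fin coprime_1_left)

text \<open>\<open>M\<close> is the product of the exponents \<open>n\<close> recorded at the finite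
  steps.\<close>

lemma poly_coprime:
  "poly 1 T h A \<Longrightarrow> \<exists>M>0. \<forall>p. coprime p M \<longrightarrow> poly p T h A"
proof (induction rule: poly.induct)
  case poly_base then show ?case by (auto intro: poly.poly_base)
next
  case (poly_fin h B a A n)
  then obtain M where "M > 0" "\<forall>p. coprime p M \<longrightarrow> poly p T h B" by auto
  then have "\<forall>p. coprime p (M * n) \<longrightarrow> poly p T h A"
    using poly_fin.hyps poly.poly_fin[of _ T h B a A n] by auto
  then show ?case using \<open>M > 0\<close> \<open>0 < n\<close> by (intro exI[of _ "M * n"]) auto
next
  case (poly_inf h B a A)
  then show ?case by (metis poly.poly_inf)
qed

subsection \<open>Sections of exponent dividing p\<close>

text \<open>\<open>F\<close> meets every right coset of \<open>S0\<close> in \<open>S\<close>,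
  possibly more than once, so for a subgroup \<open>S0\<close> of \<open>S\<close> the index is at
  most \<open>card F\<close>. This expresses finite index for subgroups that need not be
  normal.\<close>

definition covers :: "'a set \<Rightarrow> 'a set \<Rightarrow> 'a set \<Rightarrow> bool" where
  "covers S0 F S \<longleftrightarrow> finite F \<and> F \<subseteq> S \<and> (\<forall>x\<in>S. \<exists>s\<in>S0. \<exists>f\<in>F. x = s \<otimes> f)"

lemma covers_card_le:
  assumes cov: "covers S0 F S" and S: "S \<subseteq> carrier G" "subgroup S0 G"
    and E: "E \<subseteq> S" "\<And>x y. x \<in> E \<Longrightarrow> y \<in> E \<Longrightarrow> x \<otimes> inv y \<in> S0 \<Longrightarrow> x = y"
  shows "card E \<le> card F"
proof -
  have "\<exists>f\<in>F. x \<otimes> inv f \<in> S0" if x: "x \<in> E" for x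
  proof -
    obtain s f where sf: "s \<in> S0" "f \<in> F" "x = s \<otimes> f" using cov x E(1) unfolding covers_def by blast
    then have "x \<otimes> inv f = s"
      using cov S subgroup.mem_carrier[OF S(2)] unfolding covers_def by (auto simp: m_assoc subset_iff)
    then show ?thesis using sf by (intro bexI[of _ f]) simp_all
  qed
  then obtain g where g: "\<And>x. x \<in> E \<Longrightarrow> g x \<in> F \<and> x \<otimes> inv (g x) \<in> S0" by metis
  have "inj_on g E"
  proof (rule inj_onI)
    fix x y assume *: "x \<in> E" "y \<in> E" "g x = g y"
    then have "x \<in> carrier G" "y \<in> carrier G" "g y \<in> carrier G"
      using E(1) S(1) g cov unfolding covers_def by blast+
    then have "x \<otimes> inv y = (x \<otimes> inv (g x)) \<otimes> inv (y \<otimes> inv (g y))"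
      using * by (simp add: m_assoc inv_mult_group)
    then have "x \<otimes> inv y \<in> S0"
      using g[OF *(1)] g[OF *(2)] *(3) S(2) by (simp add: subgroup.m_closed subgroup.m_inv_closed)
    then show "x = y" using E * by blast
  qed
  then show ?thesis using g cov unfolding covers_def by (meson card_inj_on_le image_subsetI)
qed


section \<open>Upper bound for the size of sections of exponent p\<close>

lemma ext_pow_in:
  assumes ext: "cyclic_ext B a A" and x: "x \<in> A" and n: "a [^] (n::nat) \<in> B"
  shows "x [^] n \<in> B"
proof -
  obtain j where j: "deg B a x j" using deg_ex[OF ext x] ..
  have "deg B a (x [^] m) (j * int m)" for m :: nat
  proof (induction m)
    case 0 then show ?case using deg_0[OF ext] cyclic_extD(1)[OF ext] by (simp add: subgroup.one_closed)
  next
    case (Suc m)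
    then show ?case using deg_mult[OF ext Suc j] by (simp add: algebra_simps)
  qed
  then show ?thesis using deg_pow_in[OF ext] fin_int_pow_in[OF ext n] by blast
qed

lemma conj_shift:
  assumes "t \<in> carrier G" "f \<in> carrier G" "c \<in> carrier G" "g \<in> carrier G"
  shows "t \<otimes> f \<otimes> (c \<otimes> g) = t \<otimes> (f \<otimes> c \<otimes> inv f) \<otimes> (f \<otimes> g)"
  using assms by (simp add: m_assoc)

text \<open>Some \<open>s\<close> generates \<open>S\<close> modulo \<open>S \<inter> B\<close>.
  Since \<open>s [^] p\<close> is in \<open>S0\<close>, exponents below \<open>p\<close> suffice,
  which costs a factor \<open>p\<close>. If \<open>a [^] n\<close> is in \<open>B\<close>, then so
  is \<open>s [^] n\<close>; for \<open>n\<close> prime to \<open>p\<close> a Bezout identity writes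
  \<open>s\<close> as a product of an element of \<open>S \<inter> B\<close> and one of
  \<open>S0\<close>, so no coset is added.\<close>

lemma covers_step:
  assumes ext: "cyclic_ext B a A" and S: "subgroup S G" "S \<subseteq> A"
    and S0: "subgroup S0 G" "S0 \<subseteq> S" "\<And>x s. x \<in> S \<Longrightarrow> s \<in> S0 \<Longrightarrow> x \<otimes> s \<otimes> inv x \<in> S0"
    and pow: "\<And>x. x \<in> S \<Longrightarrow> x [^] p \<in> S0" and "0 < (p::nat)"
    and cov: "covers (S0 \<inter> B) F (S \<inter> B)"
  shows "\<exists>F'. covers S0 F' S \<and> card F' \<le> p * card F \<and>
    ((\<exists>n::nat. coprime p n \<and> a [^] n \<in> B) \<longrightarrow> card F' \<le> card F)"
proof -
  obtain s where s: "cyclic_ext (S \<inter> B) s S" using cyclic_ext_Int[OF ext S] .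
  note sE = cyclic_extD[OF s]
  have sp: "(s [^] p) [^] (q::int) \<in> S0" for q
    by (rule subgroup_int_pow_closed[OF S0(1) pow[OF sE(4)]])
  have F: "finite F" "F \<subseteq> S" using cov unfolding covers_def by auto
  have carr: "x \<in> S \<Longrightarrow> x \<in> carrier G" for x using sE(9) .
  show ?thesis
  proof (cases "\<exists>n. coprime p n \<and> a [^] (n::nat) \<in> B")
    case True
    then obtain n where n: "coprime p n" "a [^] n \<in> B" by auto
    have sn: "(s [^] n) [^] (q::int) \<in> S \<inter> B" for q
      using ext_pow_in[OF ext _ n(2)] sE(1,4) S
      by (intro subgroup_int_pow_closed) (auto intro: subgroup_nat_pow_closed)
    obtain u v where uv: "u * int p + v * int n = 1"
      using n(1) bezout_int[of "int p" "int n"] by auto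
    have "\<exists>t\<in>S0. \<exists>f\<in>F. x = t \<otimes> f" if x: "x \<in> S" for x
    proof -
      obtain b j where b: "b \<in> S \<inter> B" "x = b \<otimes> s [^] (j::int)" using sE(7)[OF x] by blast
      have "s [^] j = s [^] (int n * (v * j) + int p * (u * j))"
        using uv by (metis (no_types, opaque_lifting) mult.left_commute distrib_left add.commute mult.commute mult.right_neutral)
      also have "\<dots> = (s [^] n) [^] (v * j) \<otimes> (s [^] p) [^] (u * j)"
        using sE(5) by (simp add: int_pow_mult int_pow_pow flip: int_pow_int)
      finally have sj: "s [^] j = (s [^] n) [^] (v * j) \<otimes> (s [^] p) [^] (u * j)" .
      have "b \<otimes> (s [^] n) [^] (v * j) \<in> S \<inter> B" using b(1) sn by (intro subgroup.m_closed[OF sE(1)])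
      then obtain t f where tf: "t \<in> S0 \<inter> B" "f \<in> F" "b \<otimes> (s [^] n) [^] (v * j) = t \<otimes> f"
        using cov unfolding covers_def by blast
      let ?c = "(s [^] p) [^] (u * j)"
      have fS: "f \<in> S" using tf F by auto
      have "x = t \<otimes> f \<otimes> ?c"
        unfolding b(2) sj tf(3)[symmetric] using b(1) sE(5) carr by (simp add: m_assoc)
      also have "\<dots> = t \<otimes> (f \<otimes> ?c \<otimes> inv f) \<otimes> f"
        using carr fS tf(1) S0(2) sE(5) by (simp add: m_assoc subset_iff)
      finally show ?thesis
        using tf(1,2) S0(3)[OF fS sp] subgroup.m_closed[OF S0(1)] by blast
    qed
    then have "covers S0 F S" using F unfolding covers_def by auto
    moreover have "card F \<le> p * card F" using \<open>0 < p\<close> by simp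
    ultimately show ?thesis by blast
  next
    case False
    let ?F = "(\<lambda>(f, i). f \<otimes> s [^] i) ` (F \<times> {..<p})"
    have "\<exists>t\<in>S0. \<exists>f\<in>?F. x = t \<otimes> f" if x: "x \<in> S" for x
    proof -
      obtain b j where b: "b \<in> S \<inter> B" "x = b \<otimes> s [^] (j::int)" using sE(7)[OF x] by blast
      define i where "i = nat (j mod int p)"
      have i: "i < p" "int i = j mod int p" using \<open>0 < p\<close> unfolding i_def by (auto simp: nat_less_iff)
      have "s [^] j = s [^] (int p * (j div int p) + int i)" using i by simp
      also have "\<dots> = (s [^] p) [^] (j div int p) \<otimes> s [^] i"
        unfolding int_pow_mult[OF sE(5)] int_pow_pow[OF sE(5), symmetric] int_pow_int ..
      finally have sj: "s [^] j = (s [^] p) [^] (j div int p) \<otimes> s [^] i" .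
      obtain t f where tf: "t \<in> S0 \<inter> B" "f \<in> F" "b = t \<otimes> f"
        using cov b unfolding covers_def by blast
      let ?c = "(s [^] p) [^] (j div int p)"
      have fS: "f \<in> S" using tf F by auto
      have "x = t \<otimes> (f \<otimes> ?c \<otimes> inv f) \<otimes> (f \<otimes> s [^] i)"
        unfolding b(2) sj tf(3) using carr fS tf(1) S0(2) sE(5)
        by (intro conj_shift int_pow_closed nat_pow_closed) auto
      then show ?thesis
        using tf(1,2) S0(3)[OF fS sp] i(1)
        by (intro bexI[of _ "t \<otimes> (f \<otimes> ?c \<otimes> inv f)"] bexI[of _ "f \<otimes> s [^] i"])
          (simp_all add: subgroup.m_closed[OF S0(1)] image_iff Bex_def, blast)
    qed
    moreover have "?F \<subseteq> S"
      using F sE(2,4) by (auto intro!: subgroup.m_closed subgroup_nat_pow_closed)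
    ultimately have "covers S0 ?F S" using F unfolding covers_def by blast
    moreover have "card ?F \<le> p * card F"
      using card_image_le[of "F \<times> {..<p}" "\<lambda>(f, i). f \<otimes> s [^] i"] F
      by (simp add: card_cartesian_product mult.commute)
    ultimately show ?thesis using False by blast
  qed
qed

text \<open>Two exponents are kept apart: \<open>q\<close> governs the series and \<open>p\<close>
  the section. With \<open>q = p\<close> only the infinite factors contribute to the count; with
  \<open>q = 1\<close> the lemma still yields finite index for every exponent \<open>p\<close>, as
  \<open>pow_sub_covers\<close> needs.\<close>

lemma poly_covers:
  assumes "poly q {\<one>} h A" "0 < (p::nat)"
    and "subgroup S G" "S \<subseteq> A" "subgroup S0 G" "S0 \<subseteq> S"
    and "\<And>x s. x \<in> S \<Longrightarrow> s \<in> S0 \<Longrightarrow> x \<otimes> s \<otimes> inv x \<in> S0"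
    and "\<And>x. x \<in> S \<Longrightarrow> x [^] p \<in> S0"
  shows "\<exists>F. covers S0 F S \<and> (q = p \<longrightarrow> card F \<le> p ^ h)"
  using assms
proof (induction arbitrary: S S0 rule: poly.induct)
  case poly_base
  then have "S = {\<one>}" "S0 = {\<one>}"
    using subgroup.one_closed[of S G] subgroup.one_closed[of S0 G] by auto
  then have "covers S0 {\<one>} S" unfolding covers_def by auto
  then show ?case by (intro exI[of _ "{\<one>}"]) auto
next
  case (poly_fin h B a A n)
  note B = cyclic_extD(1)[OF poly_fin.hyps(2)]
  have "\<exists>F. covers (S0 \<inter> B) F (S \<inter> B) \<and> (q = p \<longrightarrow> card F \<le> p ^ h)"
  proof (rule poly_fin.IH)
    show "x \<otimes> s \<otimes> inv x \<in> S0 \<inter> B" if "x \<in> S \<inter> B" "s \<in> S0 \<inter> B" for x s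
      using that poly_fin.prems(6)[of x s] B by (auto intro: subgroup.m_closed subgroup.m_inv_closed)
    show "x [^] p \<in> S0 \<inter> B" if "x \<in> S \<inter> B" for x
      using that poly_fin.prems(7)[of x] B subgroup_nat_pow_closed by auto
  qed (use poly_fin.prems B in \<open>auto intro: subgroups_Inter_pair\<close>)
  then obtain F where F: "covers (S0 \<inter> B) F (S \<inter> B)" "q = p \<longrightarrow> card F \<le> p ^ h" by auto
  obtain F' where "covers S0 F' S" "(\<exists>n::nat. coprime p n \<and> a [^] n \<in> B) \<longrightarrow> card F' \<le> card F"
    using covers_step[OF poly_fin.hyps(2) poly_fin.prems(2-7,1) F(1)] by blast
  then show ?case using poly_fin.hyps F(2) by (metis le_trans)
next
  case (poly_inf h B a A)
  note B = cyclic_extD(1)[OF poly_inf.hyps(2)]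
  have "\<exists>F. covers (S0 \<inter> B) F (S \<inter> B) \<and> (q = p \<longrightarrow> card F \<le> p ^ h)"
  proof (rule poly_inf.IH)
    show "x \<otimes> s \<otimes> inv x \<in> S0 \<inter> B" if "x \<in> S \<inter> B" "s \<in> S0 \<inter> B" for x s
      using that poly_inf.prems(6)[of x s] B by (auto intro: subgroup.m_closed subgroup.m_inv_closed)
    show "x [^] p \<in> S0 \<inter> B" if "x \<in> S \<inter> B" for x
      using that poly_inf.prems(7)[of x] B subgroup_nat_pow_closed by auto
  qed (use poly_inf.prems B in \<open>auto intro: subgroups_Inter_pair\<close>)
  then obtain F where F: "covers (S0 \<inter> B) F (S \<inter> B)" "q = p \<longrightarrow> card F \<le> p ^ h" by auto
  obtain F' where F': "covers S0 F' S" "card F' \<le> p * card F"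
    using covers_step[OF poly_inf.hyps(2) poly_inf.prems(2-7,1) F(1)] by blast
  have "card F' \<le> p ^ Suc h" if "q = p"
    using F'(2) F(2) that by (metis le_trans mult_le_mono2 power_Suc)
  then show ?case using F'(1) by blast
qed

text \<open>The quotient \<open>S / S0\<close> has exponent dividing \<open>p\<close> and at least \<open>N\<close> elements.\<close>

definition power_section :: "nat \<Rightarrow> nat \<Rightarrow> 'a set \<Rightarrow> 'a set \<Rightarrow> bool" where
  "power_section p N S0 S \<longleftrightarrow> subgroup S0 G \<and> subgroup S G \<and> S0 \<subseteq> S \<and>
     (\<forall>x\<in>S. \<forall>s\<in>S0. x \<otimes> s \<otimes> inv x \<in> S0) \<and> (\<forall>x\<in>S. x [^] p \<in> S0) \<and>
     (\<exists>E\<subseteq>S. finite E \<and> card E = N \<and> (\<forall>x\<in>E. \<forall>y\<in>E. x \<otimes> inv y \<in> S0 \<longrightarrow> x = y))"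

lemma power_section_le:
  assumes "poly p {\<one>} h A" "0 < p" "power_section p N S0 S" "S \<subseteq> A"
  shows "N \<le> p ^ h"
proof -
  obtain E where E: "E \<subseteq> S" "card E = N" "\<forall>x\<in>E. \<forall>y\<in>E. x \<otimes> inv y \<in> S0 \<longrightarrow> x = y"
    using assms unfolding power_section_def by auto
  obtain F where F: "covers S0 F S" "card F \<le> p ^ h"
    using poly_covers[OF assms(1,2), of S S0] assms(3,4) unfolding power_section_def by auto
  have "S \<subseteq> carrier G" "subgroup S0 G" using assms(3) subgroup.subset unfolding power_section_def by auto
  then have "card E \<le> card F" using covers_card_le[OF F(1), of E] E by blast
  then show ?thesis using E F by simp
qed

section \<open>Subgroups generated by n-th powers\<close>

definition pow_sub :: "nat \<Rightarrow> 'a set \<Rightarrow> 'a set" where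
  "pow_sub n K = generate G ((\<lambda>x. x [^] n) ` K)"

lemma pow_sub:
  assumes K: "subgroup K G"
  shows "subgroup (pow_sub n K) G" "pow_sub n K \<subseteq> K" "\<And>x. x \<in> K \<Longrightarrow> x [^] n \<in> pow_sub n K"
    and "\<And>Y. subgroup Y G \<Longrightarrow> (\<And>x. x \<in> K \<Longrightarrow> x [^] n \<in> Y) \<Longrightarrow> pow_sub n K \<subseteq> Y"
proof -
  have 1: "(\<lambda>x. x [^] n) ` K \<subseteq> K" using subgroup_nat_pow_closed[OF K] by auto
  show "subgroup (pow_sub n K) G" unfolding pow_sub_def
    using 1 subgroup.subset[OF K] by (intro generate_is_subgroup) auto
  show "pow_sub n K \<subseteq> K" unfolding pow_sub_def by (rule generate_subgroup_incl[OF 1 K])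
  show "x [^] n \<in> pow_sub n K" if "x \<in> K" for x unfolding pow_sub_def using that by (auto intro: generate.incl)
  show "pow_sub n K \<subseteq> Y" if "subgroup Y G" "\<And>x. x \<in> K \<Longrightarrow> x [^] n \<in> Y" for Y
    unfolding pow_sub_def using that by (intro generate_subgroup_incl) auto
qed

text \<open>Conjugation commutes with powers, so every conjugation that maps \<open>K\<close> into
  itself preserves this subgroup. A general subgroup of finite index lacks this property, which is
  why \<open>S0\<close> is replaced by such a subgroup later.\<close>

lemma pow_sub_conj:
  assumes K: "subgroup K G" and y: "y \<in> carrier G" "\<And>x. x \<in> K \<Longrightarrow> y \<otimes> x \<otimes> inv y \<in> K"
    and v: "v \<in> pow_sub n K"
  shows "y \<otimes> v \<otimes> inv y \<in> pow_sub n K"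
proof -
  note V = pow_sub(1)[OF K]
  let ?Y = "{v \<in> carrier G. y \<otimes> v \<otimes> inv y \<in> pow_sub n K}"
  have "subgroup ?Y G"
  proof (rule subgroupI)
    show "?Y \<noteq> {}" using y(1) subgroup.one_closed[OF V, of n] by (auto intro!: exI[of _ \<one>])
    fix u assume u: "u \<in> ?Y"
    then have "y \<otimes> inv u \<otimes> inv y = inv (y \<otimes> u \<otimes> inv y)" using y(1) by (simp add: m_assoc inv_mult_group)
    then show "inv u \<in> ?Y" using u subgroup.m_inv_closed[OF V] by simp
    fix w assume w: "w \<in> ?Y"
    then have "y \<otimes> (u \<otimes> w) \<otimes> inv y = (y \<otimes> u \<otimes> inv y) \<otimes> (y \<otimes> w \<otimes> inv y)"
      using y(1) u by (simp add: m_assoc)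
    then show "u \<otimes> w \<in> ?Y" using u w subgroup.m_closed[OF V] by simp
  qed auto
  moreover have "x [^] n \<in> ?Y" if "x \<in> K" for x
    using that y pow_sub(3)[OF K y(2)[OF that], of n] conj_pow[OF y(1)] subgroup.mem_carrier[OF K] by simp
  ultimately show ?thesis using pow_sub(4)[OF K, of ?Y n] v by auto
qed

text \<open>The quotient has exponent dividing \<open>n\<close>, so \<open>poly_covers\<close>
  applies with \<open>S = K\<close> and \<open>q = 1\<close>.\<close>

lemma pow_sub_covers:
  assumes "poly 1 {\<one>} h K" "0 < n" shows "\<exists>F. covers (pow_sub n K) F K"
proof -
  note K = poly_subgroup[OF assms(1)]
  have conj: "x \<otimes> s \<otimes> inv x \<in> pow_sub n K" if "x \<in> K" "s \<in> pow_sub n K" for x s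
    using that K by (intro pow_sub_conj[OF K]) (auto intro: subgroup.m_closed subgroup.m_inv_closed subgroup.mem_carrier)
  show ?thesis
    using poly_covers[OF assms K order_refl pow_sub(1,2)[OF K] conj pow_sub(3)[OF K]] by blast
qed

text \<open>Among the powers of \<open>x\<close> with exponents 0 to \<open>card F\<close> two share
  a representative, so some positive power with exponent at most \<open>card F\<close> lies in
  \<open>S0\<close>; the factorial is divisible by all such exponents.\<close>

lemma covers_exponent:
  assumes cov: "covers S0 F K" and K: "subgroup K G" "subgroup S0 G"
  shows "\<exists>n::nat>0. \<forall>x\<in>K. x [^] n \<in> S0"
proof -
  have F: "finite F" "F \<subseteq> K" using cov unfolding covers_def by auto
  have "x [^] (fact (card F) :: nat) \<in> S0" if x: "x \<in> K" for x
  proof -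
    have xc: "x \<in> carrier G" by (rule subgroup.mem_carrier[OF K(1) x])
    have "\<exists>f. f \<in> F \<and> x [^] i \<otimes> inv f \<in> S0" for i :: nat
    proof -
      have "x [^] i \<in> K" using subgroup_nat_pow_closed[OF K(1) x] .
      then obtain s f where sf: "s \<in> S0" "f \<in> F" "x [^] i = s \<otimes> f" using cov unfolding covers_def by blast
      then have "x [^] i \<otimes> inv f = s"
        using subgroup.mem_carrier[OF K(1), of f] F(2) subgroup.mem_carrier[OF K(2), of s]
        by (simp add: m_assoc subsetD)
      then show ?thesis using sf by (intro exI[of _ f]) simp
    qed
    then obtain g where g: "\<And>i::nat. g i \<in> F \<and> x [^] i \<otimes> inv (g i) \<in> S0" by metis
    have "\<not> inj_on g {..card F}"
    proof
      assume "inj_on g {..card F}"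
      then have "card {..card F} \<le> card F" using g F by (intro card_inj_on_le[of g]) auto
      then show False by simp
    qed
    then obtain i j where ij: "i < j" "j \<le> card F" "g i = g j"
      unfolding inj_on_def by (metis atMost_iff linorder_neqE_nat)
    have gc: "g j \<in> carrier G" using g[of j] F(2) subgroup.mem_carrier[OF K(1), of "g j"] by auto
    have "x [^] (j - i) \<otimes> x [^] i = x [^] j" using xc ij by (simp add: nat_pow_mult)
    then have "x [^] (j - i) = x [^] j \<otimes> inv (x [^] i)"
      using xc by (metis inv_solve_right nat_pow_closed)
    also have "\<dots> = (x [^] j \<otimes> inv (g j)) \<otimes> inv (x [^] i \<otimes> inv (g i))"
      using xc gc ij(3) by (simp add: m_assoc inv_mult_group)
    also have "\<dots> \<in> S0" using g[of i] g[of j] K(2) by (simp add: subgroup.m_closed subgroup.m_inv_closed)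
    finally have *: "x [^] (j - i) \<in> S0" .
    have "(j - i) dvd (fact (card F) :: nat)" using ij by (intro dvd_fact) auto
    then obtain m where m: "fact (card F) = (j - i) * m" ..
    show ?thesis
      unfolding m using nat_pow_pow[OF xc, of "j - i" m] subgroup_nat_pow_closed[OF K(2) *, of m] by simp
  qed
  then show ?thesis by (intro exI[of _ "fact (card F)"]) simp
qed


section \<open>Construction of large sections of a given exponent\<close>

lemma covers_fin_step:
  assumes ext: "cyclic_ext B a A" and n: "a [^] n \<in> B" "0 < (n::nat)"
    and cov: "covers S0 F B" and S0: "S0 \<subseteq> carrier G"
  shows "\<exists>F'. covers S0 F' A"
proof -
  note E = cyclic_extD[OF ext]
  have F: "finite F" "F \<subseteq> B" using cov unfolding covers_def by auto
  let ?F = "(\<lambda>(f, i). f \<otimes> a [^] i) ` (F \<times> {..<n})"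
  have "\<exists>t\<in>S0. \<exists>f\<in>?F. x = t \<otimes> f" if x: "x \<in> A" for x
  proof -
    obtain b j where b: "b \<in> B" "x = b \<otimes> a [^] (j::int)" using E(7)[OF x] by blast
    define i where "i = nat (j mod int n)"
    have i: "i < n" "int i = j mod int n" using n(2) unfolding i_def by (auto simp: nat_less_iff)
    have "a [^] j = a [^] ((j div int n) * int n + int i)" using i by simp
    also have "\<dots> = a [^] ((j div int n) * int n) \<otimes> a [^] i"
      unfolding int_pow_mult[OF E(5)] int_pow_int ..
    finally have aj: "a [^] j = a [^] ((j div int n) * int n) \<otimes> a [^] i" .
    have "b \<otimes> a [^] ((j div int n) * int n) \<in> B"
      by (rule subgroup.m_closed[OF E(1) b(1) fin_int_pow_in[OF ext n(1)]])
    then obtain t f where tf: "t \<in> S0" "f \<in> F" "b \<otimes> a [^] ((j div int n) * int n) = t \<otimes> f"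
      using cov unfolding covers_def by blast
    have "x = (t \<otimes> f) \<otimes> a [^] i"
      unfolding b(2) aj tf(3)[symmetric] using E(5) E(8)[OF b(1)] by (simp add: m_assoc)
    also have "\<dots> = t \<otimes> (f \<otimes> a [^] i)"
      using E(5) E(8)[of f] tf(1,2) F(2) S0 by (intro m_assoc) auto
    finally show ?thesis using tf(1,2) i(1) by (intro bexI[of _ t] bexI[of _ "f \<otimes> a [^] i"]) auto
  qed
  moreover have "?F \<subseteq> A"
    using F(2) E(3) by (auto intro!: subgroup.m_closed[OF E(2)] subgroup_nat_pow_closed[OF E(2,4)])
  ultimately have "covers S0 ?F A" using F(1) unfolding covers_def by blast
  then show ?thesis by blast
qed

text \<open>Conjugation by \<open>a\<close> permutes the finitely many cosets of \<open>V\<close> in \<open>B\<close>, so some power of \<open>a\<close>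
  fixes them all.\<close>

lemma conj_power_trivial:
  assumes ext: "cyclic_ext B a A" and cov: "covers V F B" and V: "subgroup V G" "V \<subseteq> B"
    and inv: "\<And>y v. y \<in> A \<Longrightarrow> v \<in> V \<Longrightarrow> y \<otimes> v \<otimes> inv y \<in> V"
  shows "\<exists>k::nat>0. \<forall>b\<in>B. a [^] k \<otimes> b \<otimes> inv (a [^] k) \<otimes> inv b \<in> V"
proof -
  note E = cyclic_extD[OF ext]
  have F: "finite F" "F \<subseteq> B" using cov unfolding covers_def by auto
  have aA: "a [^] i \<in> A" for i :: nat by (rule subgroup_nat_pow_closed[OF E(2,4)])
  have ac: "a [^] i \<in> carrier G" for i :: nat using E(5) by simp
  have "\<exists>g. g \<in> F \<and> (a [^] i \<otimes> f \<otimes> inv (a [^] i)) \<otimes> inv g \<in> V" if "f \<in> F" for i :: nat and f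
  proof -
    have "a [^] i \<otimes> f \<otimes> inv (a [^] i) \<in> B" using E(6)[OF aA] that F by auto
    then obtain v g where vg: "v \<in> V" "g \<in> F" "a [^] i \<otimes> f \<otimes> inv (a [^] i) = v \<otimes> g"
      using cov unfolding covers_def by blast
    then have "(a [^] i \<otimes> f \<otimes> inv (a [^] i)) \<otimes> inv g = v"
      using E(8)[of g] E(8)[of v] F(2) V(2) by (simp add: m_assoc subsetD)
    then show ?thesis using vg(1,2) by (intro exI[of _ g]) simp
  qed
  note ex = this
  define \<phi> where "\<phi> i f = (SOME g. g \<in> F \<and> (a [^] i \<otimes> f \<otimes> inv (a [^] i)) \<otimes> inv g \<in> V)" for i :: nat and f
  have \<phi>: "\<phi> i f \<in> F \<and> (a [^] i \<otimes> f \<otimes> inv (a [^] i)) \<otimes> inv (\<phi> i f) \<in> V" if "f \<in> F" for i f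
    unfolding \<phi>_def using ex[OF that] by (rule someI_ex)
  \<comment> \<open>Outside \<open>F\<close> the choice is arbitrary; the restriction puts the maps
    into a finite function space, so two powers of \<open>a\<close> induce the same one.\<close>
  have sub: "(\<lambda>i. restrict (\<phi> i) F) ` UNIV \<subseteq> F \<rightarrow>\<^sub>E F" using \<phi> by auto
  have "finite (F \<rightarrow>\<^sub>E F)" using F(1) by (intro finite_PiE)
  then have fin: "finite ((\<lambda>i. restrict (\<phi> i) F) ` UNIV)" by (rule finite_subset[OF sub])
  have "\<not> inj (\<lambda>i. restrict (\<phi> i) F)"
  proof
    assume "inj (\<lambda>i. restrict (\<phi> i) F)"
    from finite_imageD[OF fin this] show False by simp
  qed
  then obtain i j where ij: "i < j" "restrict (\<phi> i) F = restrict (\<phi> j) F"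
    unfolding inj_def by (metis linorder_neqE_nat)
  define k where "k = j - i"
  have jk: "a [^] j = a [^] i \<otimes> a [^] k" using ij(1) E(5) by (simp add: nat_pow_mult k_def)
  have Fk: "a [^] k \<otimes> f \<otimes> inv (a [^] k) \<otimes> inv f \<in> V" if f: "f \<in> F" for f
  proof -
    have eq: "\<phi> i f = \<phi> j f" using fun_cong[OF ij(2), of f] f by simp
    let ?u = "(a [^] j \<otimes> f \<otimes> inv (a [^] j)) \<otimes> inv (\<phi> j f)"
    let ?w = "(a [^] i \<otimes> f \<otimes> inv (a [^] i)) \<otimes> inv (\<phi> j f)"
    have gc: "\<phi> j f \<in> carrier G" "f \<in> carrier G" using \<phi>[OF f, of j] f F(2) E(8) by auto
    have "?u \<in> V" "?w \<in> V" using \<phi>[OF f, of j] \<phi>[OF f, of i] eq by auto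
    \<comment> \<open>The common representative cancels in this quotient; conjugation by the inverse
      of \<open>a [^] i\<close> then leaves the commutator of \<open>a [^] k\<close> and
      \<open>f\<close>.\<close>
    then have "?u \<otimes> inv ?w \<in> V" by (rule subgroup.m_closed[OF V(1) _ subgroup.m_inv_closed[OF V(1)]])
    then have "inv (a [^] i) \<otimes> (?u \<otimes> inv ?w) \<otimes> inv (inv (a [^] i)) \<in> V"
      by (rule inv[OF subgroup.m_inv_closed[OF E(2) aA]])
    also have "inv (a [^] i) \<otimes> (?u \<otimes> inv ?w) \<otimes> inv (inv (a [^] i)) =
        a [^] k \<otimes> f \<otimes> inv (a [^] k) \<otimes> inv f"
      unfolding jk using gc ac by (simp add: m_assoc inv_mult_group)
    finally show ?thesis .
  qed
  have "a [^] k \<otimes> b \<otimes> inv (a [^] k) \<otimes> inv b \<in> V" if b: "b \<in> B" for b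
  proof -
    obtain v f where vf: "v \<in> V" "f \<in> F" "b = v \<otimes> f" using cov b unfolding covers_def by blast
    have c: "v \<in> carrier G" "f \<in> carrier G" using vf(1,2) F(2) V(2) E(8) by auto
    have "(a [^] k \<otimes> v \<otimes> inv (a [^] k)) \<otimes> (a [^] k \<otimes> f \<otimes> inv (a [^] k) \<otimes> inv f) \<otimes> inv v \<in> V"
      by (rule subgroup.m_closed[OF V(1) subgroup.m_closed[OF V(1) inv[OF aA vf(1)] Fk[OF vf(2)]]
            subgroup.m_inv_closed[OF V(1) vf(1)]])
    also have "(a [^] k \<otimes> v \<otimes> inv (a [^] k)) \<otimes> (a [^] k \<otimes> f \<otimes> inv (a [^] k) \<otimes> inv f) \<otimes> inv v =
        a [^] k \<otimes> b \<otimes> inv (a [^] k) \<otimes> inv b"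
      unfolding vf(3) using c ac by (simp add: m_assoc inv_mult_group)
    finally show ?thesis .
  qed
  moreover have "0 < k" using ij(1) by (simp add: k_def)
  ultimately show ?thesis by blast
qed

abbreviation comm :: "'a \<Rightarrow> 'a \<Rightarrow> 'a" where
  "comm x y \<equiv> x \<otimes> y \<otimes> inv x \<otimes> inv y"

text \<open>The first three concern elements \<open>s u\<close>, where in
  \<open>section_step\<close> \<open>s\<close> comes from a subgroup of \<open>B\<close> and
  \<open>u\<close> is a power of \<open>c\<close>; the corrections are commutators of such powers
  with elements of \<open>B\<close>. The last two show that the elements whose commutator with
  \<open>t\<close> lies in a normal subgroup are closed under products and inverses.\<close>

lemma comm_identities:
  assumes "s \<in> carrier G" "t \<in> carrier G" "u \<in> carrier G" "v \<in> carrier G"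
  shows "(s \<otimes> u) \<otimes> (t \<otimes> v) = (s \<otimes> comm u t \<otimes> t) \<otimes> (u \<otimes> v)"
    and "inv (s \<otimes> u) = (comm (inv u) (inv s) \<otimes> inv s) \<otimes> inv u"
    and "u \<otimes> v = v \<otimes> u \<Longrightarrow>
      (s \<otimes> u) \<otimes> (t \<otimes> v) \<otimes> inv (s \<otimes> u) = (s \<otimes> comm u t \<otimes> t \<otimes> comm v (inv s) \<otimes> inv s) \<otimes> v"
    and "comm (u \<otimes> v) t = (u \<otimes> comm v t \<otimes> inv u) \<otimes> comm u t"
    and "comm (inv u) t = inv u \<otimes> inv (comm u t) \<otimes> inv (inv u)"
proof -
  show "(s \<otimes> u) \<otimes> (t \<otimes> v) \<otimes> inv (s \<otimes> u) = (s \<otimes> comm u t \<otimes> t \<otimes> comm v (inv s) \<otimes> inv s) \<otimes> v"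
    if "u \<otimes> v = v \<otimes> u"
  proof -
    have "inv u \<otimes> (v \<otimes> inv s) = inv u \<otimes> ((v \<otimes> u) \<otimes> (inv u \<otimes> inv s))"
      using assms by (simp add: m_assoc)
    also have "\<dots> = v \<otimes> (inv u \<otimes> inv s)" unfolding that[symmetric] using assms by (simp add: m_assoc)
    finally have "v \<otimes> (inv u \<otimes> inv s) = inv u \<otimes> (v \<otimes> inv s)" ..
    then show ?thesis using assms by (simp add: m_assoc inv_mult_group)
  qed
qed (use assms in \<open>simp_all add: m_assoc inv_mult_group\<close>)

text \<open>Conjugation by \<open>a\<close> need not preserve \<open>S0\<close>, so the argument
  runs modulo \<open>V\<close>, which lies in \<open>S0\<close>, has finite index in
  \<open>B\<close> and is normal in \<open>A\<close>. For a power \<open>c\<close> of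
  \<open>a\<close> acting trivially on \<open>B / V\<close>, the new section is \<open>S\<close>
  times the powers of \<open>c\<close> over \<open>S0\<close> times the powers of
  \<open>c [^] p\<close>. As no positive power of \<open>a\<close> lies in \<open>B\<close>, this
  gains the factor \<open>p\<close>.\<close>

lemma section_step:
  assumes ext: "cyclic_ext B a A" and inf: "\<forall>n::nat>0. a [^] n \<notin> B"
    and sec: "power_section p N S0 S" and SB: "S \<subseteq> B" and cov: "covers S0 F B"
    and p: "0 < p" and B1: "poly 1 {\<one>} h B"
  shows "\<exists>S0 S F. power_section p (N * p) S0 S \<and> S \<subseteq> A \<and> covers S0 F A"
proof -
  note E = cyclic_extD[OF ext]
  have S: "subgroup S0 G" "subgroup S G" "S0 \<subseteq> S" "\<And>x s. x \<in> S \<Longrightarrow> s \<in> S0 \<Longrightarrow> x \<otimes> s \<otimes> inv x \<in> S0"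
    "\<And>x. x \<in> S \<Longrightarrow> x [^] p \<in> S0" using sec unfolding power_section_def by simp_all
  obtain D where D: "D \<subseteq> S" "finite D" "card D = N" "\<And>x y. x \<in> D \<Longrightarrow> y \<in> D \<Longrightarrow> x \<otimes> inv y \<in> S0 \<Longrightarrow> x = y"
    using sec unfolding power_section_def by auto
  obtain n :: nat where n: "0 < n" "\<And>x. x \<in> B \<Longrightarrow> x [^] n \<in> S0"
    using covers_exponent[OF cov E(1) S(1)] by blast
  define V where "V = pow_sub n B"
  have V: "subgroup V G" "V \<subseteq> S0" "V \<subseteq> B"
    unfolding V_def using pow_sub(1,2)[OF E(1), of n] pow_sub(4)[OF E(1) S(1), of n] n(2) by auto
  have Vinv: "y \<otimes> v \<otimes> inv y \<in> V" if "y \<in> A" "v \<in> V" for y v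
    unfolding V_def by (rule pow_sub_conj[OF E(1) E(9)[OF that(1)] E(6)[OF that(1)] that(2)[unfolded V_def]])
  obtain FV where FV: "covers V FV B" using pow_sub_covers[OF B1 n(1)] unfolding V_def by auto
  obtain k :: nat where k: "0 < k" "\<And>b. b \<in> B \<Longrightarrow> comm (a [^] k) b \<in> V"
    using conj_power_trivial[OF ext FV V(1,3) Vinv] by blast
  define c where "c = a [^] k"
  have cA: "c \<in> A" unfolding c_def by (rule subgroup_nat_pow_closed[OF E(2,4)])
  have cc: "c [^] (j::int) \<in> carrier G" for j using E(9)[OF cA] by simp
  have cpA: "c [^] (j::int) \<in> A" for j by (rule subgroup_int_pow_closed[OF E(2) cA])
  have cadd: "c [^] (i + j) = c [^] i \<otimes> c [^] j" for i j :: int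
    by (rule int_pow_mult[OF E(9)[OF cA]])
  have cneg: "inv (c [^] j) = c [^] (- j)" for j :: int by (rule int_pow_neg[OF E(9)[OF cA], symmetric])
  have ccomm: "c [^] i \<otimes> c [^] j = c [^] j \<otimes> c [^] i" for i j :: int by (simp only: cadd[symmetric] add.commute)
  have ca: "c [^] j = a [^] (int k * j)" for j :: int
    unfolding c_def using int_pow_pow[OF E(5), of "int k" j] by (simp add: int_pow_int)
  \<comment> \<open>The elements of \<open>A\<close> acting trivially on \<open>B / V\<close> form a
    subgroup, so negative powers of \<open>c\<close> are included.\<close>
  let ?Z = "{y \<in> A. \<forall>b\<in>B. comm y b \<in> V}"
  have "subgroup ?Z G"
  proof (rule subgroupI)
    show "?Z \<subseteq> carrier G" using E(9) by auto
    show "?Z \<noteq> {}" using cA k(2) unfolding c_def by auto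
    fix y assume y: "y \<in> ?Z"
    have "comm (inv y) b \<in> V" if b: "b \<in> B" for b
    proof -
      have "inv y \<otimes> inv (comm y b) \<otimes> inv (inv y) \<in> V"
        using y b by (intro Vinv subgroup.m_inv_closed[OF V(1)] subgroup.m_inv_closed[OF E(2)]) auto
      then show ?thesis using comm_identities(5)[OF E(8)[OF b] E(8)[OF b] E(9)[of y] E(8)[OF b]] y by simp
    qed
    then show "inv y \<in> ?Z" using y subgroup.m_inv_closed[OF E(2)] by auto
    fix z assume z: "z \<in> ?Z"
    have "comm (y \<otimes> z) b \<in> V" if b: "b \<in> B" for b
    proof -
      have "(y \<otimes> comm z b \<otimes> inv y) \<otimes> comm y b \<in> V"
        using y z b by (rule_tac subgroup.m_closed[OF V(1) Vinv]) simp_all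
      then show ?thesis using comm_identities(4)[OF E(8)[OF b] E(8)[OF b] E(9)[of y] E(9)[of z]] y z by simp
    qed
    then show "y \<otimes> z \<in> ?Z" using y z subgroup.m_closed[OF E(2)] by auto
  qed
  moreover have "c \<in> ?Z" using cA k(2) unfolding c_def by auto
  ultimately have "c [^] (j::int) \<in> ?Z" for j by (rule subgroup_int_pow_closed)
  then have cV: "comm (c [^] (j::int)) b \<in> V" if "b \<in> B" for j b using that by blast
  have S0B: "S0 \<subseteq> B" using S(3) SB by auto
  \<comment> \<open>\<open>P 1 S\<close> and \<open>P (int p) S0\<close> are the two groups of the
    new section. Both are subgroups by the same computation, because commutators with powers of
    \<open>c\<close> fall into \<open>V\<close>, a subset of \<open>K\<close>.\<close>
  define P where "P m K = {x \<otimes> c [^] (m * j) | x j. x \<in> K}" for m :: int and K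
  have PI: "x \<in> K \<Longrightarrow> x \<otimes> c [^] (m * j) \<in> P m K" for m j x K unfolding P_def by blast
  have Psub: "subgroup (P m K) G" if K: "subgroup K G" "V \<subseteq> K" "K \<subseteq> B" for m K
  proof (rule subgroupI)
    show "P m K \<subseteq> carrier G" using cc subgroup.mem_carrier[OF K(1)] unfolding P_def by auto
    show "P m K \<noteq> {}" using PI subgroup.one_closed[OF K(1)] by blast
    fix y assume "y \<in> P m K"
    then obtain x i where x: "x \<in> K" "y = x \<otimes> c [^] (m * i)" unfolding P_def by blast
    have xc: "x \<in> carrier G" using subgroup.mem_carrier[OF K(1) x(1)] .
    have ixB: "inv x \<in> B" using subgroup.m_inv_closed[OF K(1) x(1)] K(3) by blast
    have "inv y = (comm (c [^] (- (m * i))) (inv x) \<otimes> inv x) \<otimes> c [^] (m * - i)"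
      unfolding x(2) comm_identities(2)[OF xc xc cc cc] cneg by simp
    moreover have "comm (c [^] (- (m * i))) (inv x) \<otimes> inv x \<in> K"
      by (rule subgroup.m_closed[OF K(1) subsetD[OF K(2) cV[OF ixB]] subgroup.m_inv_closed[OF K(1) x(1)]])
    ultimately show "inv y \<in> P m K" using PI by metis
    fix z assume "z \<in> P m K"
    then obtain w j where w: "w \<in> K" "z = w \<otimes> c [^] (m * j)" unfolding P_def by blast
    have "y \<otimes> z = (x \<otimes> comm (c [^] (m * i)) w \<otimes> w) \<otimes> c [^] (m * (i + j))"
      unfolding x(2) w(2) comm_identities(1)[OF xc subgroup.mem_carrier[OF K(1) w(1)] cc cc]
      by (simp add: cadd distrib_left)
    moreover have "x \<otimes> comm (c [^] (m * i)) w \<otimes> w \<in> K"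
      by (rule subgroup.m_closed[OF K(1) subgroup.m_closed[OF K(1) x(1) subsetD[OF K(2) cV]] w(1)])
        (use K(3) w(1) in auto)
    ultimately show "y \<otimes> z \<in> P m K" using PI by metis
  qed
  let ?T = "P 1 S" and ?U = "P (int p) S0"
  have T: "subgroup ?T G" "subgroup ?U G" using Psub S V S0B SB by auto
  have T0T: "?U \<subseteq> ?T"
  proof
    fix x assume "x \<in> ?U"
    then obtain s j where s: "s \<in> S0" "x = s \<otimes> c [^] (int p * j)" unfolding P_def by blast
    show "x \<in> ?T" using PI[OF subsetD[OF S(3) s(1)], of 1 "int p * j"] s(2) by simp
  qed
  have TA: "?T \<subseteq> A"
    using SB E(3) cpA unfolding P_def by (auto intro!: subgroup.m_closed[OF E(2)])
  have normal: "x \<otimes> y \<otimes> inv x \<in> ?U" if "x \<in> ?T" "y \<in> ?U" for x y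
  proof -
    obtain s i where s: "s \<in> S" "x = s \<otimes> c [^] (1 * i :: int)" using \<open>x \<in> ?T\<close> unfolding P_def by blast
    obtain t j where t: "t \<in> S0" "y = t \<otimes> c [^] (int p * j)" using \<open>y \<in> ?U\<close> unfolding P_def by blast
    have sc: "s \<in> carrier G" "t \<in> carrier G" using s(1) t(1) SB S0B E(8) by auto
    have isB: "inv s \<in> B" "t \<in> B" using s(1) t(1) SB S0B subgroup.m_inv_closed[OF S(2)] by auto
    let ?w = "comm (c [^] (1 * i)) t \<otimes> t \<otimes> comm (c [^] (int p * j)) (inv s)"
    have "?w \<in> S0"
      by (rule subgroup.m_closed[OF S(1) subgroup.m_closed[OF S(1) subsetD[OF V(2) cV[OF isB(2)]] t(1)]
            subsetD[OF V(2) cV[OF isB(1)]]])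
    then have "s \<otimes> ?w \<otimes> inv s \<in> S0" using S(4) s(1) by blast
    moreover have "x \<otimes> y \<otimes> inv x = (s \<otimes> ?w \<otimes> inv s) \<otimes> c [^] (int p * j)"
      unfolding s(2) t(2) comm_identities(3)[OF sc cc cc ccomm] using sc cc by (simp add: m_assoc)
    ultimately show ?thesis using PI by metis
  qed
  have pow: "x [^] p \<in> ?U" if xT: "x \<in> ?T" for x
  proof -
    obtain s i where s: "s \<in> S" "x = s \<otimes> c [^] (1 * i :: int)" using xT unfolding P_def by blast
    have sc: "s \<in> carrier G" using s(1) SB E(8) by auto
    \<comment> \<open>Collecting the powers of \<open>c\<close> on the right creates only
      commutators in \<open>V\<close>, which are gathered in \<open>w\<close>.\<close>
    have "\<exists>w\<in>V. x [^] m = (w \<otimes> s [^] m) \<otimes> c [^] (int m * i)" for m :: nat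
    proof (induction m)
      case 0
      then show ?case using subgroup.one_closed[OF V(1)] by (intro bexI[of _ \<one>]) simp_all
    next
      case (Suc m)
      then obtain w where w: "w \<in> V" "x [^] m = (w \<otimes> s [^] m) \<otimes> c [^] (int m * i)" by blast
      have wc: "w \<in> carrier G" using w(1) V(3) E(8) by auto
      let ?v = "comm (c [^] (int m * i)) s"
      have v: "?v \<in> V" using cV s(1) SB by blast
      have vc: "?v \<in> carrier G" using v V(3) E(8) by auto
      have smA: "s [^] m \<in> A" using s(1) SB E(3) subgroup_nat_pow_closed[OF E(2), of s m] by auto
      have "x [^] Suc m = ((w \<otimes> s [^] m) \<otimes> ?v \<otimes> s) \<otimes> (c [^] (int m * i) \<otimes> c [^] (1 * i))"
        unfolding nat_pow_Suc w(2) by (subst s(2)) (rule comm_identities(1), use wc sc cc in auto)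
      also have "\<dots> = ((w \<otimes> (s [^] m \<otimes> ?v \<otimes> inv (s [^] m))) \<otimes> s [^] Suc m) \<otimes> c [^] (int (Suc m) * i)"
      proof -
        have *: "c [^] (int m * i) \<otimes> c [^] (1 * i) = c [^] (int (Suc m) * i)"
          unfolding cadd[symmetric] by (simp add: algebra_simps)
        have **: "(w \<otimes> s [^] m) \<otimes> v \<otimes> s = (w \<otimes> (s [^] m \<otimes> v \<otimes> inv (s [^] m))) \<otimes> s [^] Suc m"
          if "v \<in> carrier G" for v using wc sc that by (simp add: m_assoc)
        show ?thesis unfolding * **[OF vc] ..
      qed
      finally show ?case using subgroup.m_closed[OF V(1) w(1) Vinv[OF smA v]] by blast
    qed
    then obtain w where w: "w \<in> V" "x [^] p = (w \<otimes> s [^] p) \<otimes> c [^] (int p * i)" by blast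
    have "w \<otimes> s [^] p \<in> S0" using w(1) V(2) S(5)[OF s(1)] by (intro subgroup.m_closed[OF S(1)]) auto
    then show ?thesis unfolding w(2) using PI by metis
  qed
  have sep: "e = e' \<and> i = i'"
    if e: "e \<in> D" "e' \<in> D" and i: "i < p" "i' < p"
      and in0: "(e \<otimes> c [^] int i) \<otimes> inv (e' \<otimes> c [^] int i') \<in> ?U" for e e' i i'
  proof -
    obtain t l where t: "t \<in> S0" "(e \<otimes> c [^] int i) \<otimes> inv (e' \<otimes> c [^] int i') = t \<otimes> c [^] (int p * l)"
      using in0 unfolding P_def by blast
    have ec: "e \<in> B" "e' \<in> B" "t \<in> B" using e D(1) SB t(1) S0B by auto
    have ecc: "e \<in> carrier G" "e' \<in> carrier G" "t \<in> carrier G" using ec E(8) by auto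
    \<comment> \<open>Exponents of \<open>a\<close> modulo \<open>B\<close> are compared: the
      infinite factor makes them unique, so \<open>i - i'\<close> is a multiple of \<open>p\<close>,
      hence zero.\<close>
    have deg1: "deg B a (b \<otimes> c [^] j) (int k * j)" if "b \<in> B" for b j
      unfolding deg_def ca using that by blast
    have "deg B a ((e \<otimes> c [^] int i) \<otimes> inv (e' \<otimes> c [^] int i')) (int k * int i + - (int k * int i'))"
      by (rule deg_mult[OF ext deg1[OF ec(1)] deg_inv[OF ext deg1[OF ec(2)]]])
    moreover have "deg B a ((e \<otimes> c [^] int i) \<otimes> inv (e' \<otimes> c [^] int i')) (int k * (int p * l))"
      unfolding t(2) by (rule deg1[OF ec(3)])
    ultimately have "a [^] (int k * int i + - (int k * int i') - int k * (int p * l)) \<in> B"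
      by (rule deg_unique[OF ext])
    then have "int k * int i + - (int k * int i') - int k * (int p * l) = 0"
      using inf_int_pow_notin[OF ext inf] by blast
    then have "int k * (int i - int i' - int p * l) = 0" by (simp add: algebra_simps)
    then have il: "int i - int i' = int p * l" using k(1) by simp
    then have "int i mod int p = int i' mod int p" by (simp add: mod_eq_dvd_iff)
    then have ii: "i = i'" using i by simp
    then have "l = 0" using il p by simp
    then have "(e \<otimes> c [^] int i) \<otimes> inv (e' \<otimes> c [^] int i) = t" using t(2) ii ecc by simp
    then have "e \<otimes> inv e' = t" using ecc cc[of "int i"] by (simp add: m_assoc inv_mult_group)
    then show ?thesis using D(4)[OF e] t(1) ii by simp
  qed
  let ?D = "(\<lambda>(e, i). e \<otimes> c [^] int i) ` (D \<times> {..<p})"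
  have one0: "\<one> \<in> ?U" by (rule subgroup.one_closed[OF T(2)])
  have eicc: "e \<otimes> c [^] int i \<in> carrier G" if "e \<in> D" for e i
    using that D(1) SB E(8) cc by (intro m_closed) auto
  have "inj_on (\<lambda>(e, i). e \<otimes> c [^] int i) (D \<times> {..<p})"
  proof (rule inj_onI)
    fix u v assume u: "u \<in> D \<times> {..<p}" and v: "v \<in> D \<times> {..<p}"
      and uv: "(case u of (e, i) \<Rightarrow> e \<otimes> c [^] int i) = (case v of (e, i) \<Rightarrow> e \<otimes> c [^] int i)"
    obtain e i e' i' where [simp]: "u = (e, i)" "v = (e', i')" by (cases u, cases v) auto
    have "(e \<otimes> c [^] int i) \<otimes> inv (e' \<otimes> c [^] int i') = \<one>"
      using uv eicc[of e' i'] v by simp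
    then show "u = v" using sep[of e e' i i'] u v one0 by simp
  qed
  then have cardD: "card ?D = N * p" using D(3) by (simp add: card_image card_cartesian_product)
  have "x = y" if x: "x \<in> ?D" "y \<in> ?D" and xy: "x \<otimes> inv y \<in> ?U" for x y
  proof -
    obtain e i e' i' where "e \<in> D" "i < p" "x = e \<otimes> c [^] int i" "e' \<in> D" "i' < p" "y = e' \<otimes> c [^] int i'"
      using x by auto
    then show ?thesis using sep[of e e' i i'] xy by simp
  qed
  moreover have "?D \<subseteq> ?T"
  proof
    fix x assume "x \<in> ?D"
    then obtain e i where e: "e \<in> D" "x = e \<otimes> c [^] int i" by auto
    show "x \<in> ?T" using PI[OF subsetD[OF D(1) e(1)], of 1 "int i"] e(2) by simp
  qed
  ultimately have "power_section p (N * p) ?U ?T"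
    unfolding power_section_def using T T0T normal pow cardD D(2) by (intro conjI exI[of _ ?D]) auto
  moreover have "\<exists>F'. covers ?U F' A"
  proof -
    \<comment> \<open>\<open>c [^] p\<close> equals \<open>a [^] (k * p)\<close> and lies in
      \<open>?U\<close>, so exponents of \<open>a\<close> below \<open>k * p\<close>
      suffice.\<close>
    let ?F = "(\<lambda>(f, i). f \<otimes> a [^] (i::nat)) ` (F \<times> {..<k * p})"
    have F: "finite F" "F \<subseteq> B" using cov unfolding covers_def by auto
    have "\<exists>t\<in>?U. \<exists>f\<in>?F. x = t \<otimes> f" if x: "x \<in> A" for x
    proof -
      obtain b j where b: "b \<in> B" "x = b \<otimes> a [^] (j::int)" using E(7)[OF x] by blast
      define i where "i = nat (j mod int (k * p))"
      define q where "q = j div int (k * p)"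
      have i: "i < k * p" "int i = j mod int (k * p)"
        using p k(1) unfolding i_def by (auto simp: nat_less_iff simp del: of_nat_mult)
      have "a [^] j = a [^] (int k * (int p * q) + int i)"
        using i unfolding q_def by (metis mult.assoc mult_div_mod_eq of_nat_mult)
      also have "\<dots> = c [^] (int p * q) \<otimes> a [^] i"
        unfolding int_pow_mult[OF E(5)] int_pow_int ca ..
      finally have aj: "a [^] j = c [^] (int p * q) \<otimes> a [^] i" .
      obtain s f where sf: "s \<in> S0" "f \<in> F" "b = s \<otimes> f" using cov b unfolding covers_def by blast
      have cr: "s \<in> carrier G" "f \<in> carrier G" "a [^] i \<in> carrier G" using sf(1,2) S0B F(2) E(5,8) by auto
      have fB: "f \<in> B" using sf F by auto
      have ifB: "inv f \<in> B" using subgroup.m_inv_closed[OF E(1) fB] .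
      let ?d = "c [^] (int p * q)"
      \<comment> \<open>The power of \<open>c\<close> has to pass \<open>f\<close>; the resulting
        commutator lies in \<open>V\<close> and is absorbed by \<open>S0\<close>.\<close>
      let ?v = "f \<otimes> ?d \<otimes> inv f \<otimes> inv ?d"
      have fA: "f \<in> A" using fB E(3) by auto
      have "f \<otimes> comm ?d (inv f) \<otimes> inv f \<in> V" by (rule Vinv[OF fA cV[OF ifB]])
      moreover have "f \<otimes> comm ?d (inv f) \<otimes> inv f = ?v" using cr cc by (simp add: m_assoc)
      ultimately have v: "?v \<in> V" by simp
      have "x = (s \<otimes> ?v \<otimes> ?d) \<otimes> (f \<otimes> a [^] i)"
        unfolding b(2) aj sf(3) using cr cc by (simp add: m_assoc)
      moreover have "s \<otimes> ?v \<otimes> ?d \<in> ?U"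
        by (rule PI[OF subgroup.m_closed[OF S(1) sf(1) subsetD[OF V(2) v]]])
      moreover have "f \<otimes> a [^] i \<in> ?F" using sf(2) i(1) by auto
      ultimately show ?thesis by (intro bexI[of _ "s \<otimes> ?v \<otimes> ?d"] bexI[of _ "f \<otimes> a [^] i"])
    qed
    moreover have "?F \<subseteq> A"
      using F(2) E(3) by (auto intro!: subgroup.m_closed[OF E(2)] subgroup_nat_pow_closed[OF E(2,4)])
    ultimately have "covers ?U ?F A" using F(1) unfolding covers_def by blast
    then show ?thesis by blast
  qed
  ultimately show ?thesis using TA by blast
qed

text \<open>The starting section sits in \<open>T\<close> so that a finite central subgroup can be
  put at the bottom; for the Hirsch length \<open>T\<close> is trivial. The series \<open>T1\<close>
  continues down to the identity because the finite index of power subgroups is obtained from a full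
  series.\<close>

lemma poly_section:
  assumes "poly 1 T h A" and T1: "poly 1 {\<one>} h0 T" and p: "0 < p"
    and sec: "power_section p N S0 S" "S \<subseteq> T" "covers S0 F T"
  shows "\<exists>S0 S F. power_section p (N * p ^ h) S0 S \<and> S \<subseteq> A \<and> covers S0 F A"
  using assms(1)
proof (induction rule: poly.induct)
  case poly_base
  then show ?case using sec by auto
next
  case (poly_fin h B a A n)
  then obtain S0 S F where *: "power_section p (N * p ^ h) S0 S" "S \<subseteq> B" "covers S0 F B" by blast
  then have "S0 \<subseteq> carrier G" using subgroup.subset unfolding power_section_def by blast
  then have "\<exists>F'. covers S0 F' A" using covers_fin_step[OF poly_fin.hyps(2) poly_fin.hyps(5,3) *(3)] by blast
  then show ?case using * cyclic_extD(3)[OF poly_fin.hyps(2)] by blast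
next
  case (poly_inf h B a A)
  then obtain S0 S F where *: "power_section p (N * p ^ h) S0 S" "S \<subseteq> B" "covers S0 F B" by blast
  show ?case
    using section_step[OF poly_inf.hyps(2,3) * p poly_trans[OF poly_inf.hyps(1) T1]]
    by (simp add: ac_simps)
qed

end

section \<open>Finite quotients and laws of configuration equivalent groups\<close>

lemma indexed_partition_of_partition_on:
  assumes "partition_on (carrier G) P" "finite P"
  shows "\<exists>m E. indexed_partition G m E \<and> bij_betw E {1..m} P"
proof -
  obtain E where E: "bij_betw E {1..card P} P" using ex_bij_betw_nat_finite_1[OF assms(2)] by blast
  then have img: "E ` {1..card P} = P" and inj: "inj_on E {1..card P}" by (auto simp: bij_betw_def)
  have "disjoint_family_on E {1..card P}"
    unfolding disjoint_family_on_def
  proof (intro ballI impI)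
    fix i j assume ij: "i \<in> {1..card P}" "j \<in> {1..card P}" "i \<noteq> j"
    then have "E i \<in> P" "E j \<in> P" "E i \<noteq> E j" using img inj by (auto dest: inj_onD)
    then show "E i \<inter> E j = {}"
      using partition_onD2[OF assms(1)] unfolding disjoint_def by blast
  qed
  moreover have "E j \<noteq> {}" if "j \<in> {1..card P}" for j
    using imageI[OF that, of E] partition_onD3[OF assms(1)] unfolding img by auto
  ultimately have "indexed_partition G (card P) E"
    using partition_onD1[OF assms(1)] img unfolding indexed_partition_def by simp
  then show ?thesis using E by blast
qed

definition colour :: "nat \<Rightarrow> (nat \<Rightarrow> 'a set) \<Rightarrow> 'a \<Rightarrow> nat" where
  "colour m E x = (THE j. j \<in> {1..m} \<and> x \<in> E j)"

lemma colour_eq: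
  assumes "indexed_partition G m E" "j \<in> {1..m}" "x \<in> E j"
  shows "colour m E x = j"
  unfolding colour_def
proof (rule the_equality)
  show "i = j" if "i \<in> {1..m} \<and> x \<in> E i" for i
    using that assms unfolding indexed_partition_def disjoint_family_on_def by blast
qed (use assms in simp)

lemma colour:
  assumes "indexed_partition G m E" "x \<in> carrier G"
  shows "colour m E x \<in> {1..m}" "x \<in> E (colour m E x)"
proof -
  obtain j where "j \<in> {1..m}" "x \<in> E j" using assms unfolding indexed_partition_def by blast
  then show "colour m E x \<in> {1..m}" "x \<in> E (colour m E x)" using colour_eq[OF assms(1)] by auto
qed

lemma configuration_at:
  assumes "group G" "indexed_partition G m E" "set gs \<subseteq> carrier G" "x \<in> carrier G"
  shows "configuration G gs m E (colour m E x # map (\<lambda>g. colour m E (g \<otimes>\<^bsub>G\<^esub> x)) gs)"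
proof -
  interpret G: group G by fact
  have "g \<otimes>\<^bsub>G\<^esub> x \<in> carrier G" if "g \<in> set gs" for g using that assms by auto
  then show ?thesis
    unfolding configuration_def using colour[OF assms(2)] assms(3,4)
    by (auto intro!: bexI[of _ x])
qed

text \<open>\<open>e\<close> sends \<open>y\<close> to the class of \<open>G\<close> that has the
  number of the class of \<open>y\<close> in a matching partition of \<open>H\<close>. The
  configuration at \<open>y\<close> is realised at some \<open>x\<close> in \<open>G\<close>, but
  \<open>x\<close> depends on \<open>y\<close>, so the correspondence is only local. The last clause
  holds because every class of \<open>G\<close> occurs as first entry of a configuration.\<close>

lemma Con_transfer:
  assumes G: "group G" and H: "group H" and eq: "Con G = Con H"
    and gs: "generating_sequence G gs" and P: "partition_on (carrier G) P" "finite P"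
  shows "\<exists>hs e. generating_sequence H hs \<and> length hs = length gs \<and>
    (\<forall>y\<in>carrier H. e y \<in> P) \<and>
    (\<forall>y\<in>carrier H. \<exists>x\<in>carrier G. x \<in> e y \<and> (\<forall>i<length gs. gs ! i \<otimes>\<^bsub>G\<^esub> x \<in> e (hs ! i \<otimes>\<^bsub>H\<^esub> y))) \<and>
    (\<forall>D\<in>P. \<exists>y\<in>carrier H. e y = D)"
proof -
  obtain m E where E: "indexed_partition G m E" "bij_betw E {1..m} P"
    using indexed_partition_of_partition_on[OF P] by blast
  have "Con_pair G gs m E \<in> Con G"
    unfolding Con_def
    by (intro CollectI exI[of _ gs] exI[of _ m] exI[of _ E] conjI refl gs E(1))
  then obtain hs k F where Con: "Con_pair G gs m E = Con_pair H hs k F"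
    and hs: "generating_sequence H hs" and F: "indexed_partition H k F"
    unfolding eq unfolding Con_def mem_Collect_eq by (elim exE conjE)
  have gsc: "set gs \<subseteq> carrier G" and hsc: "set hs \<subseteq> carrier H"
    using gs hs unfolding generating_sequence_def by auto
  have conf: "configuration G gs m E C \<longleftrightarrow> configuration H hs k F C" for C
    using Con unfolding Con_pair_def by (metis mem_Collect_eq)
  define e where "e y = E (colour k F y)" for y
  \<comment> \<open>A configuration exists at the identity of \<open>G\<close>; being shared, it
    forces both generating sequences to have the same length.\<close>
  obtain C where C: "configuration G gs m E C"
    using configuration_at[OF G E(1) gsc monoid.one_closed[OF group.is_monoid[OF G]]] by (rule that)
  have len: "length hs = length gs"
    using C C[unfolded conf] unfolding configuration_def by (metis Suc_inject)
  have 1: "e y \<in> P" "\<exists>x\<in>carrier G. x \<in> e y \<and> (\<forall>i<length gs. gs ! i \<otimes>\<^bsub>G\<^esub> x \<in> e (hs ! i \<otimes>\<^bsub>H\<^esub> y))"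
    if y: "y \<in> carrier H" for y
  proof -
    let ?C = "colour k F y # map (\<lambda>g. colour k F (g \<otimes>\<^bsub>H\<^esub> y)) hs"
    have "configuration G gs m E ?C" using configuration_at[OF H F hsc y] conf by blast
    then have C: "set ?C \<subseteq> {1..m}"
      "\<exists>x\<in>carrier G. x \<in> E (?C ! 0) \<and> (\<forall>i<length gs. gs ! i \<otimes>\<^bsub>G\<^esub> x \<in> E (?C ! Suc i))"
      unfolding configuration_def by blast+
    show "e y \<in> P" using C(1) bij_betwE[OF E(2)] unfolding e_def by simp
    show "\<exists>x\<in>carrier G. x \<in> e y \<and> (\<forall>i<length gs. gs ! i \<otimes>\<^bsub>G\<^esub> x \<in> e (hs ! i \<otimes>\<^bsub>H\<^esub> y))"
      using C(2) len unfolding e_def by simp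
  qed
  have 2: "\<exists>y\<in>carrier H. e y = D" if D: "D \<in> P" for D
  proof -
    obtain j where j: "j \<in> {1..m}" "D = E j" using D E(2) unfolding bij_betw_def by blast
    then obtain x where x: "x \<in> E j" "x \<in> carrier G" using E(1) unfolding indexed_partition_def by blast
    let ?C = "colour m E x # map (\<lambda>g. colour m E (g \<otimes>\<^bsub>G\<^esub> x)) gs"
    have "configuration H hs k F ?C" using configuration_at[OF G E(1) gsc x(2)] conf by blast
    then have C: "set ?C \<subseteq> {1..k}" "\<exists>y\<in>carrier H. y \<in> F (?C ! 0)"
      unfolding configuration_def by blast+
    then obtain y where y: "y \<in> carrier H" "y \<in> F (colour m E x)" by auto
    have "colour k F y = j" using colour_eq[OF F _ y(2)] C(1) colour_eq[OF E(1) j(1) x(1)] by simp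
    then show ?thesis using y(1) j(2) unfolding e_def by auto
  qed
  show ?thesis using hs len 1 2 by blast
qed

lemma generating_sequence_exists:
  assumes "finitely_generated G" shows "\<exists>gs. generating_sequence G gs"
  using assms finite_list unfolding finitely_generated_def generating_sequence_def by metis

lemma finite_quotient_transfer:
  assumes G: "group G" and H: "group H" and eq: "Con G = Con H" and fg: "finitely_generated G"
    and N: "N \<lhd> G" and fin: "finite (rcosets\<^bsub>G\<^esub> N)"
  shows "\<exists>f. f \<in> hom H (G Mod N) \<and> f ` carrier H = carrier (G Mod N)"
proof -
  interpret G: group G by fact
  interpret H: group H by fact
  interpret N: normal N G by fact
  interpret Q: group "G Mod N" by (rule N.factorgroup_is_group)
  let ?Q = "G Mod N"
  obtain gs where gs: "generating_sequence G gs" using generating_sequence_exists[OF fg] ..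
  have Nsub: "subgroup N G" by (rule N.is_subgroup)
  have "partition_on (carrier G) (rcosets\<^bsub>G\<^esub> N)"
  proof (rule partition_onI)
    show "\<Union> (rcosets\<^bsub>G\<^esub> N) = carrier G" by (rule G.rcosets_part_G[OF Nsub])
    show "disjnt p q" if "p \<in> rcosets\<^bsub>G\<^esub> N" "q \<in> rcosets\<^bsub>G\<^esub> N" "p \<noteq> q" for p q
      using G.rcos_disjoint[OF Nsub] that unfolding pairwise_def by blast
    show "{} \<notin> rcosets\<^bsub>G\<^esub> N"
      using G.rcos_self[OF _ Nsub] unfolding RCOSETS_def by blast
  qed
  from Con_transfer[OF G H eq gs this fin] obtain hs e where hs: "generating_sequence H hs"
    and len: "length hs = length gs" and e': "\<forall>y\<in>carrier H. e y \<in> rcosets\<^bsub>G\<^esub> N"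
    and step': "(\<forall>y\<in>carrier H. \<exists>x\<in>carrier G. x \<in> e y \<and> (\<forall>i<length gs. gs ! i \<otimes>\<^bsub>G\<^esub> x \<in> e (hs ! i \<otimes>\<^bsub>H\<^esub> y)))"
    by (elim exE conjE)
  note e = bspec[OF e'] and step = bspec[OF step']
  have gsc: "set gs \<subseteq> carrier G" "generate G (set gs) = carrier G"
    and hsc: "set hs \<subseteq> carrier H" "generate H (set hs) = carrier H"
    using gs hs unfolding generating_sequence_def by auto
  let ?\<pi> = "\<lambda>g. N #>\<^bsub>G\<^esub> g"
  have \<pi>hom: "?\<pi> \<in> hom G ?Q" by (rule N.r_coset_hom_Mod)
  have eQ: "e y \<in> carrier ?Q" if "y \<in> carrier H" for y using e[OF that] by (simp add: FactGroup_def)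
  have rep: "e y = ?\<pi> x" if y: "y \<in> carrier H" and x: "x \<in> e y" for x y
  proof -
    obtain z where z: "z \<in> carrier G" "e y = ?\<pi> z" using e[OF y] unfolding RCOSETS_def by blast
    show ?thesis using G.repr_independence[OF x[unfolded z(2)] z(1) Nsub] z(2) by simp
  qed
  have gen: "e (hs ! i \<otimes>\<^bsub>H\<^esub> y) = ?\<pi> (gs ! i) \<otimes>\<^bsub>?Q\<^esub> e y" if y: "y \<in> carrier H" and i: "i < length gs" for y i
  proof -
    obtain x where x: "x \<in> carrier G" "x \<in> e y" "gs ! i \<otimes>\<^bsub>G\<^esub> x \<in> e (hs ! i \<otimes>\<^bsub>H\<^esub> y)"
      using step[OF y] i by blast
    have c: "gs ! i \<in> carrier G" "hs ! i \<in> carrier H" using gsc(1) hsc(1) i len by auto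
    have "e (hs ! i \<otimes>\<^bsub>H\<^esub> y) = ?\<pi> (gs ! i \<otimes>\<^bsub>G\<^esub> x)" using rep[OF _ x(3)] c(2) y by simp
    also have "\<dots> = ?\<pi> (gs ! i) \<otimes>\<^bsub>?Q\<^esub> ?\<pi> x" using hom_mult[OF \<pi>hom c(1) x(1)] by simp
    finally show ?thesis using rep[OF y x(2)] by simp
  qed
  \<comment> \<open>\<open>e\<close> of the identity need not be the trivial coset; the factor on
    the right normalises the map.\<close>
  define f where "f y = e y \<otimes>\<^bsub>?Q\<^esub> inv\<^bsub>?Q\<^esub> e \<one>\<^bsub>H\<^esub>" for y
  have fQ: "f y \<in> carrier ?Q" if "y \<in> carrier H" for y
    unfolding f_def by (intro Q.m_closed Q.inv_closed eQ that H.one_closed)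
  \<comment> \<open>The relation \<open>gen\<close> concerns generators only. The elements whose
    left translation acts under \<open>e\<close> as multiplication by some fixed \<open>q\<close>
    form a subgroup, so the relation extends to all of \<open>H\<close>.\<close>
  let ?M = "{y \<in> carrier H. \<exists>q\<in>carrier ?Q. \<forall>z\<in>carrier H. e (y \<otimes>\<^bsub>H\<^esub> z) = q \<otimes>\<^bsub>?Q\<^esub> e z}"
  have Msub: "subgroup ?M H"
  proof (rule H.subgroupI)
    have "\<one>\<^bsub>H\<^esub> \<in> ?M" using Q.one_closed Q.l_one[OF eQ] H.one_closed H.l_one by (auto simp del: one_FactGroup mult_FactGroup)
    then show "?M \<noteq> {}" by blast
    fix y assume "y \<in> ?M"
    then obtain q where y: "y \<in> carrier H" and q: "q \<in> carrier ?Q"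
      and qy: "\<And>z. z \<in> carrier H \<Longrightarrow> e (y \<otimes>\<^bsub>H\<^esub> z) = q \<otimes>\<^bsub>?Q\<^esub> e z" by blast
    have "e (inv\<^bsub>H\<^esub> y \<otimes>\<^bsub>H\<^esub> z) = inv\<^bsub>?Q\<^esub> q \<otimes>\<^bsub>?Q\<^esub> e z" if z: "z \<in> carrier H" for z
    proof -
      have c: "inv\<^bsub>H\<^esub> y \<otimes>\<^bsub>H\<^esub> z \<in> carrier H" using y z by simp
      have "e z = q \<otimes>\<^bsub>?Q\<^esub> e (inv\<^bsub>H\<^esub> y \<otimes>\<^bsub>H\<^esub> z)" using qy[OF c] y z by simp
      then show ?thesis using Q.inv_cancel_left(2)[OF q eQ[OF c]] by simp
    qed
    then show "inv\<^bsub>H\<^esub> y \<in> ?M" using y Q.inv_closed[OF q] by blast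
    fix y' assume "y' \<in> ?M"
    then obtain q' where y': "y' \<in> carrier H" and q': "q' \<in> carrier ?Q"
      and qy': "\<And>z. z \<in> carrier H \<Longrightarrow> e (y' \<otimes>\<^bsub>H\<^esub> z) = q' \<otimes>\<^bsub>?Q\<^esub> e z" by blast
    have "e (y \<otimes>\<^bsub>H\<^esub> y' \<otimes>\<^bsub>H\<^esub> z) = (q \<otimes>\<^bsub>?Q\<^esub> q') \<otimes>\<^bsub>?Q\<^esub> e z" if z: "z \<in> carrier H" for z
      using H.m_assoc[OF y y' z] qy[of "y' \<otimes>\<^bsub>H\<^esub> z"] qy'[OF z] Q.m_assoc[OF q q' eQ[OF z]] y' z
      by simp
    then show "y \<otimes>\<^bsub>H\<^esub> y' \<in> ?M" using y y' Q.m_closed[OF q q'] by blast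
  qed auto
  have hsM: "set hs \<subseteq> ?M"
  proof
    fix h assume "h \<in> set hs"
    then obtain i where i: "i < length gs" "h = hs ! i" using len by (metis in_set_conv_nth)
    have q: "?\<pi> (gs ! i) \<in> carrier ?Q"
      by (rule hom_in_carrier[OF \<pi>hom]) (use gsc(1) i(1) in auto)
    have "\<forall>z\<in>carrier H. e (h \<otimes>\<^bsub>H\<^esub> z) = ?\<pi> (gs ! i) \<otimes>\<^bsub>?Q\<^esub> e z"
      unfolding i(2) by (intro ballI gen i(1))
    then show "h \<in> ?M" using q subsetD[OF hsc(1) \<open>h \<in> set hs\<close>] by blast
  qed
  have M: "carrier H \<subseteq> ?M" using H.generate_subgroup_incl[OF hsM Msub] unfolding hsc(2) .
  have ef: "e (y \<otimes>\<^bsub>H\<^esub> z) = f y \<otimes>\<^bsub>?Q\<^esub> e z" if y: "y \<in> carrier H" and z: "z \<in> carrier H" for y z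
  proof -
    have "y \<in> ?M" using M y by (rule subsetD)
    then obtain q where q: "q \<in> carrier ?Q" "\<And>z. z \<in> carrier H \<Longrightarrow> e (y \<otimes>\<^bsub>H\<^esub> z) = q \<otimes>\<^bsub>?Q\<^esub> e z"
      by blast
    have "e y = q \<otimes>\<^bsub>?Q\<^esub> e \<one>\<^bsub>H\<^esub>" using q(2)[OF H.one_closed] y by simp
    then have "f y = q \<otimes>\<^bsub>?Q\<^esub> (e \<one>\<^bsub>H\<^esub> \<otimes>\<^bsub>?Q\<^esub> inv\<^bsub>?Q\<^esub> e \<one>\<^bsub>H\<^esub>)"
      unfolding f_def using Q.m_assoc[OF q(1) eQ[OF H.one_closed] Q.inv_closed[OF eQ[OF H.one_closed]]] by simp
    then have "f y = q" using Q.r_inv[OF eQ[OF H.one_closed]] Q.r_one[OF q(1)] by simp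
    then show ?thesis using q(2)[OF z] by simp
  qed
  have fhom: "f \<in> hom H ?Q"
  proof (rule homI)
    fix y z assume y: "y \<in> carrier H" and z: "z \<in> carrier H"
    have "f (y \<otimes>\<^bsub>H\<^esub> z) = (f y \<otimes>\<^bsub>?Q\<^esub> e z) \<otimes>\<^bsub>?Q\<^esub> inv\<^bsub>?Q\<^esub> e \<one>\<^bsub>H\<^esub>"
      using ef[OF y z] unfolding f_def[of "y \<otimes>\<^bsub>H\<^esub> z"] by simp
    also have "\<dots> = f y \<otimes>\<^bsub>?Q\<^esub> f z"
      unfolding f_def[of z] by (rule Q.m_assoc[OF fQ[OF y] eQ[OF z] Q.inv_closed[OF eQ[OF H.one_closed]]])
    finally show "f (y \<otimes>\<^bsub>H\<^esub> z) = f y \<otimes>\<^bsub>?Q\<^esub> f z" .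
  qed (rule fQ)
  interpret f: group_hom H ?Q f using fhom by unfold_locales
  interpret \<pi>: group_hom G ?Q ?\<pi> using \<pi>hom by unfold_locales
  \<comment> \<open>For surjectivity: the normalised map sends \<open>hs ! i\<close> to the coset of
    \<open>gs ! i\<close>, and these cosets generate the quotient.\<close>
  have sub: "?\<pi> ` set gs \<subseteq> f ` carrier H"
  proof
    fix q assume "q \<in> ?\<pi> ` set gs"
    then obtain i where i: "i < length gs" "q = ?\<pi> (gs ! i)" by (metis image_iff in_set_conv_nth)
    have q: "q \<in> carrier ?Q" unfolding i(2) by (rule hom_in_carrier[OF \<pi>hom]) (use gsc(1) i(1) in auto)
    have h: "hs ! i \<in> carrier H" using hsc(1) i len by auto
    have "f (hs ! i) = q \<otimes>\<^bsub>?Q\<^esub> e \<one>\<^bsub>H\<^esub> \<otimes>\<^bsub>?Q\<^esub> inv\<^bsub>?Q\<^esub> e \<one>\<^bsub>H\<^esub>"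
      unfolding f_def using gen[OF H.one_closed i(1)] h i(2) by simp
    also have "\<dots> = q" unfolding Q.m_assoc[OF q eQ[OF H.one_closed] Q.inv_closed[OF eQ[OF H.one_closed]]]
        Q.r_inv[OF eQ[OF H.one_closed]] by (rule Q.r_one[OF q])
    finally show "q \<in> f ` carrier H" using h by blast
  qed
  have "generate ?Q (?\<pi> ` set gs) \<subseteq> f ` carrier H"
    by (rule Q.generate_subgroup_incl[OF sub f.img_is_subgroup])
  moreover have "generate ?Q (?\<pi> ` set gs) = ?\<pi> ` carrier G"
    using \<pi>.generate_img[OF gsc(1)] gsc(2) by simp
  moreover have "?\<pi> ` carrier G = carrier ?Q" by (simp add: carrier_FactGroup)
  moreover have "f ` carrier H \<subseteq> carrier ?Q" using fQ by auto
  ultimately have "f ` carrier H = carrier ?Q" by simp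
  then show ?thesis using fhom by blast
qed

section \<open>Group words followed through a partition\<close>

datatype trm = TOne | TGen nat | TMul trm trm | TInv trm

text \<open>Words are syntactic because one word has to be evaluated at the generators of both
  groups. An index beyond the list gives the identity, so evaluation is total.\<close>

primrec teval :: "('a, 'b) monoid_scheme \<Rightarrow> 'a list \<Rightarrow> trm \<Rightarrow> 'a" where
  "teval G gs TOne = \<one>\<^bsub>G\<^esub>"
| "teval G gs (TGen i) = (if i < length gs then gs ! i else \<one>\<^bsub>G\<^esub>)"
| "teval G gs (TMul s t) = teval G gs s \<otimes>\<^bsub>G\<^esub> teval G gs t"
| "teval G gs (TInv t) = inv\<^bsub>G\<^esub> teval G gs t"

text \<open>The points visited when the letters of the word act on \<open>x\<close> one after
  another from the left. For an inverse the path of \<open>t\<close> is walked backwards, so it is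
  listed from its other end.\<close>

primrec trace :: "('a, 'b) monoid_scheme \<Rightarrow> 'a list \<Rightarrow> trm \<Rightarrow> 'a \<Rightarrow> 'a set" where
  "trace G gs TOne x = {}"
| "trace G gs (TGen i) x = {x, teval G gs (TGen i) \<otimes>\<^bsub>G\<^esub> x}"
| "trace G gs (TMul s t) x = trace G gs t x \<union> trace G gs s (teval G gs t \<otimes>\<^bsub>G\<^esub> x)"
| "trace G gs (TInv t) x = trace G gs t (inv\<^bsub>G\<^esub> teval G gs t \<otimes>\<^bsub>G\<^esub> x)"

lemma teval_closed: "group G \<Longrightarrow> set gs \<subseteq> carrier G \<Longrightarrow> teval G gs t \<in> carrier G"
proof (induction t)
  case (TMul s t) then show ?case by (simp add: group.is_monoid monoid.m_closed)
qed (auto simp: group.is_monoid monoid.one_closed)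

lemma trace_finite: "finite (trace G gs t x)"
  by (induction t arbitrary: x) auto

lemma trace_closed:
  "group G \<Longrightarrow> set gs \<subseteq> carrier G \<Longrightarrow> x \<in> carrier G \<Longrightarrow> trace G gs t x \<subseteq> carrier G"
proof (induction t arbitrary: x)
  case (TGen i)
  then show ?case using teval_closed[of G gs "TGen i"]
    by (auto simp: group.is_monoid monoid.m_closed monoid.one_closed simp del: teval.simps)
next
  case (TMul s t)
  then have "teval G gs t \<otimes>\<^bsub>G\<^esub> x \<in> carrier G"
    by (simp add: teval_closed group.is_monoid monoid.m_closed)
  then show ?case using TMul by simp
next
  case (TInv t)
  then have "inv\<^bsub>G\<^esub> teval G gs t \<otimes>\<^bsub>G\<^esub> x \<in> carrier G"
    by (simp add: teval_closed group.is_monoid monoid.m_closed)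
  then show ?case using TInv by simp
qed simp

text \<open>A class consisting of one point determines the classes of the neighbours of that point, so
  on singleton classes a configuration-preserving map follows words in both directions.\<close>

lemma trace_transfer:
  assumes G: "group G" and H: "group H" and len: "length hs = length gs"
    and gs: "set gs \<subseteq> carrier G" and hs: "set hs \<subseteq> carrier H"
    and step: "\<And>y. y \<in> carrier H \<Longrightarrow>
      \<exists>x\<in>carrier G. x \<in> e y \<and> (\<forall>i<length gs. gs ! i \<otimes>\<^bsub>G\<^esub> x \<in> e (hs ! i \<otimes>\<^bsub>H\<^esub> y))"
    and single: "\<And>x y. x \<in> S \<Longrightarrow> y \<in> carrier H \<Longrightarrow> x \<in> e y \<Longrightarrow> e y = {x}"
  shows "x \<in> carrier G \<Longrightarrow> trace G gs t x \<subseteq> S \<Longrightarrow>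
    (\<forall>y\<in>carrier H. e y = {x} \<longrightarrow> e (teval H hs t \<otimes>\<^bsub>H\<^esub> y) = {teval G gs t \<otimes>\<^bsub>G\<^esub> x}) \<and>
    (\<forall>y\<in>carrier H. e y = {teval G gs t \<otimes>\<^bsub>G\<^esub> x} \<longrightarrow> e (inv\<^bsub>H\<^esub> teval H hs t \<otimes>\<^bsub>H\<^esub> y) = {x})"
proof (induction t arbitrary: x)
  interpret G: group G by fact
  interpret H: group H by fact
  note tG = teval_closed[OF G gs] and tH = teval_closed[OF H hs]
  {
    case TOne then show ?case by simp
  next
    case (TGen i)
    show ?case
    proof (cases "i < length gs")
      case True
      then have c: "gs ! i \<in> carrier G" "hs ! i \<in> carrier H" using gs hs len by auto
      have S: "x \<in> S" "gs ! i \<otimes>\<^bsub>G\<^esub> x \<in> S" using TGen.prems(2) True by auto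
      have "e (hs ! i \<otimes>\<^bsub>H\<^esub> y) = {gs ! i \<otimes>\<^bsub>G\<^esub> x}" if y: "y \<in> carrier H" "e y = {x}" for y
        using step[OF y(1)] y True single[OF S(2) H.m_closed[OF c(2) y(1)]] by auto
      moreover have "e (inv\<^bsub>H\<^esub> (hs ! i) \<otimes>\<^bsub>H\<^esub> y) = {x}"
        if y: "y \<in> carrier H" "e y = {gs ! i \<otimes>\<^bsub>G\<^esub> x}" for y
      proof -
        \<comment> \<open>Going backwards, the configuration at \<open>?y\<close> supplies some
          \<open>z\<close> whose translate by \<open>gs ! i\<close> is the known point; cancellation
          gives \<open>z = x\<close>.\<close>
        let ?y = "inv\<^bsub>H\<^esub> (hs ! i) \<otimes>\<^bsub>H\<^esub> y"
        have yc: "?y \<in> carrier H" using c y by simp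
        obtain z where z: "z \<in> carrier G" "z \<in> e ?y" "gs ! i \<otimes>\<^bsub>G\<^esub> z \<in> e (hs ! i \<otimes>\<^bsub>H\<^esub> ?y)"
          using step[OF yc] True by blast
        have "hs ! i \<otimes>\<^bsub>H\<^esub> ?y = y" using c y by simp
        then have "gs ! i \<otimes>\<^bsub>G\<^esub> z = gs ! i \<otimes>\<^bsub>G\<^esub> x" using z(3) y(2) by simp
        then have "z = x" using c z(1) TGen.prems(1) by simp
        then show ?thesis using single[OF S(1) yc] z(2) by simp
      qed
      ultimately show ?thesis using True len by simp
    next
      case False
      then show ?thesis using TGen.prems len by simp
    qed
  next
    case (TMul s t)
    let ?x = "teval G gs t \<otimes>\<^bsub>G\<^esub> x"
    have xc: "?x \<in> carrier G" using tG TMul.prems by simp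
    have T: "trace G gs t x \<subseteq> S" "trace G gs s ?x \<subseteq> S" using TMul.prems(2) by auto
    note IH1 = TMul.IH(1)[OF xc T(2)] and IH2 = TMul.IH(2)[OF TMul.prems(1) T(1)]
    have asG: "teval G gs (TMul s t) \<otimes>\<^bsub>G\<^esub> x = teval G gs s \<otimes>\<^bsub>G\<^esub> ?x"
      using tG TMul.prems(1) by (simp add: G.m_assoc)
    have 1: "e (teval H hs (TMul s t) \<otimes>\<^bsub>H\<^esub> y) = {teval G gs s \<otimes>\<^bsub>G\<^esub> ?x}"
      if y: "y \<in> carrier H" "e y = {x}" for y
    proof -
      have "e (teval H hs t \<otimes>\<^bsub>H\<^esub> y) = {?x}" using IH2 y by blast
      then have "e (teval H hs s \<otimes>\<^bsub>H\<^esub> (teval H hs t \<otimes>\<^bsub>H\<^esub> y)) = {teval G gs s \<otimes>\<^bsub>G\<^esub> ?x}"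
        using IH1 H.m_closed[OF tH y(1)] by blast
      then show ?thesis using tH y(1) by (simp add: H.m_assoc)
    qed
    have 2: "e (inv\<^bsub>H\<^esub> teval H hs (TMul s t) \<otimes>\<^bsub>H\<^esub> y) = {x}"
      if y: "y \<in> carrier H" "e y = {teval G gs s \<otimes>\<^bsub>G\<^esub> ?x}" for y
    proof -
      have "e (inv\<^bsub>H\<^esub> teval H hs s \<otimes>\<^bsub>H\<^esub> y) = {?x}" using IH1 y by blast
      then have "e (inv\<^bsub>H\<^esub> teval H hs t \<otimes>\<^bsub>H\<^esub> (inv\<^bsub>H\<^esub> teval H hs s \<otimes>\<^bsub>H\<^esub> y)) = {x}"
        using IH2 H.m_closed[OF H.inv_closed[OF tH] y(1)] by blast
      then show ?thesis using tH y(1) by (simp add: H.m_assoc H.inv_mult_group)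
    qed
    show ?case unfolding asG using 1 2 by blast
  next
    case (TInv t)
    let ?x = "inv\<^bsub>G\<^esub> teval G gs t \<otimes>\<^bsub>G\<^esub> x"
    have xc: "?x \<in> carrier G" using tG TInv.prems by simp
    have "teval G gs t \<otimes>\<^bsub>G\<^esub> ?x = x" using tG TInv.prems(1) by simp
    then show ?case using TInv.IH[OF xc] TInv.prems tH by simp
  }
qed

text \<open>A word with nontrivial value moves the identity of \<open>G\<close> to another point.
  With all points on the way as singleton classes, some \<open>y\<close> in \<open>H\<close> is
  moved to a different class, so the word is nontrivial there too.\<close>

lemma law_transfer:
  assumes G: "group G" and H: "group H" and eq: "Con G = Con H"
    and gs: "generating_sequence G gs" and t: "teval G gs t \<noteq> \<one>\<^bsub>G\<^esub>"
  shows "\<exists>hs. generating_sequence H hs \<and> teval H hs t \<noteq> \<one>\<^bsub>H\<^esub>"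
proof -
  interpret G: group G by fact
  interpret H: group H by fact
  have gsc: "set gs \<subseteq> carrier G" using gs unfolding generating_sequence_def by auto
  define S where "S = insert \<one>\<^bsub>G\<^esub> (trace G gs t \<one>\<^bsub>G\<^esub>)"
  have S: "finite S" "S \<subseteq> carrier G"
    unfolding S_def using trace_finite trace_closed[OF G gsc G.one_closed] by auto
  \<comment> \<open>The rest of the group can be empty when \<open>G\<close> is finite; removing the
    empty set keeps this a partition.\<close>
  define P where "P = (\<lambda>x. {x}) ` S \<union> ({carrier G - S} - {{}})"
  have P: "partition_on (carrier G) P" "finite P"
    using S unfolding P_def partition_on_def disjoint_def by auto
  from Con_transfer[OF G H eq gs P] obtain hs e where hs: "generating_sequence H hs"
    and len: "length hs = length gs" and e: "\<forall>y\<in>carrier H. e y \<in> P"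
    and step: "(\<forall>y\<in>carrier H. \<exists>x\<in>carrier G. x \<in> e y \<and> (\<forall>i<length gs. gs ! i \<otimes>\<^bsub>G\<^esub> x \<in> e (hs ! i \<otimes>\<^bsub>H\<^esub> y)))"
    and surj: "\<forall>D\<in>P. \<exists>y\<in>carrier H. e y = D"
    by (elim exE conjE)
  have hsc: "set hs \<subseteq> carrier H" using hs unfolding generating_sequence_def by auto
  have single: "e y = {x}" if "x \<in> S" "y \<in> carrier H" "x \<in> e y" for x y
    using bspec[OF e that(2)] that(1,3) unfolding P_def by auto
  obtain y where y: "y \<in> carrier H" "e y = {\<one>\<^bsub>G\<^esub>}" using bspec[OF surj, of "{\<one>\<^bsub>G\<^esub>}"] unfolding P_def S_def by auto
  have "trace G gs t \<one>\<^bsub>G\<^esub> \<subseteq> S" unfolding S_def by auto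
  from trace_transfer[OF G H len gsc hsc bspec[OF step] single G.one_closed this] y
  have "e (teval H hs t \<otimes>\<^bsub>H\<^esub> y) = {teval G gs t}" using teval_closed[OF G gsc] by simp
  then have "teval H hs t \<otimes>\<^bsub>H\<^esub> y \<noteq> y" using y(2) t by auto
  then have "teval H hs t \<noteq> \<one>\<^bsub>H\<^esub>" using y(1) by auto
  then show ?thesis using hs by blast
qed

inductive lower_central_term :: "nat \<Rightarrow> trm \<Rightarrow> bool" where
  "lower_central_term 0 t"
| "lower_central_term (Suc n) TOne"
| "lower_central_term n s \<Longrightarrow> lower_central_term (Suc n) (TMul (TMul (TMul s t) (TInv s)) (TInv t))"
| "lower_central_term (Suc n) s \<Longrightarrow> lower_central_term (Suc n) t \<Longrightarrow> lower_central_term (Suc n) (TMul s t)"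
| "lower_central_term (Suc n) s \<Longrightarrow> lower_central_term (Suc n) (TInv s)"

lemma (in group) lower_central_subgroup: "subgroup (lower_central G n) G"
proof (induction n)
  case (Suc n)
  then have "lower_central G n \<subseteq> carrier G" by (rule subgroup.subset)
  then show ?case by (auto intro!: generate_is_subgroup simp: subset_iff)
qed (simp add: subgroup_self)

lemma (in group) lower_central_closed: "x \<in> lower_central G n \<Longrightarrow> x \<in> carrier G"
  using subgroup.mem_carrier[OF lower_central_subgroup] .

lemma (in group) lower_central_comm:
  "x \<in> lower_central G n \<Longrightarrow> y \<in> carrier G \<Longrightarrow> x \<otimes> y \<otimes> inv x \<otimes> inv y \<in> lower_central G (Suc n)"
  by (auto intro!: generate.incl)

lemma teval_lower_central:
  assumes "lower_central_term n t" "group G" "set gs \<subseteq> carrier G"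
  shows "teval G gs t \<in> lower_central G n"
  using assms(1)
proof (induction rule: lower_central_term.induct)
  case (1 t)
  then show ?case using teval_closed[OF assms(2,3)] by simp
next
  case (2 n)
  then show ?case using subgroup.one_closed[OF group.lower_central_subgroup[OF assms(2)]] by (simp del: lower_central.simps)
next
  case (3 n s t)
  then show ?case
    using group.lower_central_comm[OF assms(2) 3(2) teval_closed[OF assms(2,3)]] by (simp del: lower_central.simps)
next
  case (4 n s t)
  then show ?case using subgroup.m_closed[OF group.lower_central_subgroup[OF assms(2)] 4(3,4)] by (simp del: lower_central.simps)
next
  case (5 n s)
  then show ?case using subgroup.m_inv_closed[OF group.lower_central_subgroup[OF assms(2)] 5(2)] by (simp del: lower_central.simps)
qed

lemma generate_teval: "x \<in> generate G (set gs) \<Longrightarrow> \<exists>t. teval G gs t = x"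
proof (induction rule: generate.induct)
  case one show ?case by (rule exI[of _ TOne]) simp
next
  case (incl h)
  then obtain i where "i < length gs" "h = gs ! i" by (metis in_set_conv_nth)
  then show ?case by (intro exI[of _ "TGen i"]) simp
next
  case (inv h)
  then obtain i where "i < length gs" "h = gs ! i" by (metis in_set_conv_nth)
  then show ?case by (intro exI[of _ "TInv (TGen i)"]) simp
next
  case (eng h1 h2)
  then show ?case by (metis teval.simps(3))
qed

lemma lower_central_teval:
  assumes "group G" "generating_sequence G gs"
  shows "x \<in> lower_central G n \<Longrightarrow> \<exists>t. lower_central_term n t \<and> teval G gs t = x"
proof (induction n arbitrary: x)
  case 0
  then have "x \<in> generate G (set gs)" using assms(2) unfolding generating_sequence_def by simp
  then have "\<exists>t. teval G gs t = x" by (rule generate_teval)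
  then show ?case by (auto intro: lower_central_term.intros)
next
  case (Suc n)
  have comm: "\<exists>t. lower_central_term (Suc n) t \<and> teval G gs t = h"
    if h: "h \<in> (\<Union>x\<in>lower_central G n. \<Union>y\<in>carrier G. {x \<otimes>\<^bsub>G\<^esub> y \<otimes>\<^bsub>G\<^esub> inv\<^bsub>G\<^esub> x \<otimes>\<^bsub>G\<^esub> inv\<^bsub>G\<^esub> y})" for h
  proof -
    obtain x y where xy: "x \<in> lower_central G n" "y \<in> carrier G"
      "h = x \<otimes>\<^bsub>G\<^esub> y \<otimes>\<^bsub>G\<^esub> inv\<^bsub>G\<^esub> x \<otimes>\<^bsub>G\<^esub> inv\<^bsub>G\<^esub> y" using h by blast
    obtain s where s: "lower_central_term n s" "teval G gs s = x" using Suc.IH[OF xy(1)] by blast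
    have "\<exists>t. teval G gs t = y"
    proof -
      have "y \<in> generate G (set gs)" using assms(2) xy(2) unfolding generating_sequence_def by simp
      then show ?thesis by (rule generate_teval)
    qed
    then obtain t where "teval G gs t = y" ..
    then show ?thesis using lower_central_term.intros(3)[OF s(1), of t] s(2) xy(3) by auto
  qed
  from Suc.prems show ?case unfolding lower_central.simps
  proof (induction rule: generate.induct)
    case one show ?case by (intro exI[of _ TOne]) (auto intro: lower_central_term.intros)
  next
    case (incl h) then show ?case by (rule comm)
  next
    case (inv h) then show ?case using comm[OF inv] by (metis lower_central_term.intros(5) teval.simps(4))
  next
    case (eng h1 h2)
    then show ?case by (metis lower_central_term.intros(4) teval.simps(3))
  qed
qed

text \<open>A nontrivial element of \<open>lower_central G n\<close> would be the value of a word of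
  the above kind, and \<open>law_transfer\<close> would make the same word nontrivial in
  \<open>H\<close>.\<close>

lemma lower_central_transfer:
  assumes G: "group G" and H: "group H" and eq: "Con G = Con H" and fg: "finitely_generated G"
    and n: "lower_central H n = {\<one>\<^bsub>H\<^esub>}"
  shows "lower_central G n = {\<one>\<^bsub>G\<^esub>}"
proof (rule ccontr)
  assume ne: "lower_central G n \<noteq> {\<one>\<^bsub>G\<^esub>}"
  obtain gs where gs: "generating_sequence G gs" using generating_sequence_exists[OF fg] ..
  have "\<one>\<^bsub>G\<^esub> \<in> lower_central G n" by (rule subgroup.one_closed[OF group.lower_central_subgroup[OF G]])
  then obtain x where x: "x \<in> lower_central G n" "x \<noteq> \<one>\<^bsub>G\<^esub>" using ne by auto
  obtain t where t: "lower_central_term n t" "teval G gs t = x" using lower_central_teval[OF G gs x(1)] by blast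
  obtain hs where hs: "generating_sequence H hs" "teval H hs t \<noteq> \<one>\<^bsub>H\<^esub>"
    using law_transfer[OF G H eq gs] t(2) x(2) by blast
  then show False using teval_lower_central[OF t(1) H] n unfolding generating_sequence_def by auto
qed

section \<open>Central series\<close>

declare lower_central.simps(2) [simp del]

context group
begin

section \<open>Central extensions and the lower central series\<close>

lemma commutator_rewrites:
  assumes "x \<in> carrier G" "y \<in> carrier G" "z \<in> carrier G" "g \<in> carrier G"
  shows "comm x (y \<otimes> z) = comm x y \<otimes> (y \<otimes> comm x z \<otimes> inv y)"
    and "comm x (inv y) = inv y \<otimes> inv (comm x y) \<otimes> inv (inv y)"
    and "comm (g \<otimes> x \<otimes> inv g) y = g \<otimes> comm x (inv g \<otimes> y \<otimes> inv (inv g)) \<otimes> inv g"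
    and "g \<otimes> comm x y \<otimes> inv g = comm (g \<otimes> x \<otimes> inv g) (g \<otimes> y \<otimes> inv g)"
    and "comm x y = x \<otimes> (y \<otimes> inv x \<otimes> inv y)"
    and "inv (comm x y) = comm y x"
    and "x \<otimes> y \<otimes> inv x = comm x y \<otimes> y"
  using assms by (simp_all add: m_assoc inv_mult_group)

definition normal_set :: "'a set \<Rightarrow> bool" where
  "normal_set N \<longleftrightarrow> subgroup N G \<and> (\<forall>x\<in>carrier G. \<forall>n\<in>N. x \<otimes> n \<otimes> inv x \<in> N)"

lemma normal_setD:
  assumes "normal_set N"
  shows "subgroup N G" "\<And>x n. x \<in> carrier G \<Longrightarrow> n \<in> N \<Longrightarrow> x \<otimes> n \<otimes> inv x \<in> N"
    "\<And>x. x \<in> N \<Longrightarrow> x \<in> carrier G"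
proof -
  show 1: "subgroup N G" using assms unfolding normal_set_def by simp
  show "\<And>x n. x \<in> carrier G \<Longrightarrow> n \<in> N \<Longrightarrow> x \<otimes> n \<otimes> inv x \<in> N"
    using assms unfolding normal_set_def by simp
  show "\<And>x. x \<in> N \<Longrightarrow> x \<in> carrier G" by (rule subgroup.mem_carrier[OF 1])
qed

lemma normal_set_iff: "normal_set N \<longleftrightarrow> N \<lhd> G"
  unfolding normal_set_def normal_inv_iff by simp

text \<open>For normal \<open>N\<close> this is the preimage in \<open>G\<close> of the centre of
  \<open>G / N\<close>.\<close>

definition central_mod :: "'a set \<Rightarrow> 'a set" where
  "central_mod N = {x \<in> carrier G. \<forall>y\<in>carrier G. comm x y \<in> N}"

lemma normal_central_mod:
  assumes N: "normal_set N" shows "normal_set (central_mod N)" "N \<subseteq> central_mod N"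
proof -
  note N' = normal_setD[OF N]
  have 1: "comm x y \<in> N" if "x \<in> N" "y \<in> carrier G" for x y
    using that N'(3)[OF that(1)] commutator_rewrites(5)[of x y x x] N'(2)[OF that(2) subgroup.m_inv_closed[OF N'(1) that(1)]]
    by (simp add: subgroup.m_closed[OF N'(1)])
  show "N \<subseteq> central_mod N" unfolding central_mod_def using 1 N'(3) by auto
  have "subgroup (central_mod N) G"
  proof (rule subgroupI)
    show "central_mod N \<subseteq> carrier G" unfolding central_mod_def by auto
    show "central_mod N \<noteq> {}" using subgroup.one_closed[OF N'(1)] \<open>N \<subseteq> central_mod N\<close> by auto
    fix x assume x: "x \<in> central_mod N"
    then have xc: "x \<in> carrier G" and xN: "\<And>y. y \<in> carrier G \<Longrightarrow> comm x y \<in> N"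
      unfolding central_mod_def by auto
    have "comm (inv x) y \<in> N" if "y \<in> carrier G" for y
      unfolding comm_identities(5)[OF that that xc that]
      by (rule N'(2)[OF inv_closed[OF xc] subgroup.m_inv_closed[OF N'(1) xN[OF that]]])
    then show "inv x \<in> central_mod N" using xc unfolding central_mod_def by simp
    fix z assume z: "z \<in> central_mod N"
    then have zc: "z \<in> carrier G" and zN: "\<And>y. y \<in> carrier G \<Longrightarrow> comm z y \<in> N"
      unfolding central_mod_def by auto
    have "comm (x \<otimes> z) y \<in> N" if "y \<in> carrier G" for y
      unfolding comm_identities(4)[OF that that xc zc]
      by (rule subgroup.m_closed[OF N'(1) N'(2)[OF xc zN[OF that]] xN[OF that]])
    then show "x \<otimes> z \<in> central_mod N" using xc zc unfolding central_mod_def by simp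
  qed
  moreover have "g \<otimes> x \<otimes> inv g \<in> central_mod N" if g: "g \<in> carrier G" and x: "x \<in> central_mod N" for g x
  proof -
    have xc: "x \<in> carrier G" and xN: "\<And>y. y \<in> carrier G \<Longrightarrow> comm x y \<in> N"
      using x unfolding central_mod_def by auto
    have "comm (g \<otimes> x \<otimes> inv g) y \<in> N" if y: "y \<in> carrier G" for y
      unfolding commutator_rewrites(3)[OF xc y y g]
      by (rule N'(2)[OF g xN]) (use y g in simp)
    then show ?thesis using xc g unfolding central_mod_def by simp
  qed
  ultimately show "normal_set (central_mod N)" unfolding normal_set_def by blast
qed

text \<open>\<open>M\<close> consists of the products of elements of \<open>N\<close> with powers of
  \<open>x\<close>. As \<open>x\<close> is central modulo \<open>N\<close>, it is normal in all of
  \<open>G\<close>, so the step can be iterated; its minimality later identifies the result with a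
  term of the lower central series.\<close>

lemma cyclic_ext_central:
  assumes N: "normal_set N" and x: "x \<in> central_mod N"
  obtains M where "cyclic_ext N x M" "normal_set M"
    "\<And>L. subgroup L G \<Longrightarrow> N \<subseteq> L \<Longrightarrow> x \<in> L \<Longrightarrow> M \<subseteq> L"
proof -
  note N' = normal_setD[OF N]
  note C = normal_setD[OF normal_central_mod(1)[OF N]]
  have xc: "x \<in> carrier G" using C(3)[OF x] .
  have xj: "x [^] (j::int) \<in> central_mod N" for j by (rule subgroup_int_pow_closed[OF C(1) x])
  have com: "comm (x [^] (j::int)) y \<in> N" if "y \<in> carrier G" for j y
    using xj[of j] that unfolding central_mod_def by blast
  have com': "comm y (x [^] (j::int)) \<in> N" if "y \<in> carrier G" for j y
    using subgroup.m_inv_closed[OF N'(1) com[OF that, of j]] commutator_rewrites(6)[of "x [^] j" y x x] xc that by simp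
  define M where "M = {n \<otimes> x [^] (j::int) | n j. n \<in> N}"
  have MI: "n \<otimes> x [^] (j::int) \<in> M" if "n \<in> N" for n j using that unfolding M_def by blast
  have ME: "\<exists>n j. n \<in> N \<and> y = n \<otimes> x [^] (j::int)" if "y \<in> M" for y using that unfolding M_def by blast
  have Mc: "y \<in> carrier G" if "y \<in> M" for y using ME[OF that] xc N'(3) by auto
  have Msub: "subgroup M G"
  proof (rule subgroupI)
    show "M \<subseteq> carrier G" using Mc by auto
    show "M \<noteq> {}" using MI[OF subgroup.one_closed[OF N'(1)]] by auto
    fix y assume "y \<in> M"
    then obtain n j where n: "n \<in> N" "y = n \<otimes> x [^] (j::int)" using ME by blast
    have nc: "n \<in> carrier G" using N'(3)[OF n(1)] .
    have "inv y = (inv (x [^] j) \<otimes> inv n \<otimes> inv (inv (x [^] j))) \<otimes> x [^] (- j)"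
      unfolding n(2) using nc xc by (simp add: m_assoc inv_mult_group int_pow_neg)
    moreover have "inv (x [^] j) \<otimes> inv n \<otimes> inv (inv (x [^] j)) \<in> N"
      using xc by (intro N'(2) subgroup.m_inv_closed[OF N'(1) n(1)]) simp
    ultimately show "inv y \<in> M" using MI by metis
    fix z assume "z \<in> M"
    then obtain m k where m: "m \<in> N" "z = m \<otimes> x [^] (k::int)" using ME by blast
    have mc: "m \<in> carrier G" using N'(3)[OF m(1)] .
    have "y \<otimes> z = (n \<otimes> (x [^] j \<otimes> m \<otimes> inv (x [^] j))) \<otimes> x [^] (j + k)"
      unfolding n(2) m(2) int_pow_mult[OF xc] using nc mc xc by (simp add: m_assoc)
    moreover have "n \<otimes> (x [^] j \<otimes> m \<otimes> inv (x [^] j)) \<in> N"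
      by (rule subgroup.m_closed[OF N'(1) n(1) N'(2)[OF int_pow_closed[OF xc] m(1)]])
    ultimately show "y \<otimes> z \<in> M" using MI by metis
  qed
  have "normal_set M" unfolding normal_set_def
  proof (intro conjI Msub ballI)
    fix g y assume g: "g \<in> carrier G" and "y \<in> M"
    then obtain n j where n: "n \<in> N" "y = n \<otimes> x [^] (j::int)" using ME by blast
    have nc: "n \<in> carrier G" using N'(3)[OF n(1)] .
    have "g \<otimes> y \<otimes> inv g = ((g \<otimes> n \<otimes> inv g) \<otimes> comm g (x [^] j)) \<otimes> x [^] j"
      unfolding n(2) using nc xc g by (simp add: m_assoc)
    moreover have "(g \<otimes> n \<otimes> inv g) \<otimes> comm g (x [^] j) \<in> N"
      by (rule subgroup.m_closed[OF N'(1) N'(2)[OF g n(1)] com'[OF g]])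
    ultimately show "g \<otimes> y \<otimes> inv g \<in> M" using MI by metis
  qed
  moreover have "cyclic_ext N x M"
    unfolding cyclic_ext_def
  proof (intro conjI N'(1) Msub)
    show "N \<subseteq> M" using MI[of _ 0] N'(3) by auto
    show "x \<in> M" using MI[OF subgroup.one_closed[OF N'(1)], of 1] xc by simp
    show "\<forall>y\<in>M. \<forall>n\<in>N. y \<otimes> n \<otimes> inv y \<in> N" using N'(2) Mc by blast
    show "\<forall>y\<in>M. \<exists>n\<in>N. \<exists>j::int. y = n \<otimes> x [^] j" using ME by blast
  qed
  moreover have "M \<subseteq> L" if "subgroup L G" "N \<subseteq> L" "x \<in> L" for L
  proof
    fix y assume "y \<in> M"
    then obtain n j where n: "n \<in> N" "y = n \<otimes> x [^] (j::int)" using ME by blast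
    show "y \<in> L" unfolding n(2)
      using n(1) that by (intro subgroup.m_closed[OF that(1)] subgroup_int_pow_closed) auto
  qed
  ultimately show ?thesis by (intro that)
qed

lemma poly_central:
  assumes N: "normal_set N" and "finite Y" "Y \<subseteq> central_mod N"
  shows "\<exists>M h. poly 1 N h M \<and> normal_set M \<and> Y \<subseteq> M \<and>
    (\<forall>L. subgroup L G \<longrightarrow> N \<subseteq> L \<longrightarrow> Y \<subseteq> L \<longrightarrow> M \<subseteq> L)"
  using assms(2,3)
proof (induction rule: finite_induct)
  case empty
  have "poly 1 N 0 N" by (rule poly_base[OF normal_setD(1)[OF N]])
  then show ?case using N by blast
next
  case (insert x Y)
  then obtain M h where M: "poly 1 N h M" "normal_set M" "Y \<subseteq> M"
    "\<And>L. subgroup L G \<Longrightarrow> N \<subseteq> L \<Longrightarrow> Y \<subseteq> L \<Longrightarrow> M \<subseteq> L" by auto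
  have "x \<in> central_mod M"
    using insert.prems poly_subset[OF M(1)] unfolding central_mod_def by auto
  then obtain M' where M': "cyclic_ext M x M'" "normal_set M'"
    "\<And>L. subgroup L G \<Longrightarrow> M \<subseteq> L \<Longrightarrow> x \<in> L \<Longrightarrow> M' \<subseteq> L"
    using cyclic_ext_central[OF M(2)] by blast
  obtain h' where "poly 1 N h' M'" using poly_1_step[OF M(1) M'(1)] ..
  moreover have "insert x Y \<subseteq> M'" using cyclic_extD(3,4)[OF M'(1)] M(3) by auto
  moreover have "M' \<subseteq> L" if "subgroup L G" "N \<subseteq> L" "insert x Y \<subseteq> L" for L
    using M'(3)[OF that(1) M(4)[OF that(1,2)]] that(3) by auto
  ultimately show ?case using M'(2) by blast
qed

lemma normal_lower_central: "normal_set (lower_central G n)"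
proof (induction n)
  case 0 then show ?case unfolding normal_set_def by (simp add: subgroup_self)
next
  case (Suc n)
  note N = normal_setD[OF Suc]
  show ?case unfolding normal_set_iff lower_central.simps(2)
  proof (rule normal_generateI)
    show "(\<Union>x\<in>lower_central G n. \<Union>y\<in>carrier G. {comm x y}) \<subseteq> carrier G" using N(3) by auto
    fix h g assume g: "g \<in> carrier G" and "h \<in> (\<Union>x\<in>lower_central G n. \<Union>y\<in>carrier G. {comm x y})"
    then obtain x y where xy: "x \<in> lower_central G n" "y \<in> carrier G" "h = comm x y" by blast
    have "g \<otimes> h \<otimes> inv g = comm (g \<otimes> x \<otimes> inv g) (g \<otimes> y \<otimes> inv g)"
      unfolding xy(3) by (rule commutator_rewrites(4)[OF N(3)[OF xy(1)] xy(2) xy(2) g])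
    moreover have "g \<otimes> x \<otimes> inv g \<in> lower_central G n" "g \<otimes> y \<otimes> inv g \<in> carrier G"
      using N(2)[OF g xy(1)] g xy(2) by auto
    ultimately show "g \<otimes> h \<otimes> inv g \<in> (\<Union>x\<in>lower_central G n. \<Union>y\<in>carrier G. {comm x y})" by blast
  qed
qed

lemma lower_central_mono: "lower_central G (Suc n) \<subseteq> lower_central G n"
  unfolding lower_central.simps
proof (rule generate_subgroup_incl[OF _ lower_central_subgroup])
  show "(\<Union>x\<in>lower_central G n. \<Union>y\<in>carrier G. {comm x y}) \<subseteq> lower_central G n"
    using normal_central_mod(2)[OF normal_lower_central[of n]] unfolding central_mod_def by blast
qed

lemma lower_central_central_mod: "lower_central G n \<subseteq> central_mod (lower_central G (Suc n))"
  unfolding central_mod_def using lower_central_comm lower_central_closed by blast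

text \<open>On \<open>lower_central G n\<close> and \<open>G\<close> the commutator is
  multiplicative in each argument modulo \<open>lower_central G (Suc (Suc n))\<close>, so the
  commutators of \<open>Y\<close> with \<open>S\<close> generate the next factor. Finite generation
  modulo the next term is stated through subgroups \<open>L\<close>, the form in which it is
  applied.\<close>

lemma lower_central_fg:
  assumes S: "finite S" "S \<subseteq> carrier G" "generate G S = carrier G"
  shows "\<exists>Y. finite Y \<and> Y \<subseteq> lower_central G n \<and>
    (\<forall>L. subgroup L G \<longrightarrow> Y \<subseteq> L \<longrightarrow> lower_central G (Suc n) \<subseteq> L \<longrightarrow> lower_central G n \<subseteq> L)"
proof (induction n)
  case 0
  show ?case
  proof (intro exI[of _ S] conjI allI impI)
    show "lower_central G 0 \<subseteq> L" if "subgroup L G" "S \<subseteq> L" for L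
      using generate_subgroup_incl[OF that(2,1)] S(3) by simp
  qed (use S in auto)
next
  case (Suc n)
  then obtain Y where Y: "finite Y" "Y \<subseteq> lower_central G n"
    "\<And>L. subgroup L G \<Longrightarrow> Y \<subseteq> L \<Longrightarrow> lower_central G (Suc n) \<subseteq> L \<Longrightarrow> lower_central G n \<subseteq> L"
    by blast
  let ?Y = "(\<lambda>(x, g). comm x g) ` (Y \<times> S)"
  let ?A = "lower_central G n" and ?B = "lower_central G (Suc n)" and ?C = "lower_central G (Suc (Suc n))"
  note A = normal_setD[OF normal_lower_central[of n]] and B = normal_setD[OF normal_lower_central[of "Suc n"]]
  have YB: "?Y \<subseteq> ?B" using Y(2) S(2) by (auto intro!: lower_central_comm)
  have "?B \<subseteq> L" if L: "subgroup L G" "?Y \<subseteq> L" "?C \<subseteq> L" for L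
  proof -
    \<comment> \<open>Every subgroup between \<open>?C\<close> and \<open>?B\<close> is normal in
      \<open>G\<close>, because \<open>?B\<close> is central modulo \<open>?C\<close>; the
      intersection with \<open>?B\<close> puts \<open>L\<close> into this range.\<close>
    define M where "M = L \<inter> ?B"
    have Msub: "subgroup M G" unfolding M_def by (rule subgroups_Inter_pair[OF L(1) B(1)])
    have CM: "?C \<subseteq> M" unfolding M_def using L(3) lower_central_mono by blast
    have Mn: "g \<otimes> m \<otimes> inv g \<in> M" if g: "g \<in> carrier G" and m: "m \<in> M" for g m
    proof -
      have mB: "m \<in> ?B" using m unfolding M_def by simp
      have "comm m g \<in> M" using lower_central_comm[OF mB g] CM by blast
      then have "inv (comm m g) \<otimes> m \<in> M"
        by (intro subgroup.m_closed[OF Msub subgroup.m_inv_closed[OF Msub] m])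
      then show ?thesis using commutator_rewrites(6)[of m g m m] commutator_rewrites(7)[of g m m m] g B(3)[OF mB] by simp
    qed
    \<comment> \<open>One argument at a time: here \<open>g\<close> is a fixed generator and the
      good \<open>x\<close> form a subgroup containing \<open>Y\<close> and \<open>?B\<close>; in
      \<open>step2\<close> \<open>x\<close> is fixed and the good \<open>y\<close> form a subgroup
      containing \<open>S\<close>.\<close>
    have step1: "?A \<subseteq> {x \<in> ?A. comm x g \<in> M}" if g: "g \<in> S" for g
    proof (rule Y(3))
      have gc: "g \<in> carrier G" using g S(2) by auto
      show "Y \<subseteq> {x \<in> ?A. comm x g \<in> M}" using Y(2) L(2) YB g unfolding M_def by auto
      show B': "?B \<subseteq> {x \<in> ?A. comm x g \<in> M}" using lower_central_mono lower_central_comm[OF _ gc] CM by blast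
      show "subgroup {x \<in> ?A. comm x g \<in> M} G"
      proof (rule subgroupI)
        show "{x \<in> ?A. comm x g \<in> M} \<subseteq> carrier G" using A(3) by blast
        show "{x \<in> ?A. comm x g \<in> M} \<noteq> {}" using B' subgroup.one_closed[OF B(1)] by blast
        fix x assume x: "x \<in> {x \<in> ?A. comm x g \<in> M}"
        then have xA: "x \<in> ?A" and xM: "comm x g \<in> M" by blast+
        have xc: "x \<in> carrier G" using A(3)[OF xA] .
        have "comm (inv x) g \<in> M" unfolding comm_identities(5)[OF gc gc xc gc]
          by (rule Mn[OF inv_closed[OF xc] subgroup.m_inv_closed[OF Msub xM]])
        then show "inv x \<in> {x \<in> ?A. comm x g \<in> M}" using subgroup.m_inv_closed[OF A(1) xA] by blast
        fix z assume z: "z \<in> {x \<in> ?A. comm x g \<in> M}"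
        then have zA: "z \<in> ?A" and zM: "comm z g \<in> M" by blast+
        have "comm (x \<otimes> z) g \<in> M" unfolding comm_identities(4)[OF gc gc xc A(3)[OF zA]]
          by (rule subgroup.m_closed[OF Msub Mn[OF xc zM] xM])
        then show "x \<otimes> z \<in> {x \<in> ?A. comm x g \<in> M}" using subgroup.m_closed[OF A(1) xA zA] by blast
      qed
    qed
    have step2: "comm x y \<in> M" if x: "x \<in> ?A" and y: "y \<in> carrier G" for x y
    proof -
      have xc: "x \<in> carrier G" using A(3)[OF x] .
      have "subgroup {y \<in> carrier G. comm x y \<in> M} G"
      proof (rule subgroupI)
        show "{y \<in> carrier G. comm x y \<in> M} \<noteq> {}"
          using subgroup.one_closed[OF Msub] xc by (auto intro!: exI[of _ \<one>])
        fix y assume y: "y \<in> {y \<in> carrier G. comm x y \<in> M}"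
        then have yc: "y \<in> carrier G" and yM: "comm x y \<in> M" by blast+
        have "comm x (inv y) \<in> M" unfolding commutator_rewrites(2)[OF xc yc yc yc]
          by (rule Mn[OF inv_closed[OF yc] subgroup.m_inv_closed[OF Msub yM]])
        then show "inv y \<in> {y \<in> carrier G. comm x y \<in> M}" using yc by simp
        fix z assume z: "z \<in> {y \<in> carrier G. comm x y \<in> M}"
        then have zc: "z \<in> carrier G" and zM: "comm x z \<in> M" by blast+
        have "comm x (y \<otimes> z) \<in> M" unfolding commutator_rewrites(1)[OF xc yc zc zc]
          by (rule subgroup.m_closed[OF Msub yM Mn[OF yc zM]])
        then show "y \<otimes> z \<in> {y \<in> carrier G. comm x y \<in> M}" using yc zc by simp
      qed auto
      moreover have "S \<subseteq> {y \<in> carrier G. comm x y \<in> M}" using step1 x S(2) by blast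
      ultimately have "generate G S \<subseteq> {y \<in> carrier G. comm x y \<in> M}"
        by (intro generate_subgroup_incl)
      then show ?thesis using y unfolding S(3) by blast
    qed
    have "?B \<subseteq> M" unfolding lower_central.simps(2)[of G n]
      by (rule generate_subgroup_incl[OF _ Msub]) (use step2 in blast)
    then show ?thesis unfolding M_def by blast
  qed
  moreover have "finite ?Y" using Y(1) S(1) by simp
  ultimately show ?case using YB by blast
qed

text \<open>Every factor of the lower central series is central and finitely generated, so adjoining
  its generators one by one gives cyclic factors; the series is assembled upwards from
  \<open>lower_central G c\<close>.\<close>

lemma poly_of_fg_nilpotent:
  assumes fg: "finitely_generated G" and c: "lower_central G c = {\<one>}"
  shows "\<exists>h. poly 1 {\<one>} h (carrier G)"
proof -
  obtain S where S: "finite S" "S \<subseteq> carrier G" "generate G S = carrier G"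
    using fg unfolding finitely_generated_def by blast
  have "i \<le> c \<Longrightarrow> \<exists>h. poly 1 {\<one>} h (lower_central G (c - i))" for i
  proof (induction i)
    case 0
    have "poly 1 {\<one>} 0 {\<one>}" by (rule poly_base[OF triv_subgroup])
    then show ?case unfolding diff_zero c by blast
  next
    case (Suc i)
    define n where "n = c - Suc i"
    have n: "c - i = Suc n" using Suc.prems unfolding n_def by simp
    obtain h where h: "poly 1 {\<one>} h (lower_central G (Suc n))" using Suc unfolding n by auto
    obtain Y where Y: "finite Y" "Y \<subseteq> lower_central G n"
      "\<And>L. subgroup L G \<Longrightarrow> Y \<subseteq> L \<Longrightarrow> lower_central G (Suc n) \<subseteq> L \<Longrightarrow> lower_central G n \<subseteq> L"
      using lower_central_fg[OF S, of n] by blast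
    have "Y \<subseteq> central_mod (lower_central G (Suc n))" using Y(2) lower_central_central_mod by (rule order_trans)
    then obtain M k where M: "poly 1 (lower_central G (Suc n)) k M" "normal_set M" "Y \<subseteq> M"
      "\<And>L. subgroup L G \<Longrightarrow> lower_central G (Suc n) \<subseteq> L \<Longrightarrow> Y \<subseteq> L \<Longrightarrow> M \<subseteq> L"
      using poly_central[OF normal_lower_central Y(1)] by blast
    have "M = lower_central G n"
    proof
      show "M \<subseteq> lower_central G n" by (rule M(4)[OF lower_central_subgroup lower_central_mono Y(2)])
      show "lower_central G n \<subseteq> M" by (rule Y(3)[OF normal_setD(1)[OF M(2)] M(3) poly_subset[OF M(1)]])
    qed
    then show ?case using poly_trans[OF M(1) h] unfolding n_def by blast
  qed
  from this[of c] show ?thesis by simp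
qed

section \<open>Upper central series and its torsion\<close>

primrec upper_central :: "nat \<Rightarrow> 'a set" where
  "upper_central 0 = {\<one>}"
| "upper_central (Suc n) = central_mod (upper_central n)"

lemma normal_upper_central: "normal_set (upper_central n)"
proof (induction n)
  case 0 then show ?case unfolding normal_set_def by (simp add: triv_subgroup)
qed (simp add: normal_central_mod)

lemma upper_central_top:
  assumes "lower_central G c = {\<one>}" shows "upper_central c = carrier G"
proof -
  have "i \<le> c \<Longrightarrow> lower_central G (c - i) \<subseteq> upper_central i" for i
  proof (induction i)
    case 0 then show ?case using assms by simp
  next
    case (Suc i)
    then have "lower_central G (Suc (c - Suc i)) \<subseteq> upper_central i" by (simp add: Suc_diff_Suc)
    then show ?case
      using lower_central_central_mod[of "c - Suc i"] unfolding upper_central.simps central_mod_def by blast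
  qed
  from this[of c] show ?thesis using normal_setD(3)[OF normal_upper_central[of c]] by auto
qed

text \<open>If the centre is torsion-free then so are all factors of the upper central series, since
  taking the commutator with \<open>y\<close> maps each factor homomorphically into the previous one.\<close>

lemma upper_central_isolated:
  assumes tf: "\<And>x n. x \<in> central_mod {\<one>} \<Longrightarrow> 0 < (n::nat) \<Longrightarrow> x [^] n = \<one> \<Longrightarrow> x = \<one>"
  shows "x \<in> upper_central (Suc i) \<Longrightarrow> 0 < (n::nat) \<Longrightarrow> x [^] n \<in> upper_central i \<Longrightarrow> x \<in> upper_central i"
proof (induction i arbitrary: x)
  case 0 then show ?case using tf by auto
next
  case (Suc i)
  let ?Z = "upper_central i"
  note Z = normal_setD[OF normal_upper_central[of i]]
  have xc: "x \<in> carrier G" using Suc.prems(1) normal_setD(3)[OF normal_upper_central] by blast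
  \<comment> \<open>The induction hypothesis is applied to the commutator, which lies one term lower
    than \<open>x\<close>; its \<open>n\<close>-th power has to be found in
    \<open>?Z\<close>.\<close>
  have "comm x y \<in> ?Z" if y: "y \<in> carrier G" for y
  proof (rule Suc.IH[OF _ Suc.prems(2)])
    show kZ: "comm x y \<in> upper_central (Suc i)" using Suc.prems(1) y by (simp add: central_mod_def)
    define k where "k = comm x y"
    have kc: "k \<in> carrier G" unfolding k_def using xc y by simp
    have kcomm: "comm g k \<in> ?Z" if g: "g \<in> carrier G" for g
    proof -
      have "comm k g \<in> ?Z" using kZ g unfolding k_def[symmetric] by (simp add: central_mod_def)
      then show ?thesis using subgroup.m_inv_closed[OF Z(1)] commutator_rewrites(6)[of k g k k] kc g by fastforce
    qed
    \<comment> \<open>Modulo \<open>?Z\<close> the commutator \<open>k\<close> is central, so taking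
      the commutator with \<open>y\<close> turns \<open>x [^] m\<close> into
      \<open>k [^] m\<close>.\<close>
    have "\<exists>z\<in>?Z. comm (x [^] m) y = z \<otimes> k [^] m" for m :: nat
    proof (induction m)
      case 0 show ?case using y subgroup.one_closed[OF Z(1)] by (intro bexI[of _ \<one>]) auto
    next
      case (Suc m)
      then obtain z where z: "z \<in> ?Z" "comm (x [^] m) y = z \<otimes> k [^] m" by blast
      have zc: "z \<in> carrier G" using Z(3)[OF z(1)] .
      have xm: "x [^] m \<in> carrier G" using xc by simp
      have "comm (x [^] Suc m) y = (x [^] m \<otimes> k \<otimes> inv (x [^] m)) \<otimes> (z \<otimes> k [^] m)"
        unfolding nat_pow_Suc comm_identities(4)[OF y y xm xc] z(2) k_def ..
      also have "\<dots> = (comm (x [^] m) k \<otimes> k) \<otimes> (z \<otimes> k [^] m)"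
        by (rule arg_cong[OF commutator_rewrites(7)[OF xm kc kc kc], of "\<lambda>u. u \<otimes> (z \<otimes> k [^] m)"])
      also have "\<dots> = (comm (x [^] m) k \<otimes> (k \<otimes> z \<otimes> inv k)) \<otimes> (k \<otimes> k [^] m)"
      proof -
        have "(c \<otimes> k) \<otimes> (z \<otimes> l) = (c \<otimes> (k \<otimes> z \<otimes> inv k)) \<otimes> (k \<otimes> l)"
          if "c \<in> carrier G" "l \<in> carrier G" for c l
          using that kc zc by (simp add: m_assoc)
        then show ?thesis using xm kc by simp
      qed
      also have "k \<otimes> k [^] m = k [^] Suc m" by (rule nat_pow_Suc2[OF kc, symmetric])
      finally show ?case
        using subgroup.m_closed[OF Z(1) kcomm[OF xm] Z(2)[OF kc z(1)]] by blast
    qed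
    then obtain z where z: "z \<in> ?Z" "comm (x [^] n) y = z \<otimes> k [^] n" by blast
    have zc: "z \<in> carrier G" using Z(3)[OF z(1)] .
    have "comm (x [^] n) y \<in> ?Z" using Suc.prems(3) y by (simp add: central_mod_def)
    then have "inv z \<otimes> (z \<otimes> k [^] n) \<in> ?Z"
      unfolding z(2) by (rule subgroup.m_closed[OF Z(1) subgroup.m_inv_closed[OF Z(1) z(1)]])
    then show "comm x y [^] n \<in> ?Z" unfolding k_def[symmetric] using zc kc by simp
  qed
  then show ?case using xc by (simp add: central_mod_def)
qed


text \<open>The map \<open>f\<close> is only required to be a homomorphism modulo \<open>N\<close>; this covers inclusions
  (restriction of a series to a subgroup) and power maps.\<close>

lemma poly_pullback:
  assumes poly: "poly p T h A" and D: "subgroup D G" and N: "subgroup N G" "N \<subseteq> T"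
    and f: "\<And>x. x \<in> D \<Longrightarrow> f x \<in> carrier G"
    and fm: "\<And>x y. x \<in> D \<Longrightarrow> y \<in> D \<Longrightarrow> \<exists>n\<in>N. f (x \<otimes> y) = n \<otimes> (f x \<otimes> f y)"
  shows "\<exists>h'. poly p {x \<in> D. f x \<in> T} h' {x \<in> D. f x \<in> A}"
proof -
  note D' = subgroup.one_closed[OF D] subgroup.m_closed[OF D] subgroup.m_inv_closed[OF D]
    subgroup.mem_carrier[OF D]
  note N' = subgroup.one_closed[OF N(1)] subgroup.m_closed[OF N(1)] subgroup.m_inv_closed[OF N(1)]
    subgroup.mem_carrier[OF N(1)]
  have f1: "f \<one> \<in> N"
  proof -
    obtain n where n: "n \<in> N" "f (\<one> \<otimes> \<one>) = n \<otimes> (f \<one> \<otimes> f \<one>)" using fm[OF D'(1) D'(1)] by blast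
    have c: "f \<one> \<in> carrier G" "n \<in> carrier G" using f[OF D'(1)] N'(4)[OF n(1)] by auto
    have "\<one> \<otimes> f \<one> = (n \<otimes> f \<one>) \<otimes> f \<one>" using n(2) c by (simp add: m_assoc)
    then have "\<one> = n \<otimes> f \<one>" using c by (metis m_closed one_closed right_cancel)
    then have "f \<one> = inv n" using c by (metis inv_equality inv_inv inv_comm)
    then show ?thesis using N'(3)[OF n(1)] by simp
  qed
  have finv: "\<exists>n\<in>N. f (inv x) = inv (f x) \<otimes> n" if x: "x \<in> D" for x
  proof -
    obtain n where n: "n \<in> N" "f (x \<otimes> inv x) = n \<otimes> (f x \<otimes> f (inv x))" using fm[OF x D'(3)[OF x]] by blast
    have c: "f x \<in> carrier G" "f (inv x) \<in> carrier G" "n \<in> carrier G" "f \<one> \<in> carrier G"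
      using f[OF x] f[OF D'(3)[OF x]] N'(4)[OF n(1)] f[OF D'(1)] by auto
    have "x \<otimes> inv x = \<one>" using D'(4)[OF x] by simp
    then have "inv (f x) \<otimes> (inv n \<otimes> f \<one>) = f (inv x)"
      using n(2) c by (simp add: m_assoc)
    then show ?thesis using N'(2)[OF N'(3)[OF n(1)] f1] by (intro bexI[of _ "inv n \<otimes> f \<one>"]) simp_all
  qed
  have sub: "subgroup {x \<in> D. f x \<in> K} G" if K: "subgroup K G" "N \<subseteq> K" for K
  proof (rule subgroupI)
    show "{x \<in> D. f x \<in> K} \<subseteq> carrier G" using D'(4) by auto
    show "{x \<in> D. f x \<in> K} \<noteq> {}" using D'(1) f1 K(2) by blast
    fix x assume "x \<in> {x \<in> D. f x \<in> K}"
    then have x: "x \<in> D" "f x \<in> K" by auto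
    obtain n where n: "n \<in> N" "f (inv x) = inv (f x) \<otimes> n" using finv[OF x(1)] by blast
    have "f (inv x) \<in> K" unfolding n(2)
      by (rule subgroup.m_closed[OF K(1) subgroup.m_inv_closed[OF K(1) x(2)] subsetD[OF K(2) n(1)]])
    then show "inv x \<in> {x \<in> D. f x \<in> K}" using D'(3)[OF x(1)] by blast
    fix y assume "y \<in> {x \<in> D. f x \<in> K}"
    then have y: "y \<in> D" "f y \<in> K" by auto
    obtain m where m: "m \<in> N" "f (x \<otimes> y) = m \<otimes> (f x \<otimes> f y)" using fm[OF x(1) y(1)] by blast
    have "f (x \<otimes> y) \<in> K" unfolding m(2)
      by (rule subgroup.m_closed[OF K(1) subsetD[OF K(2) m(1)] subgroup.m_closed[OF K(1) x(2) y(2)]])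
    then show "x \<otimes> y \<in> {x \<in> D. f x \<in> K}" using D'(2)[OF x(1) y(1)] by blast
  qed
  have step: "\<exists>s d. cyclic_ext {x \<in> D. f x \<in> B} s {x \<in> D. f x \<in> A} \<and>
      (\<forall>k::nat. deg B a (f (s [^] k)) (d * int k))"
    if ext: "cyclic_ext B a A" and NB: "N \<subseteq> B" for B a A
  proof -
    let ?D = "{x \<in> D. f x \<in> A}"
    have NA: "N \<subseteq> A" using NB cyclic_extD(3)[OF ext] by blast
    obtain s d where s: "cyclic_ext {x \<in> ?D. deg B a (f x) 0} s ?D"
      "\<And>k::nat. deg B a (f (s [^] k)) (d * int k)"
    proof (rule cyclic_ext_of_rel[OF sub[OF cyclic_extD(2)[OF ext] NA], of "\<lambda>x. deg B a (f x)"])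
      show "\<exists>j. deg B a (f x) j" if "x \<in> ?D" for x using deg_ex[OF ext] that by blast
      show "deg B a (f (x \<otimes> y)) (j + k)"
        if xy: "x \<in> ?D" "y \<in> ?D" "deg B a (f x) j" "deg B a (f y) k" for x y j k
      proof -
        obtain m where m: "m \<in> N" "f (x \<otimes> y) = m \<otimes> (f x \<otimes> f y)" using fm xy(1,2) by blast
        have "deg B a m 0" using deg_0[OF ext] m(1) NB by blast
        from deg_mult[OF ext this deg_mult[OF ext xy(3,4)]] show ?thesis unfolding m(2) by simp
      qed
      show "deg B a (f (inv x)) (- j)" if xj: "x \<in> ?D" "deg B a (f x) j" for x j
      proof -
        obtain n where n: "n \<in> N" "f (inv x) = inv (f x) \<otimes> n" using finv xj(1) by blast
        have "deg B a n 0" using deg_0[OF ext] n(1) NB by blast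
        from deg_mult[OF ext deg_inv[OF ext xj(2)] this] show ?thesis unfolding n(2) by simp
      qed
    qed blast
    have *: "{x \<in> ?D. deg B a (f x) 0} = {x \<in> D. f x \<in> B}"
      using deg_0[OF ext] cyclic_extD(3)[OF ext] by blast
    show ?thesis by (intro exI[of _ s] exI[of _ d] conjI allI s(2) s(1)[unfolded *])
  qed
  show ?thesis using poly N(2)
  proof (induction rule: poly.induct)
    case poly_base
    then show ?case using poly.poly_base[OF sub[OF poly_base(1) N(2)]] by blast
  next
    case (poly_fin h B a A n)
    note ext = poly_fin.hyps(2)
    have NB: "N \<subseteq> B" using poly_subset[OF poly_fin.hyps(1)] N(2) by blast
    obtain h' where h': "poly p {x \<in> D. f x \<in> T} h' {x \<in> D. f x \<in> B}" using poly_fin.IH N(2) by blast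
    obtain s d where s: "cyclic_ext {x \<in> D. f x \<in> B} s {x \<in> D. f x \<in> A}"
      "\<And>k::nat. deg B a (f (s [^] k)) (d * int k)" using step[OF ext NB] by blast
    \<comment> \<open>The exponent \<open>n\<close> of the original factor works again, so
      coprimality to \<open>p\<close> is kept.\<close>
    have "f (s [^] n) \<in> B" by (rule deg_pow_in[OF ext s(2) fin_int_pow_in[OF ext poly_fin.hyps(5)]])
    moreover have "s [^] n \<in> D" using subgroup_nat_pow_closed[OF D] cyclic_extD(4)[OF s(1)] by blast
    ultimately show ?case using poly.poly_fin[OF h' s(1) poly_fin.hyps(3,4)] by blast
  next
    case (poly_inf h B a A)
    note ext = poly_inf.hyps(2)
    have NB: "N \<subseteq> B" using poly_subset[OF poly_inf.hyps(1)] N(2) by blast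
    obtain h' where h': "poly p {x \<in> D. f x \<in> T} h' {x \<in> D. f x \<in> B}" using poly_inf.IH N(2) by blast
    obtain s d where s: "cyclic_ext {x \<in> D. f x \<in> B} s {x \<in> D. f x \<in> A}"
      "\<And>k::nat. deg B a (f (s [^] k)) (d * int k)" using step[OF ext NB] by blast
    note sE = cyclic_extD[OF s(1)]
    show ?case
    proof (cases "d = 0")
      \<comment> \<open>The generator has degree 0, so the preimages of \<open>A\<close> and
        \<open>B\<close> agree and the factor disappears. An infinite factor thus never becomes a
        nontrivial finite one, which is essential for \<open>p = 0\<close>.\<close>
      case True
      have "f s \<in> B" using s(2)[of 1] True deg_0[OF ext] sE(5) by simp
      then have sB: "s \<in> {x \<in> D. f x \<in> B}" using sE(4) by blast
      have "{x \<in> D. f x \<in> A} \<subseteq> {x \<in> D. f x \<in> B}"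
      proof
        fix x assume "x \<in> {x \<in> D. f x \<in> A}"
        then obtain b j where bj: "b \<in> {x \<in> D. f x \<in> B}" "x = b \<otimes> s [^] (j::int)" using sE(7) by blast
        show "x \<in> {x \<in> D. f x \<in> B}" unfolding bj(2)
          by (rule subgroup.m_closed[OF sE(1) bj(1) subgroup_int_pow_closed[OF sE(1) sB]])
      qed
      then have "{x \<in> D. f x \<in> A} = {x \<in> D. f x \<in> B}" using sE(3) by blast
      then show ?thesis using h' by metis
    next
      case False
      have "s [^] n \<notin> {x \<in> D. f x \<in> B}" if "0 < n" for n :: nat
      proof
        assume "s [^] n \<in> {x \<in> D. f x \<in> B}"
        then have "deg B a (f (s [^] n)) 0" using deg_0[OF ext] by blast
        then have "a [^] (d * int n - 0) \<in> B" by (rule deg_unique[OF ext s(2)])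
        then show False using inf_int_pow_notin[OF ext poly_inf.hyps(3), of "d * int n"] False that by simp
      qed
      then show ?thesis using poly.poly_inf[OF h' s(1)] by blast
    qed
  qed
qed

section \<open>Removal of finite factors\<close>

lemma pow_mult_mod:
  assumes N: "subgroup N G" "\<And>x n. x \<in> A \<Longrightarrow> n \<in> N \<Longrightarrow> x \<otimes> n \<otimes> inv x \<in> N"
    and A: "subgroup A G" and com: "\<And>x y. x \<in> A \<Longrightarrow> y \<in> A \<Longrightarrow> comm x y \<in> N"
    and xy: "x \<in> A" "y \<in> A"
  shows "\<exists>m\<in>N. (x \<otimes> y) [^] (n::nat) = m \<otimes> (x [^] n \<otimes> y [^] n)"
proof (induction n)
  case 0 show ?case using subgroup.one_closed[OF N(1)] by (intro bexI[of _ \<one>]) auto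
next
  case (Suc n)
  then obtain m where m: "m \<in> N" "(x \<otimes> y) [^] n = m \<otimes> (x [^] n \<otimes> y [^] n)" by blast
  have c: "x \<in> carrier G" "y \<in> carrier G" "m \<in> carrier G"
    using subgroup.mem_carrier[OF A] subgroup.mem_carrier[OF N(1)] xy m(1) by auto
  have pA: "x [^] n \<in> A" "y [^] n \<in> A" using subgroup_nat_pow_closed[OF A] xy by auto
  have "(m \<otimes> (u \<otimes> v)) \<otimes> (x \<otimes> y) = (m \<otimes> (u \<otimes> comm v x \<otimes> inv u)) \<otimes> ((u \<otimes> x) \<otimes> (v \<otimes> y))"
    if "u \<in> carrier G" "v \<in> carrier G" for u v
    using that c by (simp add: m_assoc)
  from this[of "x [^] n" "y [^] n"]
  have "(x \<otimes> y) [^] Suc n =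
      (m \<otimes> (x [^] n \<otimes> comm (y [^] n) x \<otimes> inv (x [^] n))) \<otimes> (x [^] Suc n \<otimes> y [^] Suc n)"
    unfolding nat_pow_Suc m(2) using c by blast
  moreover have "m \<otimes> (x [^] n \<otimes> comm (y [^] n) x \<otimes> inv (x [^] n)) \<in> N"
    by (rule subgroup.m_closed[OF N(1) m(1) N(2)[OF pA(1) com[OF pA(2) xy(1)]]])
  ultimately show ?case by blast
qed

text \<open>Modulo \<open>N\<close> the group is abelian and torsion-free, so at a finite step the
  map to \<open>x [^] n\<close> is a homomorphism modulo \<open>N\<close> with kernel
  \<open>N\<close> that sends \<open>A\<close> into \<open>B\<close>. Pulling the series of
  \<open>B\<close> back along it gives a series of \<open>A\<close> without the finite
  factor.\<close>

lemma poly_0_of_torsion_free_abelian: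
  assumes "poly 1 N h A"
    and "\<And>x y. x \<in> A \<Longrightarrow> y \<in> A \<Longrightarrow> comm x y \<in> N"
    and "\<And>x n. x \<in> A \<Longrightarrow> 0 < (n::nat) \<Longrightarrow> x [^] n \<in> N \<Longrightarrow> x \<in> N"
  shows "\<exists>h'. poly 0 N h' A"
  using assms
proof (induction rule: poly.induct)
  case poly_base then show ?case using poly.poly_base by blast
next
  case (poly_fin h B a A n)
  note E = cyclic_extD[OF poly_fin.hyps(2)]
  have N: "subgroup N G" "N \<subseteq> B"
    using poly_base_subgroup[OF poly_fin.hyps(1)] poly_subset[OF poly_fin.hyps(1)] by auto
  obtain h' where h': "poly 0 N h' B" using poly_fin.IH poly_fin.prems E(3) by blast
  have conj: "x \<otimes> m \<otimes> inv x \<in> N" if x: "x \<in> A" and m: "m \<in> N" for x m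
  proof -
    have mA: "m \<in> A" using m N(2) E(3) by blast
    show ?thesis
      by (subst commutator_rewrites(7)[OF E(9)[OF x] E(9)[OF mA] E(9)[OF mA] E(9)[OF mA]], rule subgroup.m_closed[OF N(1) poly_fin.prems(1)[OF x mA] m])
  qed
  have "\<exists>h'. poly 0 {x \<in> A. x [^] n \<in> N} h' {x \<in> A. x [^] n \<in> B}"
    by (rule poly_pullback[OF h' E(2) N(1) order_refl])
      (use E(9) pow_mult_mod[OF N(1) conj E(2) poly_fin.prems(1)] in auto)
  moreover have "{x \<in> A. x [^] n \<in> B} = A" using ext_pow_in[OF poly_fin.hyps(2) _ poly_fin.hyps(5)] by blast
  moreover have "{x \<in> A. x [^] n \<in> N} = N"
    using poly_fin.prems(2)[OF _ poly_fin.hyps(3)] subgroup_nat_pow_closed[OF N(1)] N(2) E(3) by blast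
  ultimately show ?case by simp
next
  case (poly_inf h B a A)
  note E = cyclic_extD[OF poly_inf.hyps(2)]
  obtain h' where h': "poly 0 N h' B" using poly_inf.IH poly_inf.prems E(3) by blast
  then show ?case using poly.poly_inf[OF h' poly_inf.hyps(2,3)] by blast
qed

section \<open>Series multiplied by a normal subgroup\<close>

lemma mem_set_mult: "x \<in> A <#> B \<longleftrightarrow> (\<exists>a\<in>A. \<exists>b\<in>B. x = a \<otimes> b)"
  unfolding set_mult_def by blast

lemma set_mult_normal_subgroup:
  assumes N: "normal_set N" and A: "subgroup A G" shows "subgroup (A <#> N) G"
proof (rule subgroupI)
  note N' = normal_setD[OF N]
  note Ac = subgroup.mem_carrier[OF A]
  show "A <#> N \<subseteq> carrier G" using N'(3) Ac by (auto simp: mem_set_mult)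
  show "A <#> N \<noteq> {}" using subgroup.one_closed[OF A] subgroup.one_closed[OF N'(1)] by (auto simp: set_mult_def)
  fix x assume "x \<in> A <#> N"
  then obtain a n where x: "a \<in> A" "n \<in> N" "x = a \<otimes> n" by (auto simp: mem_set_mult)
  have "inv x = inv a \<otimes> (a \<otimes> inv n \<otimes> inv a)"
    unfolding x(3) using Ac[OF x(1)] N'(3)[OF x(2)] by (simp add: m_assoc inv_mult_group)
  then show "inv x \<in> A <#> N"
    using subgroup.m_inv_closed[OF A x(1)] N'(2)[OF Ac[OF x(1)] subgroup.m_inv_closed[OF N'(1) x(2)]]
    unfolding mem_set_mult by blast
  fix y assume "y \<in> A <#> N"
  then obtain b m where y: "b \<in> A" "m \<in> N" "y = b \<otimes> m" by (auto simp: mem_set_mult)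
  have "x \<otimes> y = (a \<otimes> b) \<otimes> ((inv b \<otimes> n \<otimes> inv (inv b)) \<otimes> m)"
    unfolding x(3) y(3) using Ac[OF x(1)] N'(3)[OF x(2)] Ac[OF y(1)] N'(3)[OF y(2)] by (simp add: m_assoc)
  then show "x \<otimes> y \<in> A <#> N"
    using subgroup.m_closed[OF A x(1) y(1)]
      subgroup.m_closed[OF N'(1) N'(2)[OF inv_closed[OF Ac[OF y(1)]] x(2)] y(2)]
    unfolding mem_set_mult by blast
qed

lemma subset_set_mult: "subgroup N G \<Longrightarrow> A \<subseteq> carrier G \<Longrightarrow> A \<subseteq> A <#> N"
  using subgroup.one_closed[of N G] unfolding set_mult_def by force

lemma cyclic_ext_set_mult:
  assumes ext: "cyclic_ext B a A" and N: "normal_set N"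
  shows "cyclic_ext (B <#> N) a (A <#> N)"
proof -
  note E = cyclic_extD[OF ext] and N' = normal_setD[OF N]
  have "x \<otimes> b \<otimes> inv x \<in> B <#> N" if xb: "x \<in> A <#> N" "b \<in> B <#> N" for x b
  proof -
    obtain y n where y: "y \<in> A" "n \<in> N" "x = y \<otimes> n" using xb(1) by (auto simp: mem_set_mult)
    obtain c m where c: "c \<in> B" "m \<in> N" "b = c \<otimes> m" using xb(2) by (auto simp: mem_set_mult)
    have cr: "y \<in> carrier G" "n \<in> carrier G" "c \<in> carrier G" "m \<in> carrier G"
      using E(8,9) N'(3) y(1,2) c(1,2) by auto
    have "x \<otimes> b \<otimes> inv x = (y \<otimes> c \<otimes> inv y) \<otimes> (y \<otimes> ((inv c \<otimes> n \<otimes> inv (inv c)) \<otimes> (m \<otimes> inv n)) \<otimes> inv y)"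
      unfolding y(3) c(3) using cr by (simp add: m_assoc inv_mult_group)
    moreover have "y \<otimes> ((inv c \<otimes> n \<otimes> inv (inv c)) \<otimes> (m \<otimes> inv n)) \<otimes> inv y \<in> N"
      by (rule N'(2)[OF cr(1) subgroup.m_closed[OF N'(1) N'(2)[OF inv_closed[OF cr(3)] y(2)]
              subgroup.m_closed[OF N'(1) c(2) subgroup.m_inv_closed[OF N'(1) y(2)]]]])
    ultimately show ?thesis using E(6)[OF y(1) c(1)] unfolding mem_set_mult by blast
  qed
  moreover have "\<exists>b\<in>B <#> N. \<exists>j::int. x = b \<otimes> a [^] j" if x: "x \<in> A <#> N" for x
  proof -
    obtain y n where y: "y \<in> A" "n \<in> N" "x = y \<otimes> n" using x by (auto simp: mem_set_mult)
    obtain b j where b: "b \<in> B" "y = b \<otimes> a [^] (j::int)" using E(7)[OF y(1)] by blast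
    have "x = (b \<otimes> (a [^] j \<otimes> n \<otimes> inv (a [^] j))) \<otimes> a [^] j"
      unfolding y(3) b(2) using E(8)[OF b(1)] N'(3)[OF y(2)] E(5) by (simp add: m_assoc)
    moreover have "b \<otimes> (a [^] j \<otimes> n \<otimes> inv (a [^] j)) \<in> B <#> N"
      using b(1) N'(2)[OF int_pow_closed[OF E(5)] y(2), of j] unfolding mem_set_mult by blast
    ultimately show ?thesis by blast
  qed
  moreover have "B <#> N \<subseteq> A <#> N" using E(3) unfolding set_mult_def by blast
  moreover have "a \<in> A <#> N" using subset_set_mult[OF N'(1), of A] E(4,9) by blast
  ultimately show ?thesis unfolding cyclic_ext_def
    using set_mult_normal_subgroup[OF N E(1)] set_mult_normal_subgroup[OF N E(2)] by blast
qed

text \<open>An infinite factor may become finite here, so the count \<open>h'\<close> is not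
  controlled.\<close>

lemma poly_set_mult:
  assumes "poly 1 T h A" and N: "normal_set N"
  shows "\<exists>h'. poly 1 (T <#> N) h' (A <#> N)"
  using assms(1)
proof (induction rule: poly.induct)
  case poly_base then show ?case using poly.poly_base[OF set_mult_normal_subgroup[OF N]] by blast
next
  case (poly_fin h B a A n)
  then show ?case using poly_1_step cyclic_ext_set_mult[OF poly_fin.hyps(2) N] by blast
next
  case (poly_inf h B a A)
  then show ?case using poly_1_step cyclic_ext_set_mult[OF poly_inf.hyps(2) N] by blast
qed

text \<open>If \<open>a [^] n\<close> is \<open>b\<close> in \<open>B\<close> times \<open>m\<close>
  in \<open>N\<close>, then \<open>a [^] (n * q)\<close> is \<open>b [^] q\<close>, because
  \<open>m\<close> is central and killed by \<open>q\<close>. So infinite factors stay infinite and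
  the count survives.\<close>

lemma poly_set_mult_central:
  assumes "poly 1 T h A" and N: "normal_set N" and q: "0 < (q::nat)"
    and N1: "\<And>n. n \<in> N \<Longrightarrow> n [^] q = \<one>" "\<And>n y. n \<in> N \<Longrightarrow> y \<in> carrier G \<Longrightarrow> n \<otimes> y = y \<otimes> n"
  shows "poly 1 (T <#> N) h (A <#> N)"
  using assms(1)
proof (induction rule: poly.induct)
  case poly_base then show ?case using poly.poly_base[OF set_mult_normal_subgroup[OF N]] by blast
next
  case (poly_fin h B a A n)
  have "a [^] n \<in> B <#> N"
    using subset_set_mult[OF normal_setD(1)[OF N], of B] cyclic_extD(8)[OF poly_fin.hyps(2)] poly_fin.hyps(5)
    by blast
  then show ?case
    using poly.poly_fin[OF poly_fin.IH cyclic_ext_set_mult[OF poly_fin.hyps(2) N] poly_fin.hyps(3,4)] by blast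
next
  case (poly_inf h B a A)
  note E = cyclic_extD[OF poly_inf.hyps(2)]
  have "a [^] n \<notin> B <#> N" if n: "0 < n" for n :: nat
  proof
    assume "a [^] n \<in> B <#> N"
    then obtain b m where b: "b \<in> B" "m \<in> N" "a [^] n = b \<otimes> m" unfolding mem_set_mult by blast
    have c: "b \<in> carrier G" "m \<in> carrier G" using E(8)[OF b(1)] normal_setD(3)[OF N b(2)] by auto
    have "a [^] (n * q) = (b \<otimes> m) [^] q" unfolding b(3)[symmetric] using E(5) by (simp add: nat_pow_pow)
    also have "\<dots> = b [^] q \<otimes> m [^] q"
      by (rule pow_mult_distrib[OF N1(2)[OF b(2) c(1), symmetric] c])
    also have "\<dots> = b [^] q" using N1(1)[OF b(2)] c by simp
    finally have "a [^] (n * q) \<in> B" using subgroup_nat_pow_closed[OF E(1) b(1), of q] by simp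
    then show False using poly_inf.hyps(3) n q by simp
  qed
  then show ?case
    using poly.poly_inf[OF poly_inf.IH cyclic_ext_set_mult[OF poly_inf.hyps(2) N]] by blast
qed

text \<open>The factors of the upper central series are torsion-free here. The series of
  \<open>G\<close> is restricted to one term, multiplied by the preceding one and freed from finite
  factors; the results are stacked.\<close>

lemma poly_0_of_torsion_free_nilpotent:
  assumes p1: "poly 1 {\<one>} h (carrier G)" and tf: "torsion_free G" and c: "lower_central G c = {\<one>}"
  shows "\<exists>h'. poly 0 {\<one>} h' (carrier G)"
proof -
  have iso: "x \<in> upper_central i"
    if "x \<in> upper_central (Suc i)" "0 < (n::nat)" "x [^] n \<in> upper_central i" for x n i
    using tf that unfolding torsion_free_def central_mod_def
    by (intro upper_central_isolated[of x i n]) (auto simp: central_mod_def)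
  have "\<exists>h'. poly 0 {\<one>} h' (upper_central i)" for i
  proof (induction i)
    case 0 show ?case using poly_base[OF triv_subgroup] by auto
  next
    case (Suc i)
    let ?A = "upper_central (Suc i)" and ?N = "upper_central i"
    note A = normal_setD[OF normal_upper_central[of "Suc i"]] and N = normal_setD[OF normal_upper_central[of i]]
    have NA: "?N \<subseteq> ?A" using normal_central_mod(2)[OF normal_upper_central] by simp
    \<comment> \<open>Restriction of the series to \<open>?A\<close> is the pullback along the
      identity map.\<close>
    have "\<exists>h'. poly 1 {x \<in> ?A. x \<in> {\<one>}} h' {x \<in> ?A. x \<in> carrier G}"
      by (rule poly_pullback[OF p1 A(1) triv_subgroup order_refl]) (use A(3) in auto)
    moreover have "{x \<in> ?A. x \<in> {\<one>}} = {\<one>}" using subgroup.one_closed[OF A(1)] by auto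
    moreover have "{x \<in> ?A. x \<in> carrier G} = ?A" using A(3) by auto
    ultimately obtain h1 where "poly 1 {\<one>} h1 ?A" by metis
    from poly_set_mult[OF this normal_upper_central[of i]]
    obtain h2 where h2: "poly 1 ({\<one>} <#> ?N) h2 (?A <#> ?N)" ..
    have e1: "{\<one>} <#> ?N = ?N" using N(3) unfolding set_mult_def by auto
    have e2: "?A <#> ?N = ?A"
    proof
      show "?A <#> ?N \<subseteq> ?A" using NA subgroup.m_closed[OF A(1)] unfolding set_mult_def by blast
      show "?A \<subseteq> ?A <#> ?N" by (rule subset_set_mult[OF N(1)]) (use A(3) in blast)
    qed
    have "\<exists>h'. poly 0 ?N h' ?A"
    proof (rule poly_0_of_torsion_free_abelian)
      show "poly 1 ?N h2 ?A" using h2 unfolding e1 e2 .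
      show "comm x y \<in> ?N" if "x \<in> ?A" "y \<in> ?A" for x y
        using that A(3)[OF that(2)] by (simp add: central_mod_def)
    qed (rule iso)
    then show ?case using Suc poly_trans by blast
  qed
  from this[of c] show ?thesis unfolding upper_central_top[OF c] .
qed


subsection \<open>Hirsch length and torsion\<close>

lemma r_coset_carrier_update: "r_coset (G\<lparr>carrier := A\<rparr>) B x = B #> x"
  unfolding r_coset_def by simp

lemma cyclic_ext_of_factor:
  assumes A: "subgroup A G" and B: "B \<lhd> G\<lparr>carrier := A\<rparr>"
    and cyc: "cyclic_group ((G\<lparr>carrier := A\<rparr>) Mod B)"
  shows "\<exists>a. cyclic_ext B a A"
proof -
  let ?A = "G\<lparr>carrier := A\<rparr>"
  interpret GA: group ?A by (rule subgroup_imp_group[OF A])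
  interpret B: normal B ?A by (rule B)
  interpret Q: group "?A Mod B" by (rule B.factorgroup_is_group)
  have BA: "subgroup B ?A" by (rule B.is_subgroup)
  have BG: "subgroup B G" by (rule incl_subgroup[OF A BA])
  have BsA: "B \<subseteq> A" using B.subset by simp
  obtain C where C: "C \<in> carrier (?A Mod B)" "carrier (?A Mod B) = range (\<lambda>n::int. C [^]\<^bsub>?A Mod B\<^esub> n)"
    using cyc unfolding Q.cyclic_group by blast
  have "C \<in> (\<lambda>x. B #> x) ` A" using C(1) by (simp add: carrier_FactGroup r_coset_carrier_update)
  then obtain a where a: "a \<in> A" "C = B #> a" by blast
  have Cpow: "C [^]\<^bsub>?A Mod B\<^esub> n = B #> a [^] n" for n :: int
    using B.FactGroup_int_pow[of a n] a int_pow_consistent[OF A a(1), of n] by (simp add: r_coset_carrier_update)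
  have "\<exists>b\<in>B. \<exists>j::int. x = b \<otimes> a [^] j" if x: "x \<in> A" for x
  proof -
    have "B #> x \<in> carrier (?A Mod B)" using x by (auto simp: carrier_FactGroup r_coset_carrier_update)
    then obtain j :: int where "B #> x = B #> a [^] j" unfolding C(2) Cpow by blast
    then have "x \<in> B #> a [^] j" using rcos_self[OF subgroup.mem_carrier[OF A x] BG] by simp
    then show ?thesis unfolding r_coset_def by blast
  qed
  moreover have "x \<otimes> b \<otimes> inv x \<in> B" if "x \<in> A" "b \<in> B" for x b
    using B.inv_op_closed2[of x b] that m_inv_consistent[OF A that(1)] by simp
  ultimately have "cyclic_ext B a A" unfolding cyclic_ext_def using A BG BsA a(1) by blast
  then show ?thesis ..
qed

context
  fixes B a A assumes ext: "cyclic_ext B a A"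
begin

lemma factor_carrier: "carrier ((G\<lparr>carrier := A\<rparr>) Mod B) = range (\<lambda>j::int. B #> a [^] j)"
proof -
  note E = cyclic_extD[OF ext]
  have eq: "B #> (b \<otimes> a [^] j) = B #> a [^] j" if "b \<in> B" for b and j :: int
    using repr_independence[OF _ int_pow_closed[OF E(5)] E(1), of "b \<otimes> a [^] j" j] that
    unfolding r_coset_def by blast
  have "(\<lambda>x. B #> x) ` A = range (\<lambda>j::int. B #> a [^] j)"
  proof
    show "(\<lambda>x. B #> x) ` A \<subseteq> range (\<lambda>j::int. B #> a [^] j)"
    proof
      fix C assume "C \<in> (\<lambda>x. B #> x) ` A"
      then obtain x where x: "x \<in> A" "C = B #> x" by blast
      obtain b j where b: "b \<in> B" "x = b \<otimes> a [^] (j::int)" using E(7)[OF x(1)] by blast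
      show "C \<in> range (\<lambda>j::int. B #> a [^] j)" unfolding x(2) b(2) eq[OF b(1)] by blast
    qed
    show "range (\<lambda>j::int. B #> a [^] j) \<subseteq> (\<lambda>x. B #> x) ` A"
      using subgroup_int_pow_closed[OF E(2,4)] by blast
  qed
  then show ?thesis by (simp add: carrier_FactGroup r_coset_carrier_update)
qed

lemma factor_infinite: "infinite (carrier ((G\<lparr>carrier := A\<rparr>) Mod B)) \<longleftrightarrow> (\<forall>n::nat>0. a [^] n \<notin> B)"
proof
  note E = cyclic_extD[OF ext]
  assume inf: "infinite (carrier ((G\<lparr>carrier := A\<rparr>) Mod B))"
  show "\<forall>n::nat>0. a [^] n \<notin> B"
  proof (intro allI impI notI)
    fix n :: nat assume n: "0 < n" "a [^] n \<in> B"
    have "range (\<lambda>j::int. B #> a [^] j) \<subseteq> (\<lambda>j::int. B #> a [^] j) ` {0..<int n}"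
    proof
      fix C assume "C \<in> range (\<lambda>j::int. B #> a [^] j)"
      then obtain j :: int where C: "C = B #> a [^] j" by blast
      have "a [^] j = a [^] ((j div int n) * int n + j mod int n)" by simp
      also have "\<dots> = a [^] ((j div int n) * int n) \<otimes> a [^] (j mod int n)" by (rule int_pow_mult[OF E(5)])
      finally have "a [^] j \<in> B #> a [^] (j mod int n)"
        using fin_int_pow_in[OF ext n(2)] unfolding r_coset_def by blast
      then have "C = B #> a [^] (j mod int n)"
        using repr_independence[OF _ int_pow_closed[OF E(5)] E(1)] C by metis
      then show "C \<in> (\<lambda>j::int. B #> a [^] j) ` {0..<int n}" using n(1) by simp
    qed
    then have "finite (range (\<lambda>j::int. B #> a [^] j))" by (rule finite_subset) simp
    then show False using inf unfolding factor_carrier by blast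
  qed
next
  note E = cyclic_extD[OF ext]
  assume inf: "\<forall>n::nat>0. a [^] n \<notin> B"
  have "inj (\<lambda>j::int. B #> a [^] j)"
  proof (rule injI)
    fix i j :: int assume ij: "B #> a [^] i = B #> a [^] j"
    have "a [^] i \<in> B #> a [^] i" by (rule rcos_self[OF int_pow_closed[OF E(5)] E(1)])
    then have "deg B a (a [^] i) i" "deg B a (a [^] i) j" unfolding deg_def ij using ij
      by (auto simp: r_coset_def)
    then have "a [^] (i - j) \<in> B" by (rule deg_unique[OF ext])
    then show "i = j" using inf_int_pow_notin[OF ext inf, of "i - j"] by auto
  qed
  then show "infinite (carrier ((G\<lparr>carrier := A\<rparr>) Mod B))"
    unfolding factor_carrier using finite_imageD[of _ UNIV] infinite_UNIV_int by blast
qed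

lemma cyclic_ext_factor: "B \<lhd> G\<lparr>carrier := A\<rparr>" "cyclic_group ((G\<lparr>carrier := A\<rparr>) Mod B)"
proof -
  note E = cyclic_extD[OF ext]
  let ?A = "G\<lparr>carrier := A\<rparr>"
  interpret GA: group ?A by (rule subgroup_imp_group[OF E(2)])
  show nB: "B \<lhd> ?A" unfolding GA.normal_inv_iff
    using subgroup_incl[OF E(1,2,3)] E(6) m_inv_consistent[OF E(2)] by simp
  interpret B: normal B ?A by (rule nB)
  interpret Q: group "?A Mod B" by (rule B.factorgroup_is_group)
  have "(B #> a) [^]\<^bsub>?A Mod B\<^esub> n = B #> a [^] n" for n :: int
    using B.FactGroup_int_pow[of a n] E(4) int_pow_consistent[OF E(2,4), of n] by (simp add: r_coset_carrier_update)
  then have "carrier (?A Mod B) = range (\<lambda>n::int. (B #> a) [^]\<^bsub>?A Mod B\<^esub> n)" unfolding factor_carrier by simp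
  moreover have "B #> a \<in> carrier (?A Mod B)" using E(4) by (auto simp: carrier_FactGroup r_coset_carrier_update)
  ultimately show "cyclic_group (?A Mod B)" unfolding Q.cyclic_group by blast
qed

end

lemma poly_of_has_hirsch_length:
  assumes "has_hirsch_length G h" shows "poly 1 {\<one>} h (carrier G)"
proof -
  obtain r K where K: "K 0 = {\<one>}" "K r = carrier G"
    and step: "\<And>i. i < r \<Longrightarrow> subgroup (K (Suc i)) G \<and> K i \<lhd> G\<lparr>carrier := K (Suc i)\<rparr> \<and> cyclic_group (series_factor G K i)"
    and h: "card {i. i < r \<and> infinite (carrier (series_factor G K i))} = h"
    using assms unfolding has_hirsch_length_def cyclic_series_def by blast
  have "i \<le> r \<Longrightarrow> poly 1 {\<one>} (card {j. j < i \<and> infinite (carrier (series_factor G K j))}) (K i)" for i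
  proof (induction i)
    case 0 show ?case using poly_base[OF triv_subgroup] K(1) by simp
  next
    case (Suc i)
    let ?I = "\<lambda>i. {j. j < i \<and> infinite (carrier (series_factor G K j))}"
    have IH: "poly 1 {\<one>} (card (?I i)) (K i)" using Suc by simp
    have i: "i < r" using Suc.prems by simp
    obtain a where a: "cyclic_ext (K i) a (K (Suc i))" using cyclic_ext_of_factor step[OF i] by blast
    show ?case
    proof (cases "infinite (carrier (series_factor G K i))")
      case True
      have "?I (Suc i) = insert i (?I i)" using True by (auto simp: less_Suc_eq)
      then have "card (?I (Suc i)) = Suc (card (?I i))" by simp
      then show ?thesis using poly_inf[OF IH a] True factor_infinite[OF a] by simp
    next
      case False
      have "?I (Suc i) = ?I i" using False by (auto simp: less_Suc_eq)
      moreover obtain n :: nat where "0 < n" "a [^] n \<in> K i" using False factor_infinite[OF a] by blast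
      ultimately show ?thesis using poly_fin[OF IH a] by simp
    qed
  qed
  from this[of r] show ?thesis using K(2) h by simp
qed

text \<open>\<open>cyclic_series\<close> with an arbitrary top in place of the carrier, as the
  induction over \<open>poly\<close> requires.\<close>

definition series_to :: "nat \<Rightarrow> (nat \<Rightarrow> 'a set) \<Rightarrow> 'a set \<Rightarrow> bool" where
  "series_to r K A \<longleftrightarrow> K 0 = {\<one>} \<and> K r = A \<and>
     (\<forall>i<r. subgroup (K (Suc i)) G \<and> K i \<lhd> G\<lparr>carrier := K (Suc i)\<rparr> \<and> cyclic_group (series_factor G K i))"

lemma series_to_extend:
  assumes ext: "cyclic_ext B a A" and K: "series_to r K B"
  shows "series_to (Suc r) (K(Suc r := A)) A"
    and "card {i. i < Suc r \<and> infinite (carrier (series_factor G (K(Suc r := A)) i))} =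
      card {i. i < r \<and> infinite (carrier (series_factor G K i))} + (if \<forall>n::nat>0. a [^] n \<notin> B then 1 else 0)"
proof -
  let ?K = "K(Suc r := A)"
  have old: "?K i = K i" "?K (Suc i) = K (Suc i)" if "i < r" for i using that by simp_all
  have new: "?K r = B" "?K (Suc r) = A" using K unfolding series_to_def by simp_all
  show "series_to (Suc r) ?K A" unfolding series_to_def
  proof (intro conjI)
    show "?K 0 = {\<one>}" using K unfolding series_to_def by simp
    show "?K (Suc r) = A" by simp
    show "\<forall>i<Suc r. subgroup (?K (Suc i)) G \<and> ?K i \<lhd> G\<lparr>carrier := ?K (Suc i)\<rparr> \<and> cyclic_group (series_factor G ?K i)"
    proof (rule allI, rule impI)
      fix i assume "i < Suc r"
      then consider "i < r" | "i = r" by linarith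
      then show "subgroup (?K (Suc i)) G \<and> ?K i \<lhd> G\<lparr>carrier := ?K (Suc i)\<rparr> \<and> cyclic_group (series_factor G ?K i)"
      proof cases
        case 1
        show ?thesis unfolding old[OF 1] using K 1 unfolding series_to_def by blast
      next
        case 2
        show ?thesis unfolding 2 new by (intro conjI cyclic_extD(2)[OF ext] cyclic_ext_factor[OF ext])
      qed
    qed
  qed
  let ?I = "{i. i < r \<and> infinite (carrier (series_factor G K i))}"
  have "{i. i < Suc r \<and> infinite (carrier (series_factor G ?K i))} =
      {i. i < r \<and> infinite (carrier (series_factor G ?K i))} \<union>
      {i. i = r \<and> infinite (carrier (series_factor G ?K i))}"
    unfolding less_Suc_eq by blast
  also have "{i. i < r \<and> infinite (carrier (series_factor G ?K i))} = ?I"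
    by (rule Collect_cong, rule conj_cong[OF refl]) (simp only: old)
  also have "{i. i = r \<and> infinite (carrier (series_factor G ?K i))} = (if \<forall>n::nat>0. a [^] n \<notin> B then {r} else {})"
    unfolding factor_infinite[OF ext, symmetric] using new by (auto simp del: fun_upd_apply)
  finally have eq: "{i. i < Suc r \<and> infinite (carrier (series_factor G ?K i))} =
      ?I \<union> (if \<forall>n::nat>0. a [^] n \<notin> B then {r} else {})" .
  have "card (?I \<union> (if c then {r} else {})) = card ?I + (if c then 1 else 0)" for c by simp
  then show "card {i. i < Suc r \<and> infinite (carrier (series_factor G ?K i))} =
      card ?I + (if \<forall>n::nat>0. a [^] n \<notin> B then 1 else 0)"
    unfolding eq .
qed

lemma has_hirsch_length_of_poly:
  assumes "poly 1 {\<one>} h (carrier G)" shows "has_hirsch_length G h"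
proof -
  have "\<exists>r K. series_to r K A \<and> card {i. i < r \<and> infinite (carrier (series_factor G K i))} = h"
    if "poly 1 {\<one>} h A" for h A
    using that
  proof (induction rule: poly.induct)
    case poly_base
    show ?case by (intro exI[of _ 0] exI[of _ "\<lambda>_. {\<one>}"]) (simp add: series_to_def)
  next
    case (poly_fin h B a A n)
    then obtain r K where K: "series_to r K B" "card {i. i < r \<and> infinite (carrier (series_factor G K i))} = h"
      by blast
    have "\<not> (\<forall>n::nat>0. a [^] n \<notin> B)" using poly_fin.hyps(3,5) by blast
    then show ?case
      using series_to_extend[OF poly_fin.hyps(2) K(1)] K(2)
      by (intro exI[of _ "Suc r"] exI[of _ "K(Suc r := A)"]) (simp del: fun_upd_apply)
  next
    case (poly_inf h B a A)
    then obtain r K where K: "series_to r K B" "card {i. i < r \<and> infinite (carrier (series_factor G K i))} = h"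
      by blast
    show ?case
      using series_to_extend[OF poly_inf.hyps(2) K(1)] K(2) poly_inf.hyps(3)
      by (intro exI[of _ "Suc r"] exI[of _ "K(Suc r := A)"]) (simp del: fun_upd_apply)
  qed
  from this[OF assms] show ?thesis unfolding has_hirsch_length_def cyclic_series_def series_to_def .
qed

text \<open>Otherwise \<open>upper_central_isolated\<close> pushes every torsion element down the
  upper central series from the whole group to the identity.\<close>

lemma central_torsion:
  assumes c: "lower_central G c = {\<one>}" and ntf: "\<not> torsion_free G"
  shows "\<exists>t\<in>central_mod {\<one>}. t \<noteq> \<one> \<and> (\<exists>n::nat>0. t [^] n = \<one>)"
proof (rule ccontr)
  assume "\<not> ?thesis"
  then have tf: "\<And>x n. x \<in> central_mod {\<one>} \<Longrightarrow> 0 < (n::nat) \<Longrightarrow> x [^] n = \<one> \<Longrightarrow> x = \<one>" by blast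
  have "x = \<one>" if x: "x \<in> carrier G" and n: "0 < n" "x [^] n = \<one>" for x and n :: nat
  proof -
    have "i \<le> c \<Longrightarrow> x \<in> upper_central (c - i)" for i
    proof (induction i)
      case 0 show ?case using x upper_central_top[OF c] by simp
    next
      case (Suc i)
      then have 1: "x \<in> upper_central (Suc (c - Suc i))" by (simp add: Suc_diff_Suc del: upper_central.simps)
      have 2: "x [^] n \<in> upper_central (c - Suc i)"
        unfolding n(2) by (rule subgroup.one_closed[OF normal_setD(1)[OF normal_upper_central]])
      show ?case by (rule upper_central_isolated[OF _ 1 n(1) 2]) (rule tf)
    qed
    from this[of c] show ?thesis by simp
  qed
  then show False using ntf unfolding torsion_free_def by blast
qed

text \<open>\<open>q\<close> is the order of a central torsion element \<open>t\<close> and may be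
  composite. The group \<open>T\<close> of its powers is itself a section with \<open>q\<close>
  elements. Being central of exponent \<open>q\<close>, it can be multiplied into the series without
  losing any of the \<open>h\<close> infinite factors, and each of them contributes another factor
  \<open>q\<close>.\<close>

lemma torsion_section:
  assumes poly: "poly 1 {\<one>} h (carrier G)" and c: "lower_central G c = {\<one>}" and ntf: "\<not> torsion_free G"
  shows "\<exists>q>1. \<exists>S0 S F. power_section q (q ^ Suc h) S0 S \<and> covers S0 F (carrier G)"
proof -
  obtain t n where t: "t \<in> central_mod {\<one>}" "t \<noteq> \<one>" "0 < n" "t [^] (n::nat) = \<one>"
    using central_torsion[OF c ntf] by blast
  have tc: "t \<in> carrier G" using t(1) unfolding central_mod_def by blast
  have triv: "normal_set {\<one>}" unfolding normal_set_def by (simp add: triv_subgroup)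
  define q where "q = (LEAST n::nat. 0 < n \<and> t [^] n = \<one>)"
  have q: "0 < q" "t [^] q = \<one>" using LeastI[of "\<lambda>n::nat. 0 < n \<and> t [^] n = \<one>" n] t(3,4) unfolding q_def by auto
  have qmin: "q \<le> m" if "0 < m" "t [^] m = \<one>" for m :: nat unfolding q_def using that by (intro Least_le) simp
  have "q \<noteq> 1" using q(2) t(2) tc by auto
  then have q1: "1 < q" using q(1) by simp
  obtain T where T: "cyclic_ext {\<one>} t T" "normal_set T"
    "\<And>L. subgroup L G \<Longrightarrow> {\<one>} \<subseteq> L \<Longrightarrow> t \<in> L \<Longrightarrow> T \<subseteq> L"
    using cyclic_ext_central[OF triv t(1)] by blast
  note E = cyclic_extD[OF T(1)]
  have Tpow: "\<exists>j::int. x = t [^] j" if "x \<in> T" for x using E(7)[OF that] tc by auto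
  have Tq: "x [^] q = \<one>" if "x \<in> T" for x
    using ext_pow_in[OF T(1) that, of q] q(2) by simp
  have Tcentral: "x \<otimes> y = y \<otimes> x" if "x \<in> T" "y \<in> carrier G" for x y
  proof -
    have "x \<in> central_mod {\<one>}"
      using T(3)[OF normal_setD(1)[OF normal_central_mod(1)[OF triv]] normal_central_mod(2)[OF triv] t(1)] that(1) by blast
    then have xc: "x \<in> carrier G" and c1: "comm x y = \<one>" using that(2) unfolding central_mod_def by auto
    have "x \<otimes> y = comm x y \<otimes> (y \<otimes> x)" using xc that(2) by (simp add: m_assoc)
    then show ?thesis unfolding c1 using xc that(2) by simp
  qed
  let ?E = "(\<lambda>i. t [^] i) ` {..<q}"
  have sep: "i = j" if "i < q" "j < q" "t [^] i \<otimes> inv (t [^] j) = \<one>" for i j :: nat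
  proof -
    have eq: "t [^] i = t [^] j" using that(3) tc by (metis inv_closed inv_equality inv_inv nat_pow_closed)
    have *: "i = j" if "i \<le> j" "j < q" "t [^] i = t [^] j" for i j :: nat
    proof (rule ccontr)
      assume "i \<noteq> j"
      have "t [^] i \<otimes> t [^] (j - i) = t [^] (i + (j - i))" by (rule nat_pow_mult[OF tc])
      also have "\<dots> = t [^] i \<otimes> \<one>" using that(1,3) tc by simp
      finally have "t [^] i \<otimes> t [^] (j - i) = t [^] i \<otimes> \<one>" .
      then have "t [^] (j - i) = \<one>" using tc by (metis l_cancel nat_pow_closed one_closed)
      then have "q \<le> j - i" using qmin[of "j - i"] that(1) \<open>i \<noteq> j\<close> by simp
      then show False using that(2) by simp
    qed
    show ?thesis using *[of i j] *[of j i] that(1,2) eq by (metis nat_le_linear)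
  qed
  have Ecard: "card ?E = q"
  proof -
    have "inj_on (\<lambda>i. t [^] i) {..<q}"
    proof (rule inj_onI)
      fix i j assume ij: "i \<in> {..<q}" "j \<in> {..<q}" "t [^] i = t [^] j"
      then show "i = j" using sep[of i j] tc by simp
    qed
    then show ?thesis by (simp add: card_image)
  qed
  have ET: "?E \<subseteq> T" using subgroup_nat_pow_closed[OF E(2,4)] by blast
  have sec: "power_section q q {\<one>} T"
    unfolding power_section_def
    using E(2,3) Tq Ecard ET sep E(9) by (intro conjI exI[of _ ?E]) (auto simp: triv_subgroup)
  have cov: "covers {\<one>} ?E T"
  proof -
    have "x \<in> ?E" if xT: "x \<in> T" for x
    proof -
      obtain j :: int where j: "x = t [^] j" using Tpow[OF xT] by blast
      have "t [^] j = t [^] (int q * (j div int q) + j mod int q)" by simp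
      also have "\<dots> = (t [^] q) [^] (j div int q) \<otimes> t [^] (j mod int q)"
        unfolding int_pow_mult[OF tc] int_pow_pow[OF tc, symmetric] int_pow_int ..
      also have "\<dots> = t [^] (j mod int q)" unfolding q(2) using tc by simp
      also have "\<dots> = t [^] nat (j mod int q)" using q(1) by simp
      finally show ?thesis unfolding j using q(1) by (intro image_eqI[of _ _ "nat (j mod int q)"]) (auto simp: nat_less_iff simp del: pow_nat)
    qed
    moreover have "x = \<one> \<otimes> x" if "x \<in> T" for x using E(9)[OF that] by simp
    ultimately show ?thesis unfolding covers_def using ET by blast
  qed
  have "poly 1 ({\<one>} <#> T) h (carrier G <#> T)"
    by (rule poly_set_mult_central[OF poly T(2) q(1) Tq Tcentral])
  moreover have "{\<one>} <#> T = T" using E(9) unfolding set_mult_def by auto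
  moreover have "carrier G <#> T = carrier G"
    using subset_set_mult[OF E(2) order_refl] set_mult_closed[OF order_refl, of T] E(9) by blast
  ultimately have pT: "poly 1 T h (carrier G)" by simp
  have p1T: "poly 1 {\<one>} 0 T"
    using poly_fin[OF poly_base[OF triv_subgroup] T(1) q(1)] q(2) by simp
  show ?thesis
    using poly_section[OF pT p1T q(1) sec order_refl cov] q1 by auto
qed

end

section \<open>Comparison of the two groups\<close>

lemma power_section_transfer:
  assumes G: "group G" and H: "group H" and eq: "Con G = Con H" and fg: "finitely_generated G"
    and poly: "group.poly G 1 {\<one>\<^bsub>G\<^esub>} h (carrier G)"
    and sec: "group.power_section G p N S0 S" and cov: "group.covers G S0 F (carrier G)"
  shows "\<exists>T0 T. group.power_section H p N T0 T"
proof -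
  interpret G: group G by fact
  interpret H: group H by fact
  have S: "subgroup S0 G" "subgroup S G" "S0 \<subseteq> S"
    "\<And>x s. x \<in> S \<Longrightarrow> s \<in> S0 \<Longrightarrow> x \<otimes>\<^bsub>G\<^esub> s \<otimes>\<^bsub>G\<^esub> inv\<^bsub>G\<^esub> x \<in> S0"
    "\<And>x. x \<in> S \<Longrightarrow> x [^]\<^bsub>G\<^esub> p \<in> S0"
    using sec unfolding G.power_section_def by simp_all
  obtain D where D: "D \<subseteq> S" "finite D" "card D = N"
    "\<And>x y. x \<in> D \<Longrightarrow> y \<in> D \<Longrightarrow> x \<otimes>\<^bsub>G\<^esub> inv\<^bsub>G\<^esub> y \<in> S0 \<Longrightarrow> x = y"
    using sec unfolding G.power_section_def by auto
  obtain n :: nat where n: "0 < n" "\<And>x. x \<in> carrier G \<Longrightarrow> x [^]\<^bsub>G\<^esub> n \<in> S0"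
    using G.covers_exponent[OF cov G.subgroup_self S(1)] by blast
  \<comment> \<open>The transfer of quotients takes a normal subgroup of finite index, which
    \<open>S0\<close> need not be; \<open>V\<close> is one inside \<open>S0\<close>.\<close>
  define V where "V = G.pow_sub n (carrier G)"
  have V: "subgroup V G" "V \<subseteq> S0"
    unfolding V_def using G.pow_sub(1)[OF G.subgroup_self, of n] G.pow_sub(4)[OF G.subgroup_self S(1), of n] n(2) by auto
  have Vconj: "x \<otimes>\<^bsub>G\<^esub> v \<otimes>\<^bsub>G\<^esub> inv\<^bsub>G\<^esub> x \<in> V" if "x \<in> carrier G" "v \<in> V" for x v
    unfolding V_def by (rule G.pow_sub_conj[OF G.subgroup_self that(1) _ that(2)[unfolded V_def]]) (use that(1) in simp)
  have VG: "V \<lhd> G" unfolding G.normal_inv_iff using V(1) Vconj by blast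
  interpret V: normal V G by (rule VG)
  obtain FV where FV: "G.covers V FV (carrier G)" using G.pow_sub_covers[OF poly n(1)] unfolding V_def by blast
  have "rcosets\<^bsub>G\<^esub> V \<subseteq> (\<lambda>x. V #>\<^bsub>G\<^esub> x) ` FV"
  proof
    fix C assume "C \<in> rcosets\<^bsub>G\<^esub> V"
    then obtain x where x: "x \<in> carrier G" "C = V #>\<^bsub>G\<^esub> x" unfolding RCOSETS_def by blast
    obtain v f where vf: "v \<in> V" "f \<in> FV" "x = v \<otimes>\<^bsub>G\<^esub> f" "f \<in> carrier G"
      using FV x(1) unfolding G.covers_def by blast
    have "x \<in> V #>\<^bsub>G\<^esub> f" unfolding r_coset_def using vf(1,3) by blast
    then have "C = V #>\<^bsub>G\<^esub> f" unfolding x(2) by (rule G.repr_independence[OF _ vf(4) V(1), symmetric])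
    then show "C \<in> (\<lambda>x. V #>\<^bsub>G\<^esub> x) ` FV" using vf(2) by blast
  qed
  then have "finite (rcosets\<^bsub>G\<^esub> V)" using FV finite_subset unfolding G.covers_def by blast
  then obtain f where f: "f \<in> hom H (G Mod V)" "f ` carrier H = carrier (G Mod V)"
    using finite_quotient_transfer[OF G H eq fg VG] by blast
  interpret Q: group "G Mod V" by (rule V.factorgroup_is_group)
  interpret f: group_hom H "G Mod V" f using f(1) by unfold_locales
  interpret \<pi>: group_hom G "G Mod V" "\<lambda>x. V #>\<^bsub>G\<^esub> x" using V.r_coset_hom_Mod by unfold_locales
  \<comment> \<open>The two elements have the same image in \<open>G Mod V\<close>. This
    correspondence is multiplicative and determines \<open>x\<close> from \<open>y\<close> up to
    \<open>V\<close>; the sets \<open>P K\<close> below are the preimages in \<open>H\<close> of the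
    images of subgroups \<open>K\<close>.\<close>
  define R where "R y x \<longleftrightarrow> y \<in> carrier H \<and> x \<in> carrier G \<and> f y = V #>\<^bsub>G\<^esub> x" for y x
  have Rmult: "R (y \<otimes>\<^bsub>H\<^esub> y') (x \<otimes>\<^bsub>G\<^esub> x')" if "R y x" "R y' x'" for x y x' y'
    using that f.hom_mult[of y y'] \<pi>.hom_mult[of x x'] unfolding R_def by simp
  have Rinv: "R (inv\<^bsub>H\<^esub> y) (inv\<^bsub>G\<^esub> x)" if "R y x" for x y
    using that f.hom_inv[of y] \<pi>.hom_inv[of x] unfolding R_def by simp
  have Rpow: "R (y [^]\<^bsub>H\<^esub> m) (x [^]\<^bsub>G\<^esub> m)" if "R y x" for x y and m :: nat
    using that f.hom_nat_pow[of y m] \<pi>.hom_nat_pow[of x m] unfolding R_def by simp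
  have Rone: "R \<one>\<^bsub>H\<^esub> \<one>\<^bsub>G\<^esub>" using f.hom_one \<pi>.hom_one unfolding R_def by simp
  have Rex: "\<exists>y. R y x" if "x \<in> carrier G" for x
  proof -
    have "V #>\<^bsub>G\<^esub> x \<in> f ` carrier H" unfolding f(2) by (rule \<pi>.hom_closed[OF that])
    then show ?thesis using that unfolding R_def by auto
  qed
  have Runiq: "x \<otimes>\<^bsub>G\<^esub> inv\<^bsub>G\<^esub> x' \<in> V" if "R y x" "R y x'" for x x' y
  proof -
    have c: "x \<in> carrier G" "x' \<in> carrier G" and e: "V #>\<^bsub>G\<^esub> x' = V #>\<^bsub>G\<^esub> x" using that unfolding R_def by auto
    have "x \<in> V #>\<^bsub>G\<^esub> x'" by (rule G.repr_independenceD[OF V(1) c(1) e])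
    then obtain v where "v \<in> V" "x = v \<otimes>\<^bsub>G\<^esub> x'" unfolding r_coset_def by blast
    then show ?thesis using c V.mem_carrier by (simp add: G.m_assoc)
  qed
  define P where "P K = {y. \<exists>x\<in>K. R y x}" for K
  have Psub: "subgroup (P K) H" if K: "subgroup K G" for K
  proof (rule H.subgroupI)
    show "P K \<subseteq> carrier H" unfolding P_def R_def by blast
    show "P K \<noteq> {}" unfolding P_def using Rone subgroup.one_closed[OF K] by blast
    show "inv\<^bsub>H\<^esub> y \<in> P K" if "y \<in> P K" for y
      using that Rinv subgroup.m_inv_closed[OF K] unfolding P_def by blast
    show "y \<otimes>\<^bsub>H\<^esub> z \<in> P K" if "y \<in> P K" "z \<in> P K" for y z
      using that Rmult subgroup.m_closed[OF K] unfolding P_def by blast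
  qed
  \<comment> \<open>As \<open>V\<close> lies in \<open>S0\<close>, membership in \<open>P S0\<close>
    does not depend on the chosen partner in \<open>G\<close>; hence separated elements of
    \<open>D\<close> stay separated in \<open>H\<close>.\<close>
  have P0: "x \<in> S0" if y: "y \<in> P S0" and R: "R y x" for x y
  proof -
    obtain s where s: "s \<in> S0" "R y s" using y unfolding P_def by blast
    have "x \<otimes>\<^bsub>G\<^esub> inv\<^bsub>G\<^esub> s \<in> S0" using Runiq[OF R s(2)] V(2) by blast
    then have "(x \<otimes>\<^bsub>G\<^esub> inv\<^bsub>G\<^esub> s) \<otimes>\<^bsub>G\<^esub> s \<in> S0" using s(1) by (rule subgroup.m_closed[OF S(1)])
    moreover have "x \<in> carrier G" "s \<in> carrier G" using R s(2) unfolding R_def by auto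
    ultimately show ?thesis by (simp add: G.m_assoc)
  qed
  obtain g where g: "\<And>x. x \<in> carrier G \<Longrightarrow> R (g x) x" using Rex by metis
  have Dc: "D \<subseteq> carrier G" using D(1) subgroup.subset[OF S(2)] by blast
  have sep: "x = y" if "x \<in> D" "y \<in> D" "g x \<otimes>\<^bsub>H\<^esub> inv\<^bsub>H\<^esub> g y \<in> P S0" for x y
  proof -
    have "R (g x \<otimes>\<^bsub>H\<^esub> inv\<^bsub>H\<^esub> g y) (x \<otimes>\<^bsub>G\<^esub> inv\<^bsub>G\<^esub> y)" by (intro Rmult Rinv g) (use that Dc in auto)
    then show ?thesis using P0[OF that(3)] D(4)[OF that(1,2)] by blast
  qed
  have "inj_on g D"
  proof (rule inj_onI)
    fix x y assume xy: "x \<in> D" "y \<in> D" "g x = g y"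
    have "g y \<in> carrier H" using g[of y] xy(2) Dc unfolding R_def by blast
    then have "g x \<otimes>\<^bsub>H\<^esub> inv\<^bsub>H\<^esub> g y = \<one>\<^bsub>H\<^esub>" using xy(3) by simp
    then show "x = y" using sep[OF xy(1,2)] subgroup.one_closed[OF Psub[OF S(1)]] by simp
  qed
  then have card: "card (g ` D) = N" using D(3) by (simp add: card_image)
  have "H.power_section p N (P S0) (P S)"
    unfolding H.power_section_def
  proof (intro conjI ballI exI[of _ "g ` D"] impI)
    show "P S0 \<subseteq> P S" using S(3) unfolding P_def by blast
    show "y \<otimes>\<^bsub>H\<^esub> s \<otimes>\<^bsub>H\<^esub> inv\<^bsub>H\<^esub> y \<in> P S0" if y: "y \<in> P S" and s: "s \<in> P S0" for y s
    proof -
      obtain x where x: "x \<in> S" "R y x" using y unfolding P_def by blast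
      obtain u where u: "u \<in> S0" "R s u" using s unfolding P_def by blast
      have "R (y \<otimes>\<^bsub>H\<^esub> s \<otimes>\<^bsub>H\<^esub> inv\<^bsub>H\<^esub> y) (x \<otimes>\<^bsub>G\<^esub> u \<otimes>\<^bsub>G\<^esub> inv\<^bsub>G\<^esub> x)" by (intro Rmult Rinv x u)
      then show ?thesis using S(4)[OF x(1) u(1)] unfolding P_def by blast
    qed
    show "y [^]\<^bsub>H\<^esub> p \<in> P S0" if y: "y \<in> P S" for y
    proof -
      obtain x where x: "x \<in> S" "R y x" using y unfolding P_def by blast
      show ?thesis using Rpow[OF x(2), of p] S(5)[OF x(1)] unfolding P_def by blast
    qed
    show "g ` D \<subseteq> P S" using g D(1) Dc unfolding P_def by blast
    show "x = y" if "x \<in> g ` D" "y \<in> g ` D" "x \<otimes>\<^bsub>H\<^esub> inv\<^bsub>H\<^esub> y \<in> P S0" for x y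
      using that sep by blast
  qed (use Psub S card D(2) in auto)
  then show ?thesis by blast
qed

text \<open>A section with \<open>p ^ h\<close> elements, grown in \<open>G\<close> from the trivial
  one, has a counterpart in \<open>H\<close>, where sections of exponent \<open>p\<close> are
  bounded by \<open>p ^ k\<close>.\<close>

lemma hirsch_length_le:
  assumes G: "group G" and H: "group H" and eq: "Con G = Con H" and fg: "finitely_generated G"
    and pG: "group.poly G 1 {\<one>\<^bsub>G\<^esub>} h (carrier G)" and pH: "group.poly H 1 {\<one>\<^bsub>H\<^esub>} k (carrier H)"
  shows "h \<le> k"
proof -
  interpret G: group G by fact
  interpret H: group H by fact
  obtain M where M: "0 < M" "\<forall>p. coprime p M \<longrightarrow> H.poly p {\<one>\<^bsub>H\<^esub>} k (carrier H)"
    using H.poly_coprime[OF pH] by blast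
  \<comment> \<open>Any integer above 1 and prime to \<open>M\<close> would do; \<open>Suc M\<close>
    is one because \<open>M\<close> is positive.\<close>
  define p where "p = Suc M"
  have p: "1 < p" "H.poly p {\<one>\<^bsub>H\<^esub>} k (carrier H)" using M unfolding p_def by auto
  have "G.poly 1 {\<one>\<^bsub>G\<^esub>} 0 {\<one>\<^bsub>G\<^esub>}" by (rule G.poly_base[OF G.triv_subgroup])
  moreover have "G.power_section p 1 {\<one>\<^bsub>G\<^esub>} {\<one>\<^bsub>G\<^esub>}"
    unfolding G.power_section_def using G.triv_subgroup by (intro conjI exI[of _ "{\<one>\<^bsub>G\<^esub>}"]) auto
  moreover have "G.covers {\<one>\<^bsub>G\<^esub>} {\<one>\<^bsub>G\<^esub>} {\<one>\<^bsub>G\<^esub>}" unfolding G.covers_def by simp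
  ultimately obtain S0 S F where "G.power_section p (1 * p ^ h) S0 S" "G.covers S0 F (carrier G)"
    using G.poly_section[OF pG, of 0 p 1 "{\<one>\<^bsub>G\<^esub>}" "{\<one>\<^bsub>G\<^esub>}" "{\<one>\<^bsub>G\<^esub>}"] p(1) by auto
  then obtain T0 T where T: "H.power_section p (1 * p ^ h) T0 T"
    using power_section_transfer[OF G H eq fg pG] by blast
  have "T \<subseteq> carrier H" using T subgroup.subset unfolding H.power_section_def by blast
  then have "p ^ h \<le> p ^ k" using H.power_section_le[OF p(2) _ T] p(1) by simp
  then show ?thesis using p(1) by simp
qed

theorem proposition2p5:
  fixes G :: "('a, 'c) monoid_scheme" and H :: "('b, 'd) monoid_scheme"
    and c h :: nat
  assumes "group G" and "finitely_generated G"
    and "group H" and "finitely_generated H"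
    and "configuration_equivalent G H"
    and "torsion_free G" and "nilpotent_of_class G c" and "has_hirsch_length G h"
  shows "torsion_free H \<and> nilpotent_of_class H c \<and> has_hirsch_length H h"
proof -
  interpret G: group G by fact
  interpret H: group H by fact
  note fgG = \<open>finitely_generated G\<close> and fgH = \<open>finitely_generated H\<close>
  have eq: "Con G = Con H" using assms(5) unfolding configuration_equivalent_def .
  have cG: "lower_central G c = {\<one>\<^bsub>G\<^esub>}" using assms(7) unfolding nilpotent_of_class_def by blast
  have cH: "lower_central H c = {\<one>\<^bsub>H\<^esub>}"
    by (rule lower_central_transfer[OF assms(3,1) eq[symmetric] fgH cG])
  have "lower_central H d \<noteq> {\<one>\<^bsub>H\<^esub>}" if "d < c" for d
    using lower_central_transfer[OF assms(1,3) eq fgG, of d] assms(7) that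
    unfolding nilpotent_of_class_def by blast
  then have nil: "nilpotent_of_class H c" using cH unfolding nilpotent_of_class_def by blast
  have pG: "G.poly 1 {\<one>\<^bsub>G\<^esub>} h (carrier G)" by (rule G.poly_of_has_hirsch_length[OF assms(8)])
  \<comment> \<open>Nilpotency is transferred first because it makes the finitely generated group
    \<open>H\<close> polycyclic, so that Hirsch lengths can be compared.\<close>
  obtain k where pH: "H.poly 1 {\<one>\<^bsub>H\<^esub>} k (carrier H)" using H.poly_of_fg_nilpotent[OF fgH cH] ..
  have hk: "h = k"
    using hirsch_length_le[OF assms(1,3) eq fgG pG pH]
      hirsch_length_le[OF assms(3,1) eq[symmetric] fgH pH pG] by simp
  have "torsion_free H"
  proof (rule ccontr)
    assume "\<not> torsion_free H"
    then obtain q S0 S F where q: "1 < q" "H.power_section q (q ^ Suc k) S0 S" "H.covers S0 F (carrier H)"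
      using H.torsion_section[OF pH cH] by blast
    obtain T0 T where T: "G.power_section q (q ^ Suc k) T0 T"
      using power_section_transfer[OF assms(3,1) eq[symmetric] fgH pH q(2,3)] by blast
    \<comment> \<open>\<open>q\<close> may share factors with the finite factors in
      \<open>pG\<close>, so the bound is taken from a series without nontrivial finite factors,
      valid for every exponent.\<close>
    obtain h0 where h0: "G.poly 0 {\<one>\<^bsub>G\<^esub>} h0 (carrier G)"
      using G.poly_0_of_torsion_free_nilpotent[OF pG assms(6) cG] ..
    have "T \<subseteq> carrier G" using T subgroup.subset unfolding G.power_section_def by blast
    then have "q ^ Suc k \<le> q ^ h0" using G.power_section_le[OF G.poly_0_imp[OF h0] _ T] q(1) by simp
    then have "Suc k \<le> h0" using q(1) by (simp del: power_Suc)
    \<comment> \<open>Comparing \<open>G\<close> with itself relates the new series to the given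
      one.\<close>
    moreover have "h0 \<le> h" by (rule hirsch_length_le[OF assms(1,1) refl fgG G.poly_0_imp[OF h0] pG])
    ultimately show False using hk by simp
  qed
  moreover have "has_hirsch_length H h" unfolding hk by (rule H.has_hirsch_length_of_poly[OF pH])
  ultimately show ?thesis using nil by blast
qed

end
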